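(* Let $m\ge1$, let $1\le r_i\le p_i<\infty$ for $1\le i\le m$, let $1\le r_{m+1}<\infty$, put $\frac1p=\sum_{i=1}^m\frac1{p_i}$ and assume $\frac1p>\frac1{r_{m+1}'}$. Let $\alpha_i\in(0,p_i]$ for $1\le i\le m$, and define $\widetilde r$ by $\frac1{\widetilde r}=\sum_{i=1}^m\frac1{r_i}$. Let $\varphi:(0,\infty)\to(0,\infty)$ be nondecreasing. Then there is a nondecreasing function $\psi:(0,\infty)\to(0,\infty)$, depending only on $n$, $m$, $\varphi$ and the exponents $p_i,r_i,r_{m+1},\alpha_i$, with the following property. Let $f_1,\dots,f_m$ and $g$ be measurable functions on $\mathbb R^n$ such that for all $\vec w=(w_1,\dots,w_m)\in A_{\vec p,\vec r}^{\mathcal R}$ $$\|g\|_{L^{p,\infty}\left(\prod_{i=1}^m w_i^{p/p_i}\right)}\le\varphi\big([\vec w]_{A_{\vec p,\vec r}^{\mathcal R}}\big)\prod_{i=1}^m\|f_i\|_{L^{p_i,\alpha_i}(w_i)}.$$ Then for all $\vec v=(v_1,\dots,v_m)\in A_{(r_1,\dots,r_m),\vec r}$ $$\|g\|_{L^{\widetilde r,\infty}\left(\prod_{i=1}^m v_i^{\widetilde r/r_i}\right)}\le\psi\big([\vec v]_{A_{(r_1,\dots,r_m),\vec r}}\big)\prod_{i=1}^m\|f_i\|_{L^{r_i,\alpha_i r_i/p_i}(v_i)}.$$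
   Context: A weight is an a.e. positive measurable function on $\mathbb R^n$, identified with the measure $w\,dx$. All cubes $Q$ are cubes in $\mathbb R^n$. $r'$ denotes the conjugate exponent, with $1'=\infty$ and $1/\infty=0$. Lorentz quasi-norms: for $0<p<\infty$ and $0<\alpha<\infty$, $\|f\|_{L^{p,\alpha}(w)}=\big(p\int_0^\infty s^{\alpha-1}\,w(\{|f|>s\})^{\alpha/p}\,ds\big)^{1/\alpha}$ (other usual normalizations differ by a constant factor), and $\|f\|_{L^{p,\infty}(w)}=\sup_{t>0}t\,w(\{|f|>t\})^{1/p}$. Class $A_{\vec p,\vec r}^{\mathcal R}$: let $\vec p=(p_1,\dots,p_m)$, $\vec r=(r_1,\dots,r_{m+1})$ with $1\le r_1,\dots,r_{m+1}<\infty$, $r_i\le p_i<\infty$ for $1\le i\le m$, $\frac1p=\sum_{i=1}^m\frac1{p_i}$, $p<r_{m+1}'$. Put $\frac1{p_{m+1}}=1-\frac1p$ and $\frac1{\delta_i}=\frac1{r_i}-\frac1{p_i}$ for $1\le i\le m+1$ (so $\frac1{\delta_{m+1}}=\frac1p-\frac1{r_{m+1}'}>0$). For $\vec w=(w_1,\dots,w_m)$ set $w=\prod_{i=1}^m w_i^{p/p_i}$. Then $\vec w\in A_{\vec p,\vec r}^{\mathcal R}$ if $$[\vec w]_{A_{\vec p,\vec r}^{\mathcal R}}:=\sup_Q\Big(\frac1{|Q|}\int_Q w^{\frac{\delta_{m+1}}p}\Big)^{\frac1{\delta_{m+1}}}\prod_{i=1}^m\big\|\chi_Q w_i^{-\frac1{p_i}}\big\|_{L^{\delta_i,\infty}\left(\frac{dx}{|Q|}\right)}<\infty,$$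 where, if $r_i=p_i$ (i.e. $\delta_i=\infty$), the $i$-th factor is $\operatorname{ess\,sup}_Q w_i^{-1/p_i}$. The class $A_{(r_1,\dots,r_m),\vec r}$ is the case $p_i=r_i$ for all $1\le i\le m$: with $\frac1{\widetilde r}=\sum_{i=1}^m\frac1{r_i}$ and $\frac1\delta=\frac1{\widetilde r}-\frac1{r_{m+1}'}$, $\vec v$ belongs to it if $$[\vec v]_{A_{(r_1,\dots,r_m),\vec r}}:=\sup_Q\Big(\frac1{|Q|}\int_Q\prod_{i=1}^m v_i^{\frac{\delta}{r_i}}\Big)^{\frac1\delta}\prod_{i=1}^m\operatorname{ess\,sup}_Q v_i^{-\frac1{r_i}}<\infty.$$ The convention $0\cdot\infty=\infty$ is used in products of norms on right-hand sides. *)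

theory Defs
  imports "HOL-Analysis.Analysis" "HOL-Probability.Essential_Supremum"
begin

(* Powers of elements of [0,\<infinity>]; only meant for exponents a > 0,
   for which 0 powr a = 0 and \<infinity> powr a = \<infinity>. *)
definition epowr :: "ennreal \<Rightarrow> real \<Rightarrow> ennreal" (infixr "epowr" 80) where
  "x epowr a = (if x = \<infinity> then \<infinity> else ennreal (enn2real x powr a))"

(* Product of norms with the convention 0 * \<infinity> = \<infinity>
   (multiplication on ennreal itself satisfies 0 * \<infinity> = 0). *)
definition norm_prod :: "('i \<Rightarrow> ennreal) \<Rightarrow> 'i set \<Rightarrow> ennreal" where
  "norm_prod N I = (if \<exists>i\<in>I. N i = \<infinity> then \<infinity> else \<Prod>i\<in>I. N i)"

definition is_weight :: "(real^'n \<Rightarrow> real) \<Rightarrow> bool" where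
  "is_weight w \<longleftrightarrow> w \<in> borel_measurable lebesgue \<and> (AE x in lebesgue. 0 < w x)"

definition weight_measure :: "(real^'n \<Rightarrow> real) \<Rightarrow> (real^'n) measure" where
  "weight_measure w = density lebesgue (\<lambda>x. ennreal (w x))"

definition lorentz_norm ::
    "'a measure \<Rightarrow> real \<Rightarrow> real \<Rightarrow> ('a \<Rightarrow> 'b::real_normed_vector) \<Rightarrow> ennreal" where
  "lorentz_norm M p \<alpha> f =
     (ennreal p * (\<integral>\<^sup>+ s\<in>{0<..}. ennreal (s powr (\<alpha> - 1)) *
        emeasure M {x \<in> space M. norm (f x) > s} epowr (\<alpha> / p) \<partial>lborel)) epowr (1 / \<alpha>)"

definition weak_lorentz_norm ::
    "'a measure \<Rightarrow> real \<Rightarrow> ('a \<Rightarrow> 'b::real_normed_vector) \<Rightarrow> ennreal" where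
  "weak_lorentz_norm M p f =
     (SUP t\<in>{0<..}. ennreal t * emeasure M {x \<in> space M. norm (f x) > t} epowr (1 / p))"

(* Cubes with sides parallel to the axes. *)
definition cubes :: "(real^'n) set set" where
  "cubes = {cbox a (\<chi> i. a $ i + l) | a l. 0 < l}"

(* Lebesgue measure divided by |Q|; it is not restricted to Q. *)
definition normalized_lebesgue :: "(real^'n) set \<Rightarrow> (real^'n) measure" where
  "normalized_lebesgue Q = scale_measure (1 / emeasure lebesgue Q) lebesgue"

(* 1/r', where r' is the conjugate exponent (r' = \<infinity> if r = 1) *)
definition inv_conj :: "real \<Rightarrow> real" where
  "inv_conj r = 1 - 1 / r"

(* p with 1/p = 1/p_1 + ... + 1/p_m *)
definition total_exp :: "nat \<Rightarrow> (nat \<Rightarrow> real) \<Rightarrow> real" where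
  "total_exp m ps = 1 / (\<Sum>i=1..m. 1 / ps i)"

(* 1/p_i for 1 \<le> i \<le> m + 1, where 1/p_(m+1) = 1 - 1/p may be zero or negative;
   the value ps (m + 1) is never used. *)
definition inv_exp :: "nat \<Rightarrow> (nat \<Rightarrow> real) \<Rightarrow> nat \<Rightarrow> real" where
  "inv_exp m ps i = (if i = m + 1 then 1 - 1 / total_exp m ps else 1 / ps i)"

(* \<delta>_i; the value 0 = 1 / 0 occurs when r_i = p_i and then stands for \<delta>_i = \<infinity>. *)
definition delta_exp :: "nat \<Rightarrow> (nat \<Rightarrow> real) \<Rightarrow> (nat \<Rightarrow> real) \<Rightarrow> nat \<Rightarrow> real" where
  "delta_exp m ps r i = 1 / (1 / r i - inv_exp m ps i)"

definition prod_weight ::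
    "nat \<Rightarrow> (nat \<Rightarrow> real) \<Rightarrow> (nat \<Rightarrow> real^'n \<Rightarrow> real) \<Rightarrow> real^'n \<Rightarrow> real" where
  "prod_weight m ps w x = (\<Prod>i=1..m. w i x powr (total_exp m ps / ps i))"

(* For weights all factors below are nonzero, so no convention on 0 * \<infinity> is needed. *)
definition AR_const ::
    "nat \<Rightarrow> (nat \<Rightarrow> real) \<Rightarrow> (nat \<Rightarrow> real) \<Rightarrow> (nat \<Rightarrow> real^'n \<Rightarrow> real) \<Rightarrow> ennreal" where
  "AR_const m ps r w =
     (SUP Q\<in>cubes.
        ((\<integral>\<^sup>+ x\<in>Q. ennreal (prod_weight m ps w x
              powr (delta_exp m ps r (m + 1) / total_exp m ps)) \<partial>lebesgue)
          / emeasure lebesgue Q) epowr (1 / delta_exp m ps r (m + 1))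
        * (\<Prod>i=1..m.
            if r i = ps i
            then esssup (restrict_space lebesgue Q) (\<lambda>x. ennreal (w i x powr (- 1 / ps i)))
            else weak_lorentz_norm (normalized_lebesgue Q) (delta_exp m ps r i)
                   (\<lambda>x. indicator Q x * w i x powr (- 1 / ps i))))"

definition AR_class ::
    "nat \<Rightarrow> (nat \<Rightarrow> real) \<Rightarrow> (nat \<Rightarrow> real) \<Rightarrow> (nat \<Rightarrow> real^'n \<Rightarrow> real) set" where
  "AR_class m ps r = {w. (\<forall>i\<in>{1..m}. is_weight (w i)) \<and> AR_const m ps r w < \<infinity>}"

(* The class A_((r_1,...,r_m),r) is AR_class m r r. *)
lemma AR_const_diagonal:
  fixes v :: "nat \<Rightarrow> real^'n \<Rightarrow> real"
  assumes "1 \<le> m" and "\<And>i. i \<in> {1..m} \<Longrightarrow> 1 \<le> r i"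
  defines "\<delta> \<equiv> 1 / (1 / total_exp m r - inv_conj (r (m + 1)))"
  shows "AR_const m r r v =
     (SUP Q\<in>cubes.
        ((\<integral>\<^sup>+ x\<in>Q. ennreal (\<Prod>i=1..m. v i x powr (\<delta> / r i)) \<partial>lebesgue)
          / emeasure lebesgue Q) epowr (1 / \<delta>)
        * (\<Prod>i=1..m. esssup (restrict_space lebesgue Q)
             (\<lambda>x. ennreal (v i x powr (- 1 / r i)))))"
proof -
  have "0 < (\<Sum>i=1..m. 1 / r i)"
    using assms(1,2) by (intro sum_pos) force+
  then have p: "0 < total_exp m r"
    by (simp add: total_exp_def)
  have d: "delta_exp m r r (m + 1) = \<delta>"
    by (simp add: delta_exp_def inv_exp_def inv_conj_def \<delta>_def)
  have "prod_weight m r v x powr (\<delta> / total_exp m r) = (\<Prod>i=1..m. v i x powr (\<delta> / r i))"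
    for x
    unfolding prod_weight_def using p by (subst prod_powr_distrib) (simp_all add: powr_powr)
  then show ?thesis
    unfolding AR_const_def d by simp
qed

end

(* Put V = prod_i v_i^(1/r_i). The condition on v says that omega = V^delta is an A_1 weight and that
   its averages are controlled by the essential infima of the v_i. Normalize the norms of the f_i to 1.
   Then k = sum_i |f_i|^(r_i) v_i is integrable. Let h be the maximal function of k/omega with respect
   to omega dx and take w_i^(1/p_i) = (h omega)^(-1/delta_i) v_i^(1/r_i). Since k <= h omega, the norm
   of f_i in L^(p_i,alpha_i)(w_i) is bounded. The product weight of w is controlled from below by that
   of v wherever h omega^beta is not large, where beta = 1 - rho/delta and rho is the r-tilde of the
   statement; the remaining set is small by a mixed weak type inequality of Sawyer type for A_1 weights,
       s * integral of omega^(1-beta) over {h omega^beta > s} <= C * integral of k   (0 <= beta <= 1).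
   The case beta = 1 of the same inequality, localized to a cube Q, bounds the L^(1,infinity)(dx/|Q|)
   norm of h omega by the infimum of h times the average of omega, which puts w in the class. *)
theory Submission
  imports Defs
begin

section \<open>Shifted dyadic grids\<close>

text \<open>The weak norms L^(delta_i,infinity) in the class fit a single maximal function: a weak
  L^1 bound for h omega on a cube puts its power 1/delta_i into weak L^(delta_i). If L is the
  infimum of h on the cube, these factors together contribute L^G with G the sum of the 1/delta_i,
  while the average of the product weight contributes L^(-G). So the class constant of w is bounded
  independently of the f_i. The obstacle is the mixed inequality. There a power of omega multiplies
  the maximal function inside the level set, and cutting along the level sets of omega produces a
  different family of maximal cubes for every level. Summing over the levels relies on the
  A_infinity behaviour of omega, obtained here as geometric decay of the omega-mass of the set where
  omega is large on a dyadic cube. The condition alpha_i <= p_i enters as alpha_i r_i / p_i <= r_i: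
  then the Lorentz norm of f_i dominates its L^(r_i) norm, and k is integrable. Vanishing norms are
  approached by positive bounds.\<close>

text \<open>The shift by \<open>1/3\<close> in the coordinates from \<open>T\<close> alternates its sign with the level; this
  makes the cubes of one grid nested, while at every level the cubes of the \<open>2^n\<close> grids together
  contain all small cubes.\<close>
definition dyadic_index :: "'n::finite set \<Rightarrow> int \<Rightarrow> real^'n \<Rightarrow> int^'n" where
  "dyadic_index T k x =
     (\<chi> i. \<lfloor>x $ i * 2 powi k - (if even k then 1 else -1) * of_bool (i \<in> T) / 3\<rfloor>)"

text \<open>Fibres of the index map, hence half-open cubes of side \<open>2 powi (- k)\<close> which
  partition the space. Larger \<open>k\<close> means smaller cubes.\<close>

definition dyadic_cube :: "'n::finite set \<Rightarrow> int \<Rightarrow> real^'n \<Rightarrow> (real^'n) set" where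
  "dyadic_cube T k x = {y. dyadic_index T k y = dyadic_index T k x}"

definition dyadic_grid :: "'n::finite set \<Rightarrow> (real^'n) set set" where
  "dyadic_grid T = {dyadic_cube T k x | k x. True}"

lemma dyadic_cube_self [simp]: "x \<in> dyadic_cube T k x"
  by (simp add: dyadic_cube_def)

lemma dyadic_cube_eq: "y \<in> dyadic_cube T k x \<Longrightarrow> dyadic_cube T k y = dyadic_cube T k x"
  by (auto simp: dyadic_cube_def)

lemma countable_dyadic_grid: "countable (dyadic_grid T)"
proof -
  have "dyadic_grid T \<subseteq> range (\<lambda>(k, z). {y. dyadic_index T k y = z})"
    by (auto simp: dyadic_grid_def dyadic_cube_def)
  then show ?thesis
    by (rule countable_subset) auto
qed

text \<open>If e/3 is the shift at level \<open>k\<close>, then -e/3 is the shift at level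
  \<open>k + 1\<close>, and 2 (e/3) + e/3 = e is an integer. Hence halving the finer index
  determines the coarser one, which is the nesting of one grid.\<close>

lemma dyadic_index_Suc:
  fixes x :: "real^'n::finite"
  shows "dyadic_index T k x $ i =
    (dyadic_index T (k + 1) x $ i - (if even k then 1 else -1) * of_bool (i \<in> T)) div 2"
proof -
  define e :: int where "e = (if even k then 1 else -1) * of_bool (i \<in> T)"
  define X where "X = x $ i * 2 powi k - real_of_int e / 3"
  have 1: "dyadic_index T k x $ i = \<lfloor>X\<rfloor>"
    by (simp add: dyadic_index_def X_def e_def)
  have "x $ i * 2 powi (k + 1) - (if even (k + 1) then 1 else -1) * of_bool (i \<in> T) / 3
      = 2 * X + of_int e"
    by (simp add: X_def e_def power_int_add algebra_simps)
  then have "dyadic_index T (k + 1) x $ i = \<lfloor>2 * X\<rfloor> + e"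
    by (simp add: dyadic_index_def del: floor_diff_of_int)
  moreover have "\<lfloor>2 * X\<rfloor> div 2 = \<lfloor>X\<rfloor>"
    by (metis floor_divide_real_eq_div nonzero_mult_div_cancel_left of_int_numeral zero_le_numeral zero_neq_numeral)
  ultimately show ?thesis
    using 1 by (simp add: e_def)
qed

lemma dyadic_cube_mono:
  assumes "j \<le> k" shows "dyadic_cube T k x \<subseteq> dyadic_cube T j x"
proof -
  have "dyadic_cube T (j + int n) x \<subseteq> dyadic_cube T j x" for n
  proof (induction n)
    case (Suc n)
    have "dyadic_cube T (j + int n + 1) x \<subseteq> dyadic_cube T (j + int n) x"
      by (auto simp: dyadic_cube_def vec_eq_iff dyadic_index_Suc[of _ "j + int n"])
    then show ?case using Suc by (simp add: add.assoc add.commute[of 1])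
  qed simp
  from this[of "nat (k - j)"] show ?thesis using assms by simp
qed

abbreviation cube :: "real^'n \<Rightarrow> real \<Rightarrow> (real^'n) set" where
  "cube a l \<equiv> cbox a (\<chi> i. a $ i + l)"

text \<open>The two inclusions give the volume of the half-open cube, and the second one transfers
  conditions stated for closed cubes.\<close>

lemma dyadic_cube_box:
  fixes x :: "real^'n::finite"
  obtains a :: "real^'n" where
    "box a (\<chi> i. a $ i + 2 powi (- k)) \<subseteq> dyadic_cube T k x"
    "dyadic_cube T k x \<subseteq> cube a (2 powi (- k))"
proof
  define e where "e i = (if even k then 1 else -1) * of_bool (i \<in> T) / (3::real)" for i
  define z where "z = dyadic_index T k x"
  define a :: "real^'n" where "a = (\<chi> i. (z $ i + e i) * 2 powi (- k))"
  have p: "(2::real) powi k > 0" "2 powi (-k) = 1 / (2::real) powi k"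
    by (auto simp: power_int_minus field_simps)
  have iff: "y \<in> dyadic_cube T k x \<longleftrightarrow> (\<forall>i. a $ i \<le> y $ i \<and> y $ i < a $ i + 2 powi (-k))" for y
  proof -
    have "y \<in> dyadic_cube T k x \<longleftrightarrow> (\<forall>i. \<lfloor>y $ i * 2 powi k - e i\<rfloor> = z $ i)"
      by (simp add: dyadic_cube_def vec_eq_iff z_def[symmetric]) (simp add: dyadic_index_def e_def)
    also have "\<dots> \<longleftrightarrow> (\<forall>i. a $ i \<le> y $ i \<and> y $ i < a $ i + 2 powi (-k))"
      unfolding floor_eq_iff a_def p(2) using p(1) by (auto simp: field_simps)
    finally show ?thesis .
  qed
  show "box a (\<chi> i. a $ i + 2 powi (- k)) \<subseteq> dyadic_cube T k x"
    by (force simp: iff mem_box_cart intro: less_imp_le)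
  show "dyadic_cube T k x \<subseteq> cube a (2 powi (- k))"
    by (force simp: iff mem_box_cart intro: less_imp_le)
qed

lemma emeasure_cube:
  fixes a :: "real^'n::finite"
  assumes "0 < l"
  shows "emeasure lebesgue (cube a l) = ennreal (l ^ CARD('n))"
    and "emeasure lebesgue (box a (\<chi> i. a $ i + l)) = ennreal (l ^ CARD('n))"
proof -
  have B: "(Basis::(real^'n) set) = range (\<lambda>i. axis i 1)"
    by (auto simp: Basis_vec_def)
  have inj: "inj (\<lambda>i::'n. axis i (1::real))"
    by (auto simp: inj_on_def axis_eq_axis)
  have *: "(\<Prod>b\<in>Basis. ((\<chi> i. a $ i + l) - a) \<bullet> b) = l ^ CARD('n)"
    unfolding B by (subst prod.reindex[OF inj]) (simp add: inner_axis)
  have **: "a \<bullet> b \<le> (\<chi> i. a $ i + l) \<bullet> b" if "b \<in> Basis" for b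
    using that assms unfolding B by (auto simp: inner_axis)
  show "emeasure lebesgue (cube a l) = ennreal (l ^ CARD('n))"
    using ** * by (simp add: emeasure_lborel_cbox_eq)
  show "emeasure lebesgue (box a (\<chi> i. a $ i + l)) = ennreal (l ^ CARD('n))"
    using ** * by (simp add: emeasure_lborel_box_eq)
qed

lemma cube_not_null:
  fixes a :: "real^'n::finite"
  assumes "0 < l" shows "\<not> (AE x in lebesgue. x \<notin> cube a l)"
proof
  assume "AE x in lebesgue. x \<notin> cube a l"
  then have "cube a l \<in> null_sets lebesgue" by (subst (asm) AE_iff_null_sets[symmetric]) auto
  then have "emeasure lebesgue (cube a l) = 0" by auto
  then show False using assms unfolding emeasure_cube(1)[OF assms] by simp
qed

lemma sets_dyadic_cube [measurable, simp]: "dyadic_cube T k x \<in> sets borel"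
proof -
  have "dyadic_cube T k x = {y\<in>space borel. \<forall>i. \<lfloor>y $ i * 2 powi k - (if even k then 1 else -1) * of_bool (i \<in> T) / 3\<rfloor> = dyadic_index T k x $ i}"
    by (auto simp: dyadic_cube_def vec_eq_iff dyadic_index_def)
  also have "\<dots> \<in> sets borel"
    by measurable
  finally show ?thesis .
qed

lemma sets_dyadic_grid: "P \<in> dyadic_grid T \<Longrightarrow> P \<in> sets borel"
  by (auto simp: dyadic_grid_def)

lemma emeasure_dyadic_cube:
  fixes x :: "real^'n::finite"
  shows "emeasure lebesgue (dyadic_cube T k x) = ennreal ((2 powi (- k)) ^ CARD('n))"
proof -
  obtain a where a: "box a (\<chi> i. a $ i + 2 powi (- k)) \<subseteq> dyadic_cube T k x"
    "dyadic_cube T k x \<subseteq> cube a (2 powi (- k))"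
    by (rule dyadic_cube_box)
  have "emeasure lebesgue (dyadic_cube T k x) \<le> emeasure lebesgue (cube a (2 powi (- k)))"
    by (rule emeasure_mono[OF a(2)]) simp
  moreover have "emeasure lebesgue (box a (\<chi> i. a $ i + 2 powi (- k))) \<le> emeasure lebesgue (dyadic_cube T k x)"
    by (rule emeasure_mono[OF a(1)]) simp
  ultimately show ?thesis
    by (simp only: emeasure_cube zero_less_power_int zero_less_numeral antisym)
qed

lemma laminar_dyadic_grid:
  assumes "P \<in> dyadic_grid T" "Q \<in> dyadic_grid T" "P \<inter> Q \<noteq> {}"
  shows "P \<subseteq> Q \<or> Q \<subseteq> P"
proof -
  obtain k x j y where PQ: "P = dyadic_cube T k x" "Q = dyadic_cube T j y"
    using assms by (auto simp: dyadic_grid_def)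
  obtain z where "z \<in> P" "z \<in> Q" using assms(3) by auto
  then have "P = dyadic_cube T k z" "Q = dyadic_cube T j z"
    by (auto simp: PQ dest: dyadic_cube_eq)
  then show ?thesis
    using dyadic_cube_mono[of k j T z] dyadic_cube_mono[of j k T z] by (cases "k \<le> j") auto
qed

lemma dyadic_cube_subset_level:
  assumes "dyadic_cube T k x \<subseteq> dyadic_cube T j y"
  shows "j \<le> k"
proof -
  have "emeasure lebesgue (dyadic_cube T k x) \<le> emeasure lebesgue (dyadic_cube T j y)"
    using assms by (intro emeasure_mono) auto
  then have "(2::real) powi (- k) \<le> 2 powi (- j)"
    unfolding emeasure_dyadic_cube by (simp add: ennreal_le_iff power_mono_iff)
  then show ?thesis
    using power_int_strict_increasing[of "-j" "-k" "2::real"] by force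
qed

text \<open>All these cubes contain a fixed point of \<open>P\<close>, so each is determined by its
  level, and comparing volumes confines the level. This finiteness is what makes maximal cubes
  exist.\<close>

lemma finite_between_dyadic_grid:
  assumes "P \<in> dyadic_grid T" "Q \<in> dyadic_grid T"
  shows "finite {R \<in> dyadic_grid T. P \<subseteq> R \<and> R \<subseteq> Q}"
proof -
  obtain k x j y where PQ: "P = dyadic_cube T k x" "Q = dyadic_cube T j y"
    using assms by (auto simp: dyadic_grid_def)
  have "{R \<in> dyadic_grid T. P \<subseteq> R \<and> R \<subseteq> Q} \<subseteq> (\<lambda>i. dyadic_cube T i x) ` {j..k}"
  proof
    fix R assume R: "R \<in> {R \<in> dyadic_grid T. P \<subseteq> R \<and> R \<subseteq> Q}"
    then obtain i z where Ri: "R = dyadic_cube T i z" by (auto simp: dyadic_grid_def)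
    have "j \<le> i" "i \<le> k" using R dyadic_cube_subset_level by (auto simp: PQ Ri)
    moreover have "x \<in> R" using R by (auto simp: PQ)
    then have "R = dyadic_cube T i x" using Ri dyadic_cube_eq by metis
    ultimately show "R \<in> (\<lambda>i. dyadic_cube T i x) ` {j..k}" by auto
  qed
  then show ?thesis by (rule finite_subset) simp
qed

text \<open>A proper inclusion forces a level difference of at least one, so the cube one level up
  is still inside \<open>P\<close>. It supplies the upper bound for averages on maximal
  cubes.\<close>

lemma dyadic_parent:
  fixes P R :: "(real^'n::finite) set"
  assumes "P \<in> dyadic_grid T" "R \<in> dyadic_grid T" "R \<subset> P"
  obtains R' where "R' \<in> dyadic_grid T" "R \<subset> R'" "R' \<subseteq> P"
    "emeasure lebesgue R' = 2 ^ CARD('n) * emeasure lebesgue R"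
proof -
  obtain k x j y where PQ: "R = dyadic_cube T k x" "P = dyadic_cube T j y"
    using assms by (auto simp: dyadic_grid_def)
  have P: "P = dyadic_cube T j x"
    using assms(3) dyadic_cube_eq[of x T j y] dyadic_cube_self[of x T k] PQ by blast
  have jk: "j < k"
    using assms(3) dyadic_cube_mono[of k j T x] PQ P by (metis dual_order.strict_iff_not linorder_not_le)
  define R' where "R' = dyadic_cube T (k - 1) x"
  have e: "emeasure lebesgue R' = 2 ^ CARD('n) * emeasure lebesgue R"
  proof -
    have "(2::real) powi (1 - k) = 2 * 2 powi (- k)"
      by (simp add: power_int_diff power_int_minus field_simps)
    then show ?thesis
      unfolding R'_def PQ emeasure_dyadic_cube
      by (simp add: power_mult_distrib ennreal_mult ennreal_power[symmetric])
  qed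
  have "R \<noteq> R'"
  proof
    assume "R = R'"
    then have "k \<le> k - 1"
      using dyadic_cube_subset_level[of T "k-1" x k x] by (simp add: R'_def PQ(1))
    then show False by simp
  qed
  moreover have "R \<subseteq> R'" unfolding R'_def PQ by (rule dyadic_cube_mono) simp
  moreover have "R' \<subseteq> P" unfolding R'_def P using jk by (intro dyadic_cube_mono) simp
  moreover have "R' \<in> dyadic_grid T" by (auto simp: R'_def dyadic_grid_def)
  ultimately show thesis using that e by blast
qed

text \<open>Choose the level with 3 l < 2^(-k) <= 6 l, so that in units of the dyadic side the cube
  has side L < 1/3. A coordinate is shifted exactly if its interval [X, X + L] crosses an integer.
  The crossing then lies within distance L < 1/3 of both ends, so a shift by 1/3 in either direction
  moves the interval off the integers, and the sign prescribed by the parity of the level is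
  harmless.\<close>

lemma cube_subset_dyadic:
  fixes a :: "real^'n::finite"
  assumes "0 < l"
  obtains T P where "P \<in> dyadic_grid T" "cube a l \<subseteq> P"
    "emeasure lebesgue P \<le> ennreal ((6 * l) ^ CARD('n))"
proof -
  define k where "k = - \<lfloor>log 2 (6 * l)\<rfloor>"
  have k: "2 powi (- k) \<le> 6 * l" "3 * l < 2 powi (- k)"
  proof -
    have "2 powi (- k) = (2::real) powr of_int \<lfloor>log 2 (6 * l)\<rfloor>"
      by (simp add: k_def powr_real_of_int')
    moreover have "2 powr of_int \<lfloor>log 2 (6 * l)\<rfloor> \<le> 2 powr (log 2 (6 * l))"
      by (intro powr_mono) auto
    moreover have "2 powr (log 2 (6 * l) - 1) < 2 powr of_int \<lfloor>log 2 (6 * l)\<rfloor>"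
      by (intro powr_less_mono) linarith+
    ultimately show "2 powi (- k) \<le> 6 * l" "3 * l < 2 powi (- k)"
      using assms by (simp_all add: powr_diff)
  qed
  define L where "L = l * 2 powi k"
  have L: "0 < L" "3 * L < 1"
  proof -
    show "0 < L" using assms by (simp add: L_def)
    have "3 * l * 2 powi k < 2 powi (- k) * 2 powi k"
      using k(2) by (intro mult_strict_right_mono) auto
    then show "3 * L < 1" by (simp add: L_def power_int_minus)
  qed
  define X where "X i = a $ i * 2 powi k" for i
  define T where "T = {i. \<lfloor>X i + L\<rfloor> \<noteq> \<lfloor>X i\<rfloor>}"
  define e :: real where "e = (if even k then 1 else -1)"
  have e: "e = 1 \<or> e = -1" by (simp add: e_def)
  have "y \<in> dyadic_cube T k a" if y: "y \<in> cube a l" for y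
  proof -
    have "\<lfloor>y $ i * 2 powi k - e * of_bool (i \<in> T) / 3\<rfloor> = \<lfloor>X i - e * of_bool (i \<in> T) / 3\<rfloor>" for i
    proof -
      have "a $ i \<le> y $ i" "y $ i \<le> a $ i + l" using y by (auto simp: mem_box_cart)
      then have "a $ i * 2 powi k \<le> y $ i * 2 powi k" "y $ i * 2 powi k \<le> (a $ i + l) * 2 powi k"
        by (auto intro!: mult_right_mono)
      then have Y: "X i \<le> y $ i * 2 powi k" "y $ i * 2 powi k \<le> X i + L"
        by (auto simp: X_def L_def algebra_simps)
      show ?thesis
      proof (cases "i \<in> T")
        case False
        then have "\<lfloor>X i + L\<rfloor> = \<lfloor>X i\<rfloor>" by (simp add: T_def)
        then have "\<lfloor>y $ i * 2 powi k\<rfloor> = \<lfloor>X i\<rfloor>"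
          using floor_mono[OF Y(1)] floor_mono[OF Y(2)] by linarith
        then show ?thesis using False by simp
      next
        case True
        then have "\<lfloor>X i + L\<rfloor> \<noteq> \<lfloor>X i\<rfloor>" by (simp add: T_def)
        then have f: "\<lfloor>X i\<rfloor> + 1 \<le> X i + L" using L(1) by linarith
        have f2: "X i < \<lfloor>X i\<rfloor> + 1" by linarith
        show ?thesis
          using e
        proof
          assume e1: "e = 1"
          have "\<lfloor>X i - 1/3\<rfloor> = \<lfloor>X i\<rfloor>" "\<lfloor>y $ i * 2 powi k - 1/3\<rfloor> = \<lfloor>X i\<rfloor>"
            unfolding floor_eq_iff using f f2 Y L by linarith+
          then show ?thesis using True e1 by simp
        next
          assume e1: "e = -1"
          have "\<lfloor>X i + 1/3\<rfloor> = \<lfloor>X i\<rfloor> + 1" "\<lfloor>y $ i * 2 powi k + 1/3\<rfloor> = \<lfloor>X i\<rfloor> + 1"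
            unfolding floor_eq_iff of_int_add of_int_1 using f f2 Y L by linarith+
          then show ?thesis using True e1 by simp
        qed
      qed
    qed
    then show ?thesis
      by (auto simp: dyadic_cube_def vec_eq_iff dyadic_index_def e_def X_def)
  qed
  moreover have "emeasure lebesgue (dyadic_cube T k a) \<le> ennreal ((6 * l) ^ CARD('n))"
    unfolding emeasure_dyadic_cube using k(1) by (intro ennreal_leI power_mono) auto
  moreover have "dyadic_cube T k a \<in> dyadic_grid T" by (auto simp: dyadic_grid_def)
  ultimately show thesis using that by blast
qed

section \<open>Maximal cubes and dyadic density\<close>

lemma laminar_maximal:
  fixes S :: "'a set set"
  assumes "\<And>P Q. P \<in> S \<Longrightarrow> Q \<in> S \<Longrightarrow> P \<inter> Q \<noteq> {} \<Longrightarrow> P \<subseteq> Q \<or> Q \<subseteq> P"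
    and "\<And>P. P \<in> S \<Longrightarrow> finite {R \<in> S. P \<subseteq> R}"
  defines "F \<equiv> {P \<in> S. \<forall>R\<in>S. P \<subseteq> R \<longrightarrow> R = P}"
  shows "disjoint F" "\<Union>F = \<Union>S"
proof -
  show "disjoint F"
  proof (rule disjointI)
    fix P Q assume PQ: "P \<in> F" "Q \<in> F" "P \<noteq> Q"
    then have "\<not> (P \<subseteq> Q \<or> Q \<subseteq> P)" by (auto simp: F_def)
    then show "P \<inter> Q = {}" using assms(1)[of P Q] PQ by (auto simp: F_def)
  qed
  have "\<exists>Q\<in>F. P \<subseteq> Q" if P: "P \<in> S" for P
  proof -
    obtain Q where Q: "Q \<in> {R \<in> S. P \<subseteq> R}" "\<forall>R\<in>{R \<in> S. P \<subseteq> R}. Q \<subseteq> R \<longrightarrow> R = Q"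
      using finite_has_maximal[of "{R \<in> S. P \<subseteq> R}"] assms(2)[OF P] P by (metis (mono_tags) empty_iff mem_Collect_eq order_refl)
    have "R = Q" if "R \<in> S" "Q \<subseteq> R" for R
      using Q that by auto
    then have "Q \<in> F" using Q(1) by (simp add: F_def)
    then show ?thesis using Q by auto
  qed
  then have "\<Union>S \<subseteq> \<Union>F" by blast
  then show "\<Union>F = \<Union>S" by (auto simp: F_def)
qed

lemma open_eq_Union_dyadic:
  fixes U :: "(real^'n::finite) set"
  assumes "open U"
  shows "\<Union>{R \<in> dyadic_grid T. R \<subseteq> U} = U"
proof
  show "U \<subseteq> \<Union>{R \<in> dyadic_grid T. R \<subseteq> U}"
  proof
    fix x assume "x \<in> U"
    then obtain e where e: "e > 0" "ball x e \<subseteq> U" using assms openE by blast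
    define c where "c = real CARD('n)"
    have c: "c > 0" by (simp add: c_def)
    obtain k :: nat where k: "(1/2) ^ k < e / c"
      using real_arch_pow_inv[of "e / c" "1/2"] e c by auto
    have "dyadic_cube T (int k) x \<subseteq> ball x e"
    proof
      fix y assume y: "y \<in> dyadic_cube T (int k) x"
      obtain a where a: "dyadic_cube T (int k) x \<subseteq> cube a (2 powi (- int k))"
        by (rule dyadic_cube_box)
      have l: "(2::real) powi (- int k) = (1/2)^k" by (simp add: power_int_minus power_one_over inverse_eq_divide)
      have "\<bar>(x - y) $ i\<bar> \<le> (1/2)^k" for i
      proof -
        have "x \<in> cube a (2 powi (- int k))" "y \<in> cube a (2 powi (- int k))"
          using a y by auto
        then have "a $ i \<le> x $ i" "x $ i \<le> a $ i + (1/2)^k" "a $ i \<le> y $ i" "y $ i \<le> a $ i + (1/2)^k"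
          by (auto simp: mem_box_cart l)
        then show ?thesis by (simp add: abs_le_iff)
      qed
      then have "norm (x - y) \<le> (\<Sum>i\<in>(UNIV::'n set). (1/2)^k)"
        using norm_le_l1_cart[of "x - y"] by (meson order_trans sum_mono)
      also have "\<dots> < e" using k c by (simp add: c_def field_simps)
      finally show "y \<in> ball x e" by (simp add: dist_norm)
    qed
    then show "x \<in> \<Union>{R \<in> dyadic_grid T. R \<subseteq> U}"
      using e dyadic_cube_self[of x T "int k"] by (auto simp: dyadic_grid_def intro!: exI[of _ "dyadic_cube T (int k) x"])
  qed
qed auto

section \<open>Weights of class A_1\<close>

lemma emeasure_disjoint_Union_le:
  assumes "countable F" "disjoint F" "F \<subseteq> sets M" "G \<in> sets M" "sets N = sets M"
    and "\<And>R. R \<in> F \<Longrightarrow> emeasure M (R \<inter> G) \<le> c * emeasure N R"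
  shows "emeasure M (\<Union>F \<inter> G) \<le> c * emeasure N (\<Union>F)"
proof -
  have d: "disjoint_family_on (\<lambda>R. R) F" "disjoint_family_on (\<lambda>R. R \<inter> G) F"
    using assms(2) by (auto simp: disjoint_family_on_def disjoint_def)
  have "\<Union>F \<inter> G = (\<Union>R\<in>F. R \<inter> G)" by auto
  then have "emeasure M (\<Union>F \<inter> G) = (\<integral>\<^sup>+R. emeasure M (R \<inter> G) \<partial>count_space F)"
    using emeasure_UN_countable[of F "\<lambda>R. R \<inter> G" M] assms d by auto
  also have "\<dots> \<le> (\<integral>\<^sup>+R. c * emeasure N R \<partial>count_space F)"
    using assms(6) by (intro nn_integral_mono) auto
  also have "\<dots> = c * (\<integral>\<^sup>+R. emeasure N R \<partial>count_space F)"
    by (intro nn_integral_cmult) auto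
  also have "(\<integral>\<^sup>+R. emeasure N R \<partial>count_space F) = emeasure N (\<Union>F)"
    using emeasure_UN_countable[of F "\<lambda>R. R" N] assms d by (auto simp: subset_iff)
  finally show ?thesis .
qed

lemma sets_lebesgue_dyadic_grid: "P \<in> dyadic_grid T \<Longrightarrow> P \<in> sets lebesgue"
  by (drule sets_dyadic_grid) simp

lemma emeasure_dyadic_grid_pos:
  "P \<in> dyadic_grid T \<Longrightarrow> 0 < emeasure lebesgue P"
  "P \<in> dyadic_grid T \<Longrightarrow> emeasure lebesgue P < \<infinity>"
  unfolding dyadic_grid_def using emeasure_dyadic_cube by (auto simp: emeasure_dyadic_cube)

lemma measure_dyadic_grid_pos:
  "P \<in> dyadic_grid T \<Longrightarrow> 0 < measure lebesgue P"
  using emeasure_dyadic_grid_pos[of P T] by (simp add: measure_def enn2real_positive_iff)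

lemma emeasure_eq_measure_dyadic:
  "P \<in> dyadic_grid T \<Longrightarrow> emeasure lebesgue P = ennreal (measure lebesgue P)"
  using emeasure_dyadic_grid_pos(2)[of P T] by (intro emeasure_eq_ennreal_measure) auto

text \<open>Confinement to \<open>P\<close> leaves only finitely many cubes above each member of
  \<open>S\<close>, so the infinite family is still covered by its disjoint maximal members.\<close>

lemma maximal_dyadic_cubes:
  assumes "P \<in> dyadic_grid T" "\<And>R. R \<in> S \<Longrightarrow> R \<in> dyadic_grid T \<and> R \<subseteq> P"
  obtains F where "F \<subseteq> S" "disjoint F" "\<Union>F = \<Union>S" "countable F" "F \<subseteq> sets lebesgue"
    "\<And>Q R. Q \<in> F \<Longrightarrow> R \<in> S \<Longrightarrow> Q \<subseteq> R \<Longrightarrow> R = Q"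
proof
  define F where "F = {P \<in> S. \<forall>R\<in>S. P \<subseteq> R \<longrightarrow> R = P}"
  have fin: "finite {R \<in> S. Q \<subseteq> R}" if "Q \<in> S" for Q
    by (rule finite_subset[OF _ finite_between_dyadic_grid[of Q T P]]) (use that assms in auto)
  have lam: "\<And>P Q. P \<in> S \<Longrightarrow> Q \<in> S \<Longrightarrow> P \<inter> Q \<noteq> {} \<Longrightarrow> P \<subseteq> Q \<or> Q \<subseteq> P"
    using laminar_dyadic_grid assms(2) by blast
  show "disjoint F" "\<Union>F = \<Union>S"
    using laminar_maximal[OF lam fin] unfolding F_def[symmetric] by auto
  show "F \<subseteq> S" by (auto simp: F_def)
  then have g: "F \<subseteq> dyadic_grid T" using assms(2) by blast
  then show "countable F" using countable_dyadic_grid countable_subset by blast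
  show "F \<subseteq> sets lebesgue" using g sets_lebesgue_dyadic_grid by auto
  show "R = Q" if "Q \<in> F" "R \<in> S" "Q \<subseteq> R" for Q R using that by (auto simp: F_def)
qed

text \<open>A substitute for the differentiation theorem. Outer regularity gives an open set of
  measure less than twice that of \<open>B\<close> which contains almost all of \<open>B\<close>. If
  \<open>B\<close> filled at most half of every dyadic cube, summing over the maximal cubes of this
  open set would give measure at most half of it, a contradiction.\<close>

lemma dyadic_density:
  fixes P :: "(real^'n::finite) set"
  assumes P: "P \<in> dyadic_grid T" and B: "B \<subseteq> P" "B \<in> sets lebesgue" "0 < emeasure lebesgue B"
  shows "\<exists>R\<in>dyadic_grid T. R \<subseteq> P \<and> emeasure lebesgue R < 2 * emeasure lebesgue (R \<inter> B)"
proof -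
  obtain k x where Pkx: "P = dyadic_cube T k x" using P by (auto simp: dyadic_grid_def)
  obtain a where a: "box a (\<chi> i. a $ i + 2 powi (- k)) \<subseteq> P"
    "P \<subseteq> cube a (2 powi (- k))"
    unfolding Pkx by (rule dyadic_cube_box)
  \<comment> \<open>Intersecting with the interior of \<open>P\<close> keeps the approximating set
    open and all its dyadic subcubes inside \<open>P\<close>; only the null boundary of
    \<open>P\<close> is lost.\<close>
  define I where "I = box a (\<chi> i. a $ i + 2 powi (- k))"
  have Pfin: "emeasure lebesgue P < \<infinity>" using emeasure_dyadic_grid_pos(2)[OF P] .
  have null: "P - I \<in> null_sets lebesgue"
  proof -
    have "P - I \<subseteq> cube a (2 powi (- k)) - box a (\<chi> i. a $ i + 2 powi (- k))"
      using a by (auto simp: I_def)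
    then show ?thesis
      using negligible_subset[OF negligible_frontier_interval] by (simp add: negligible_iff_null_sets)
  qed
  define B0 where "B0 = B \<inter> I"
  have B0s: "B0 \<in> sets lebesgue" using B by (auto simp: B0_def I_def)
  have "B - B0 \<in> null_sets lebesgue"
    by (rule null_sets_subset[OF null]) (use B B0s in \<open>auto simp: B0_def\<close>)
  then have eB: "emeasure lebesgue B0 = emeasure lebesgue B"
    using emeasure_Un_null_set[OF B0s, of "B - B0"] by (auto simp: B0_def Un_Diff_Int Un_commute)
  have fB: "emeasure lebesgue B0 < \<infinity>"
  proof (rule order_le_less_trans[OF _ Pfin])
    show "emeasure lebesgue B0 \<le> emeasure lebesgue P"
      using B P by (intro emeasure_mono sets_lebesgue_dyadic_grid) (auto simp: B0_def)
  qed
  define e where "e = measure lebesgue B0"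
  have e: "emeasure lebesgue B0 = ennreal e" using fB by (simp add: e_def emeasure_eq_ennreal_measure)
  have "e > 0" using B(3) eB e by (metis ennreal_less_zero_iff)
  from sets_lebesgue_outer_open[OF B0s this] obtain W where W:
    "open W" "B0 \<subseteq> W" "W - B0 \<in> lmeasurable" "emeasure lebesgue (W - B0) < ennreal e" .
  define U where "U = W \<inter> I"
  have U: "open U" "B0 \<subseteq> U" using W by (auto simp: U_def B0_def I_def)
  have Us: "U \<in> sets lebesgue" using U(1) by auto
  have "emeasure lebesgue U \<le> emeasure lebesgue ((W - B0) \<union> B0)"
    using W B0s by (intro emeasure_mono) (auto simp: U_def)
  also have "\<dots> \<le> emeasure lebesgue (W - B0) + emeasure lebesgue B0"
    using W B0s by (intro emeasure_subadditive) auto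
  also have "\<dots> < ennreal e + ennreal e"
    using W(4) e ennreal_add_left_cancel_less[of "ennreal e" "emeasure lebesgue (W - B0)" "ennreal e"]
    by (simp add: add.commute)
  finally have Ult: "emeasure lebesgue U < 2 * emeasure lebesgue B0"
    by (simp add: e mult_2)
  show ?thesis
  proof (rule ccontr)
    assume "\<not> ?thesis"
    then have *: "2 * emeasure lebesgue (R \<inter> B) \<le> emeasure lebesgue R"
      if "R \<in> dyadic_grid T" "R \<subseteq> P" for R using that by (auto simp: not_less)
    define S where "S = {R \<in> dyadic_grid T. R \<subseteq> U}"
    have SP: "R \<subseteq> P" "R \<in> dyadic_grid T" if "R \<in> S" for R
      using that a by (auto simp: S_def U_def I_def)
    obtain F where F: "F \<subseteq> S" "disjoint F" "\<Union>F = \<Union>S" "countable F" "F \<subseteq> sets lebesgue"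
      by (rule maximal_dyadic_cubes[OF P, of S]) (use SP in auto)
    have FU: "\<Union>F = U" unfolding F(3) S_def by (rule open_eq_Union_dyadic[OF U(1)])
    have "emeasure lebesgue (\<Union>F \<inter> B0) \<le> ennreal (1/2) * emeasure lebesgue (\<Union>F)"
    proof (rule emeasure_disjoint_Union_le)
      fix R assume "R \<in> F"
      then have R: "R \<in> dyadic_grid T" "R \<subseteq> P" using F(1) SP by auto
      have "2 * emeasure lebesgue (R \<inter> B0) \<le> 2 * emeasure lebesgue (R \<inter> B)"
        using R B by (intro mult_left_mono emeasure_mono) (auto simp: B0_def sets_lebesgue_dyadic_grid)
      also have "\<dots> \<le> emeasure lebesgue R" using * R by auto
      finally have "ennreal (1/2) * (2 * emeasure lebesgue (R \<inter> B0)) \<le> ennreal (1/2) * emeasure lebesgue R"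
        by (rule mult_left_mono) simp
      moreover have "ennreal (1/2) * 2 = 1"
        by (metis divide_self_if ennreal_1 ennreal_mult' ennreal_numeral mult.commute nonzero_mult_div_cancel_left times_divide_eq_right zero_le_numeral zero_neq_numeral mult_1)
      ultimately show "emeasure lebesgue (R \<inter> B0) \<le> ennreal (1/2) * emeasure lebesgue R"
        by (simp add: mult.assoc[symmetric])
    qed (use B0s F in auto)
    note * = this
    have half: "0 < ennreal (1/2)" "ennreal (1/2) < top"
      unfolding ennreal_less_zero_iff by (simp, rule ennreal_less_top)
    have "ennreal e \<le> ennreal (1/2) * emeasure lebesgue U"
      using * U(2) FU e by (simp add: Int_absorb1)
    also have "\<dots> < ennreal (1/2) * (2 * ennreal e)"
      using Ult unfolding e
      by (rule ennreal_mult_strict_left_mono) (use half in auto)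
    also have "\<dots> = ennreal e"
    proof -
      have "2 * ennreal e = ennreal (2 * e)" using \<open>e > 0\<close> by (simp add: ennreal_mult)
      then have "ennreal (1/2) * (2 * ennreal e) = ennreal ((1/2) * (2 * e))"
        using \<open>e > 0\<close> by (simp only: ennreal_mult)
      then show ?thesis by simp
    qed
    finally show False by simp
  qed
qed

text \<open>The average of \<omega> over a cube is compared with the value at almost every point of
  it, which expresses the essential infimum. Positivity is demanded everywhere; weights that are
  positive only almost everywhere are first changed on a null set.\<close>

locale A1_weight =
  fixes \<omega> :: "real^'n::finite \<Rightarrow> real" and A :: real
  assumes meas_omega [measurable]: "\<omega> \<in> borel_measurable lebesgue"
    and omega_pos: "0 < \<omega> x"
    and A_ge_1: "1 \<le> A"
    and A1: "0 < l \<Longrightarrow> AE x in lebesgue. x \<in> cube a l \<longrightarrow>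
      (\<integral>\<^sup>+x\<in>cube a l. ennreal (\<omega> x) \<partial>lebesgue) \<le> ennreal (A * l ^ CARD('n) * \<omega> x)"
begin

definition \<nu> :: "(real^'n) measure" where
  "\<nu> = density lebesgue (\<lambda>x. ennreal (\<omega> x))"

lemma sets_nu [simp, measurable_cong]: "sets \<nu> = sets lebesgue"
  and space_nu [simp]: "space \<nu> = UNIV"
  by (simp_all add: \<nu>_def)

lemma emeasure_nu: "X \<in> sets lebesgue \<Longrightarrow> emeasure \<nu> X = (\<integral>\<^sup>+x\<in>X. ennreal (\<omega> x) \<partial>lebesgue)"
  unfolding \<nu>_def by (subst emeasure_density) auto

lemma AE_nu: "(AE x in \<nu>. Q x) \<longleftrightarrow> (AE x in lebesgue. Q x)"
  unfolding \<nu>_def by (subst AE_density) (auto simp: omega_pos)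

lemma A1_dyadic:
  assumes P: "P \<in> dyadic_grid T"
  shows "AE x in lebesgue. x \<in> P \<longrightarrow> emeasure \<nu> P \<le> ennreal (A * measure lebesgue P * \<omega> x)"
proof -
  obtain k x where Pkx: "P = dyadic_cube T k x" using P by (auto simp: dyadic_grid_def)
  obtain a where a: "P \<subseteq> cube a (2 powi (- k))"
    unfolding Pkx by (rule dyadic_cube_box)
  have "emeasure \<nu> P \<le> emeasure \<nu> (cube a (2 powi (- k)))"
    using a by (intro emeasure_mono) auto
  also have "\<dots> = (\<integral>\<^sup>+x\<in>cube a (2 powi (- k)). ennreal (\<omega> x) \<partial>lebesgue)"
    by (rule emeasure_nu) simp
  finally have *: "emeasure \<nu> P \<le> \<dots>" .
  have "measure lebesgue P = (2 powi (- k)) ^ CARD('n)"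
    by (simp add: measure_def Pkx emeasure_dyadic_cube)
  then show ?thesis
    using A1[of "2 powi (- k)" a] a order_trans[OF *] by (auto elim!: eventually_mono)
qed

text \<open>Local integrability follows from the A_1 condition itself: evaluated at one suitable
  point of \<open>P\<close>, its right-hand side is a real number.\<close>

lemma emeasure_nu_dyadic_finite:
  assumes P: "P \<in> dyadic_grid T" shows "emeasure \<nu> P < \<infinity>"
proof -
  have "\<exists>x. x \<in> P \<and> emeasure \<nu> P \<le> ennreal (A * measure lebesgue P * \<omega> x)"
  proof (rule ccontr)
    assume "\<not> ?thesis"
    then have "AE x in lebesgue. x \<notin> P" using A1_dyadic[OF P] by (auto elim!: eventually_mono)
    then have "emeasure lebesgue P = 0"
      using P sets_lebesgue_dyadic_grid by (subst (asm) AE_iff_null_sets[symmetric]) (auto simp: null_sets_def)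
    then show False using emeasure_dyadic_grid_pos(1)[OF P] by simp
  qed
  then show ?thesis by (auto simp: order_le_less_trans)
qed

lemma emeasure_nu_pos:
  assumes "X \<in> sets lebesgue" "0 < emeasure lebesgue X" shows "0 < emeasure \<nu> X"
proof (rule ccontr)
  assume "\<not> ?thesis"
  then have "X \<in> null_sets \<nu>" using assms by (auto simp: null_sets_def)
  then have "AE x in lebesgue. x \<notin> X" using AE_not_in AE_nu by blast
  then have "X \<in> null_sets lebesgue" using assms(1) AE_iff_null_sets by blast
  then show False using assms by auto
qed

lemma measure_nu_pos: "P \<in> dyadic_grid T \<Longrightarrow> 0 < measure \<nu> P"
  using emeasure_nu_pos[of P] emeasure_nu_dyadic_finite[of P T] emeasure_dyadic_grid_pos[of P T]
    sets_lebesgue_dyadic_grid[of P T]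
  by (auto simp: measure_def enn2real_positive_iff)

lemma fmeasurable_nu: "P \<in> dyadic_grid T \<Longrightarrow> P \<in> fmeasurable \<nu>"
  using emeasure_nu_dyadic_finite sets_lebesgue_dyadic_grid by (auto intro!: fmeasurableI)

lemma emeasure_nu_eq: "P \<in> dyadic_grid T \<Longrightarrow> X \<subseteq> P \<Longrightarrow> X \<in> sets lebesgue \<Longrightarrow>
    emeasure \<nu> X = ennreal (measure \<nu> X)"
  by (metis emeasure_eq_measure2 fmeasurableI2 fmeasurable_nu sets_nu)

lemma A1_dyadic_measure:
  assumes P: "P \<in> dyadic_grid T"
  shows "AE x in lebesgue. x \<in> P \<longrightarrow> measure \<nu> P \<le> A * measure lebesgue P * \<omega> x"
proof -
  have "P \<in> sets lebesgue" by (rule sets_lebesgue_dyadic_grid[OF P])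
  then have e: "emeasure \<nu> P = ennreal (measure \<nu> P)"
    using emeasure_nu_eq[OF P order_refl] by simp
  have "0 \<le> A * measure lebesgue P * \<omega> x" for x
    using A_ge_1 omega_pos[of x] by simp
  then show ?thesis
    using A1_dyadic[OF P] unfolding e by (auto elim!: eventually_mono simp: ennreal_le_iff)
qed

text \<open>Integrate the pointwise A_1 bound on \<open>P\<close> over \<open>X\<close>. Depending
  on \<open>X\<close> this serves as doubling, as an A_infinity estimate, or as the near
  monotonicity of averages.\<close>

lemma nu_doubling:
  assumes P: "P \<in> dyadic_grid T" and X: "X \<subseteq> P" "X \<in> sets lebesgue"
  shows "measure \<nu> P * measure lebesgue X \<le> A * measure lebesgue P * measure \<nu> X"
proof -
  have Ps: "P \<in> sets lebesgue" using P sets_lebesgue_dyadic_grid by auto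
  have eX: "emeasure lebesgue X = ennreal (measure lebesgue X)"
    using emeasure_mono[OF X(1) Ps] emeasure_dyadic_grid_pos(2)[OF P]
    by (intro emeasure_eq_ennreal_measure) (auto simp: top_unique)
  have "ennreal (measure \<nu> P * measure lebesgue X) = (\<integral>\<^sup>+x. ennreal (measure \<nu> P) * indicator X x \<partial>lebesgue)"
    using X eX by (simp add: nn_integral_cmult_indicator ennreal_mult)
  also have "\<dots> \<le> (\<integral>\<^sup>+x. ennreal (A * measure lebesgue P) * (ennreal (\<omega> x) * indicator X x) \<partial>lebesgue)"
  proof (rule nn_integral_mono_AE)
    show "AE x in lebesgue. ennreal (measure \<nu> P) * indicator X x
        \<le> ennreal (A * measure lebesgue P) * (ennreal (\<omega> x) * indicator X x)"
      using A1_dyadic_measure[OF P] X A_ge_1 omega_pos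
      by (auto elim!: eventually_mono simp: ennreal_leI ennreal_mult[symmetric] less_imp_le split: split_indicator)
  qed
  also have "\<dots> = ennreal (A * measure lebesgue P) * emeasure \<nu> X"
    using X by (subst nn_integral_cmult) (auto simp: emeasure_nu)
  also have "\<dots> = ennreal (A * measure lebesgue P * measure \<nu> X)"
    using A_ge_1 emeasure_nu_eq[OF P X] by (simp add: ennreal_mult)
  finally show ?thesis
    using A_ge_1 by (subst (asm) ennreal_le_iff) auto
qed

text \<open>If a set fills at most half of a cube, its complement carries at least the fraction
  1/(2A) of the mass by \<open>nu_doubling\<close>; this gives \<theta>. In \<open>K\<close> the
  factor A passes from averages to pointwise lower bounds, 2^n passes from a maximal cube to its
  parent, and 2 leaves only half of the cube in the Chebyshev estimate.\<close>

definition \<theta> :: real where "\<theta> = 1 - 1 / (2 * A)"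
definition K :: real where "K = 2 ^ (CARD('n) + 1) * A"

lemma theta: "0 < \<theta>" "\<theta> < 1"
  using A_ge_1 by (auto simp: \<theta>_def field_simps)

lemma K_ge: "2 * A \<le> K" "1 < K" "A \<le> K"
proof -
  have "(2::real) ^ 1 \<le> 2 ^ (CARD('n) + 1)" by (rule power_increasing) auto
  then have "2 * A \<le> K" using A_ge_1 by (auto simp: K_def intro!: mult_right_mono)
  then show "2 * A \<le> K" "1 < K" "A \<le> K" using A_ge_1 by auto
qed

lemma nu_half:
  assumes P: "P \<in> dyadic_grid T" and E: "E \<subseteq> P" "E \<in> sets lebesgue"
    and half: "2 * measure lebesgue E \<le> measure lebesgue P"
  shows "measure \<nu> E \<le> \<theta> * measure \<nu> P"
proof -
  have Ps: "P \<in> sets lebesgue" using P sets_lebesgue_dyadic_grid by auto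
  have PL: "P \<in> fmeasurable lebesgue"
    using emeasure_dyadic_grid_pos(2)[OF P] Ps by (auto intro!: fmeasurableI)
  have mP: "0 < measure lebesgue P" by (rule measure_dyadic_grid_pos[OF P])
  have "measure lebesgue (P - E) = measure lebesgue P - measure lebesgue E"
    using measurable_measure_Diff[OF PL E(2,1)] .
  then have 1: "measure lebesgue P / 2 \<le> measure lebesgue (P - E)" using half by simp
  have 2: "measure \<nu> (P - E) = measure \<nu> P - measure \<nu> E"
    using measurable_measure_Diff[OF fmeasurable_nu[OF P]] E by simp
  have "measure \<nu> P * (measure lebesgue P / 2) \<le> measure \<nu> P * measure lebesgue (P - E)"
    using 1 by (intro mult_left_mono) auto
  also have "\<dots> \<le> A * measure lebesgue P * measure \<nu> (P - E)"
    using nu_doubling[OF P, of "P - E"] E Ps by auto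
  finally have "measure lebesgue P * (measure \<nu> P / 2) \<le> measure lebesgue P * (A * measure \<nu> (P - E))"
    by (simp add: mult_ac)
  then have "measure \<nu> P / 2 \<le> A * measure \<nu> (P - E)" using mP by (simp add: mult_le_cancel_left)
  then show ?thesis using A_ge_1 by (simp add: 2 \<theta>_def field_simps)
qed

text \<open>A reverse Hoelder inequality in distributional form: on the maximal dyadic cubes with large
  average of \<open>\<omega>\<close>, the set where \<open>\<omega>\<close> is much larger still fills at most half of the cube.\<close>
lemma nu_decay_step:
  assumes P: "P \<in> dyadic_grid T" and t: "measure \<nu> P \<le> t * measure lebesgue P"
  shows "measure \<nu> {x\<in>P. K * t < \<omega> x} \<le> \<theta> * measure \<nu> {x\<in>P. t < \<omega> x}"
proof -
  \<comment> \<open>The stopping level exceeds \<open>t\<close> by the A_1 constant, so that on a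
    cube with average above \<open>l\<close> the weight itself exceeds \<open>t\<close> almost
    everywhere.\<close>
  define l where "l = A * t"
  have tpos: "t > 0"
    using t measure_nu_pos[OF P] measure_dyadic_grid_pos[OF P]
    by (metis less_le_not_le linorder_not_le mult_nonpos_nonneg order_trans)
  have lpos: "l > 0" using tpos A_ge_1 by (simp add: l_def)
  have Ps[measurable]: "P \<in> sets lebesgue" using P sets_lebesgue_dyadic_grid by auto
  define S where "S = {R \<in> dyadic_grid T. R \<subseteq> P \<and> l * measure lebesgue R < measure \<nu> R}"
  have SP: "R \<subseteq> P" "R \<in> dyadic_grid T" if "R \<in> S" for R using that by (auto simp: S_def)
  obtain F where FS: "F \<subseteq> S" and F: "disjoint F" "\<Union>F = \<Union>S" and cF: "countable F"
    and Fs: "F \<subseteq> sets lebesgue" and Fmax: "\<And>Q R. Q \<in> F \<Longrightarrow> R \<in> S \<Longrightarrow> Q \<subseteq> R \<Longrightarrow> R = Q"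
    by (rule maximal_dyadic_cubes[OF P, of S]) (use SP in auto)
  have Fg: "F \<subseteq> dyadic_grid T" using FS SP by auto
  have [measurable]: "\<Union>F \<in> sets lebesgue" using cF Fs by auto
  \<comment> \<open>A set of positive measure outside the stopping cubes where \<omega> > 2 l would
    fill more than half of some dyadic cube. That cube would then have average above
    \<open>l\<close> and belong to \<open>S\<close>.\<close>
  have cover: "AE y in lebesgue. y \<in> P \<and> 2 * l < \<omega> y \<longrightarrow> y \<in> \<Union>F"
  proof -
    define B where "B = {y \<in> P. 2 * l < \<omega> y} - \<Union>F"
    have Bs: "B \<in> sets lebesgue" unfolding B_def by measurable
    have "emeasure lebesgue B = 0"
    proof (rule ccontr)
      assume "emeasure lebesgue B \<noteq> 0"
      then have "0 < emeasure lebesgue B" by (simp add: zero_less_iff_neq_zero)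
      from dyadic_density[OF P _ Bs this] obtain R where R: "R \<in> dyadic_grid T" "R \<subseteq> P"
        "emeasure lebesgue R < 2 * emeasure lebesgue (R \<inter> B)" by (auto simp: B_def)
      have Rs: "R \<in> sets lebesgue" using R sets_lebesgue_dyadic_grid by auto
      have fin: "emeasure lebesgue (R \<inter> B) = ennreal (measure lebesgue (R \<inter> B))"
        using emeasure_mono[of "R \<inter> B" R lebesgue] emeasure_dyadic_grid_pos(2)[OF R(1)] Rs
        by (intro emeasure_eq_ennreal_measure) (auto simp: top_unique)
      have lt: "measure lebesgue R < 2 * measure lebesgue (R \<inter> B)"
        using R(3) unfolding fin emeasure_eq_measure_dyadic[OF R(1)]
        by (metis ennreal_less_iff ennreal_mult' ennreal_numeral measure_nonneg zero_le_numeral)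
      then obtain y where "y \<in> R \<inter> B" using measure_nonneg[of lebesgue R]
        by (metis all_not_in_conv less_le_not_le measure_empty mult_zero_right)
      then have "R \<notin> S" using F(2) by (auto simp: B_def)
      then have nl: "measure \<nu> R \<le> l * measure lebesgue R" using R by (auto simp: S_def)
      have "ennreal (2 * l * measure lebesgue (R \<inter> B)) = (\<integral>\<^sup>+x. ennreal (2 * l) * indicator (R \<inter> B) x \<partial>lebesgue)"
        using Rs Bs fin lpos by (simp add: nn_integral_cmult_indicator ennreal_mult)
      also have "\<dots> \<le> (\<integral>\<^sup>+x. ennreal (\<omega> x) * indicator (R \<inter> B) x \<partial>lebesgue)"
        by (intro nn_integral_mono) (auto simp: B_def ennreal_leI split: split_indicator)
      also have "\<dots> = ennreal (measure \<nu> (R \<inter> B))"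
        using Rs Bs by (subst emeasure_nu[symmetric]) (auto intro!: emeasure_nu_eq[OF R(1)])
      finally have "2 * l * measure lebesgue (R \<inter> B) \<le> measure \<nu> (R \<inter> B)"
        by (simp add: ennreal_le_iff)
      also have "\<dots> \<le> measure \<nu> R"
        using Bs Rs by (intro measure_mono_fmeasurable fmeasurable_nu[OF R(1)]) auto
      also note nl
      finally have "2 * measure lebesgue (R \<inter> B) \<le> measure lebesgue R"
        using lpos by (simp add: mult.assoc mult.left_commute[of 2])
      then show False using lt by simp
    qed
    then have "AE y in lebesgue. y \<notin> B" using Bs by (intro AE_not_in) (auto simp: null_sets_def)
    then show ?thesis by (auto simp: B_def elim!: eventually_mono)
  qed
  have low: "AE y in lebesgue. y \<in> \<Union>F \<longrightarrow> t < \<omega> y"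
  proof -
    have "AE y in lebesgue. \<forall>R\<in>F. y \<in> R \<longrightarrow> measure \<nu> R \<le> A * measure lebesgue R * \<omega> y"
      using cF Fg A1_dyadic_measure by (subst AE_ball_countable) auto
    then show ?thesis
    proof (rule eventually_mono, intro impI)
      fix y assume *: "\<forall>R\<in>F. y \<in> R \<longrightarrow> measure \<nu> R \<le> A * measure lebesgue R * \<omega> y" "y \<in> \<Union>F"
      then obtain R where R: "R \<in> F" "y \<in> R" by auto
      then have "l * measure lebesgue R < A * measure lebesgue R * \<omega> y"
        using * FS by (force simp: S_def)
      then have "(A * measure lebesgue R) * t < (A * measure lebesgue R) * \<omega> y"
        by (simp add: l_def mult_ac)
      then show "t < \<omega> y"
        using A_ge_1 measure_nonneg[of lebesgue R] by (auto simp: mult_less_cancel_left)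
    qed
  qed
  \<comment> \<open>The parent of a maximal cube is not in \<open>S\<close>, so the average over the
    cube is at most 2^n l. Since K t = 2 * 2^n l, Chebyshev leaves at most half of the cube.\<close>
  have part: "measure \<nu> (R \<inter> {x. K * t < \<omega> x}) \<le> \<theta> * measure \<nu> R" if R: "R \<in> F" for R
  proof (rule nu_half)
    show Rg: "R \<in> dyadic_grid T" using R Fg by auto
    have Rs[measurable]: "R \<in> sets lebesgue" using Rg sets_lebesgue_dyadic_grid by auto
    have m[measurable]: "{x. K * t < \<omega> x} \<in> sets lebesgue"
      using borel_measurable_less[of "\<lambda>x. K * t" lebesgue \<omega>] by auto
    show Es: "R \<inter> {x. K * t < \<omega> x} \<in> sets lebesgue" by simp
    \<comment> \<open>The average over \<open>P\<close> is at most \<open>t\<close>, hence not above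
      the stopping level; therefore the parent of \<open>R\<close> still lies in
      \<open>P\<close>.\<close>
    have "R \<noteq> P"
    proof
      assume "R = P"
      then have "l * measure lebesgue P < t * measure lebesgue P" using R FS t by (force simp: S_def)
      then have "A * t < t" unfolding l_def by (rule mult_right_less_imp_less) simp
      then show False using A_ge_1 tpos by simp
    qed
    then have "R \<subset> P" using R FS SP by auto
    from dyadic_parent[OF P Rg this] obtain R' where R': "R' \<in> dyadic_grid T" "R \<subset> R'" "R' \<subseteq> P"
      "emeasure lebesgue R' = 2 ^ CARD('n) * emeasure lebesgue R" .
    have "R' \<notin> S" using Fmax[OF R, of R'] R' by auto
    then have "measure \<nu> R' \<le> l * measure lebesgue R'" using R' by (auto simp: S_def)
    moreover have "measure lebesgue R' = 2 ^ CARD('n) * measure lebesgue R"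
      using R'(4) by (simp add: measure_def enn2real_mult flip: ennreal_numeral ennreal_power)
    moreover have "measure \<nu> R \<le> measure \<nu> R'"
      using R' Rs by (intro measure_mono_fmeasurable fmeasurable_nu) auto
    ultimately have up: "measure \<nu> R \<le> l * (2 ^ CARD('n) * measure lebesgue R)" by simp
    have fin: "emeasure lebesgue (R \<inter> {x. K * t < \<omega> x}) = ennreal (measure lebesgue (R \<inter> {x. K * t < \<omega> x}))"
      using emeasure_mono[of "R \<inter> {x. K * t < \<omega> x}" R lebesgue] emeasure_dyadic_grid_pos(2)[OF Rg] Rs
      by (intro emeasure_eq_ennreal_measure) (auto simp: top_unique)
    have Kt: "0 < K * t" using K_ge tpos by simp
    have "ennreal (K * t * measure lebesgue (R \<inter> {x. K * t < \<omega> x}))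
        = (\<integral>\<^sup>+x. ennreal (K * t) * indicator (R \<inter> {x. K * t < \<omega> x}) x \<partial>lebesgue)"
      using Es fin Kt by (simp add: nn_integral_cmult_indicator ennreal_mult)
    also have "\<dots> \<le> (\<integral>\<^sup>+x. ennreal (\<omega> x) * indicator R x \<partial>lebesgue)"
      by (intro nn_integral_mono) (auto simp: ennreal_leI split: split_indicator)
    also have "\<dots> = ennreal (measure \<nu> R)"
      using Rs by (subst emeasure_nu[symmetric]) (auto intro!: emeasure_nu_eq[OF Rg])
    finally have "K * t * measure lebesgue (R \<inter> {x. K * t < \<omega> x}) \<le> measure \<nu> R"
      by (simp add: ennreal_le_iff)
    also note up
    finally have "(A * 2 ^ CARD('n) * t) * (2 * measure lebesgue (R \<inter> {x. K * t < \<omega> x}))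
        \<le> (A * 2 ^ CARD('n) * t) * measure lebesgue R"
      by (simp add: K_def l_def mult_ac)
    then show "2 * measure lebesgue (R \<inter> {x. K * t < \<omega> x}) \<le> measure lebesgue R"
      using tpos A_ge_1 by (subst (asm) mult_le_cancel_left_pos) auto
  qed auto
  have m[measurable]: "{x. c < \<omega> x} \<in> sets lebesgue" for c
    using borel_measurable_less[of "\<lambda>x. c" lebesgue \<omega>] by auto
  have "2 * l \<le> K * t" using mult_right_mono[OF K_ge(1), of t] tpos by (simp add: l_def mult_ac)
  then have "emeasure \<nu> {x\<in>P. K * t < \<omega> x} \<le> emeasure \<nu> (\<Union>F \<inter> {x. K * t < \<omega> x})"
    using cover by (intro emeasure_mono_AE) (auto simp: AE_nu elim!: eventually_mono)
  also have "\<dots> \<le> ennreal \<theta> * emeasure \<nu> (\<Union>F)"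
  proof (rule emeasure_disjoint_Union_le)
    fix R assume "R \<in> F"
    then show "emeasure \<nu> (R \<inter> {x. K * t < \<omega> x}) \<le> ennreal \<theta> * emeasure \<nu> R"
      using part[of R] emeasure_nu_eq[of R T] Fg Fs theta
      by (auto simp: subset_iff ennreal_mult[symmetric] ennreal_leI)
  qed (use cF F Fs m in auto)
  also have "\<dots> \<le> ennreal \<theta> * emeasure \<nu> {x\<in>P. t < \<omega> x}"
    using low SP FS by (intro mult_left_mono emeasure_mono_AE) (auto simp: AE_nu elim!: eventually_mono)
  finally show ?thesis
    using emeasure_nu_eq[OF P, of "{x\<in>P. K * t < \<omega> x}"] emeasure_nu_eq[OF P, of "{x\<in>P. t < \<omega> x}"] theta
    by (simp add: ennreal_mult[symmetric] ennreal_le_iff)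
qed

text \<open>Each application of \<open>nu_decay_step\<close> raises the threshold by the factor
  \<open>K\<close>, and the larger threshold still bounds the average over \<open>P\<close>, so the
  step can be repeated.\<close>

lemma nu_decay:
  assumes P: "P \<in> dyadic_grid T" and t: "measure \<nu> P \<le> t * measure lebesgue P"
  shows "measure \<nu> {x\<in>P. K ^ i * t < \<omega> x} \<le> \<theta> ^ i * measure \<nu> P"
proof (induction i)
  case 0
  have "{x\<in>P. t < \<omega> x} \<in> sets \<nu>" using P sets_lebesgue_dyadic_grid[of P T] by measurable
  then show ?case by (auto intro!: measure_mono_fmeasurable fmeasurable_nu[OF P])
next
  case (Suc i)
  have "t * measure lebesgue P \<le> (K ^ i * t) * measure lebesgue P"
  proof -
    have "0 < t" using t measure_nu_pos[OF P] measure_dyadic_grid_pos[OF P]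
      by (metis less_le_not_le linorder_not_le mult_nonpos_nonneg order_trans)
    then have "1 * t \<le> K ^ i * t" using one_le_power[of K i] K_ge by (intro mult_right_mono) auto
    then show ?thesis by (intro mult_right_mono) auto
  qed
  then have "measure \<nu> {x\<in>P. K * (K ^ i * t) < \<omega> x} \<le> \<theta> * measure \<nu> {x\<in>P. K ^ i * t < \<omega> x}"
    using t by (intro nu_decay_step[OF P]) auto
  also have "\<dots> \<le> \<theta> * (\<theta> ^ i * measure \<nu> P)"
    using Suc theta by (intro mult_left_mono) auto
  finally show ?case by (simp add: mult_ac)
qed

end

section \<open>A mixed weak type inequality\<close>

text \<open>Here \<open>t j\<close> is the part of \<open>\<nu>\<close> which \<open>{\<omega> \<approx> K^j}\<close> carries in the \<open>j\<close>-th cube of an increasing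
  chain, and \<open>m j\<close> is the average of \<open>\<omega>\<close> over this cube. It vanishes for small \<open>j\<close>, and decays
  geometrically after the first nonzero term because the averages are almost decreasing.\<close>
lemma level_sum_bound:
  fixes t m :: "int \<Rightarrow> real" and A K \<theta> :: real
  assumes J: "finite J" and A: "1 \<le> A" "A \<le> K" "1 < K" and th: "0 < \<theta>" "\<theta> < 1"
    and t1: "\<And>j. j \<in> J \<Longrightarrow> 0 \<le> t j \<and> t j \<le> 1"
    and m0: "\<And>j. j \<in> J \<Longrightarrow> t j \<noteq> 0 \<Longrightarrow> m j \<le> A * K powr (of_int j + 1)"
    and mm: "\<And>i j. i \<in> J \<Longrightarrow> j \<in> J \<Longrightarrow> i \<le> j \<Longrightarrow> m j \<le> A * m i"
    and mpos: "\<And>j. j \<in> J \<Longrightarrow> 0 \<le> m j"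
    and td: "\<And>j i. j \<in> J \<Longrightarrow> K ^ i * m j \<le> K powr of_int j \<Longrightarrow> t j \<le> \<theta> ^ i"
  shows "sum t J \<le> 3 + 1 / (1 - \<theta>)"
proof (cases "\<forall>j\<in>J. t j = 0")
  case True
  then have "sum t J = 0" by simp
  then show ?thesis using th by (simp add: add_nonneg_nonneg)
next
  case False
  define J0 where "J0 = {j\<in>J. t j \<noteq> 0}"
  have J0: "finite J0" "J0 \<noteq> {}" using J False by (auto simp: J0_def)
  define j0 where "j0 = Min J0"
  have j0: "j0 \<in> J" "t j0 \<noteq> 0" "\<And>j. j \<in> J0 \<Longrightarrow> j0 \<le> j"
    using Min_in[OF J0] J0 by (auto simp: j0_def J0_def)
  \<comment> \<open>If \<open>j0\<close> is the first level with a nonzero term, then m j <= A m j0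
    <= K powr (j0 + 3). Decay is therefore available with exponent j - j0 - 3; the first three
    levels have only the bound 1, which is the 3 in the conclusion.\<close>
  define u where "u n = (if n < 3 then 1 else \<theta> ^ (n - 3))" for n :: nat
  have tu: "t j \<le> u (nat (j - j0))" if j: "j \<in> J0" for j
  proof (cases "j - j0 < 3")
    case True
    then show ?thesis using t1 j by (auto simp: u_def J0_def)
  next
    case False
    define i where "i = nat (j - j0 - 3)"
    have i: "real i = of_int j - of_int j0 - 3" "nat (j - j0) = i + 3" using False by (auto simp: i_def)
    have K0: "0 < K" using A by simp
    have "m j \<le> A * m j0" using mm j0 j by (auto simp: J0_def)
    also have "\<dots> \<le> K * (K * K powr (of_int j0 + 1))"
    proof (rule mult_mono)
      have "A * K powr (of_int j0 + 1) \<le> K * K powr (of_int j0 + 1)"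
        using A by (intro mult_right_mono) auto
      then show "m j0 \<le> K * K powr (of_int j0 + 1)" using m0[OF j0(1,2)] by simp
      show "0 \<le> K" using A by simp
    qed (use A mpos[OF j0(1)] in auto)
    also have "\<dots> = K powr (of_int j0 + 3)"
    proof -
      have "K powr (of_int j0 + 3) = K powr (1 + (1 + (of_int j0 + 1)))" by (simp add: add_ac)
      then show ?thesis using K0 by (simp only: powr_add) (simp add: powr_one)
    qed
    finally have "K ^ i * m j \<le> K ^ i * K powr (of_int j0 + 3)"
      using A by (intro mult_left_mono) auto
    also have "K ^ i = K powr real i" using K0 by (simp add: powr_realpow)
    also have "\<dots> * K powr (of_int j0 + 3) = K powr of_int j"
      by (simp add: powr_add[symmetric] i(1))
    finally have "t j \<le> \<theta> ^ i" using j K0 by (intro td) (auto simp: J0_def powr_realpow)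
    then show ?thesis by (simp add: u_def i)
  qed
  have "sum t J = sum t J0"
    unfolding J0_def using J by (intro sum.mono_neutral_right) auto
  also have "\<dots> \<le> (\<Sum>j\<in>J0. u (nat (j - j0)))" by (intro sum_mono tu)
  also have "\<dots> = sum u ((\<lambda>j. nat (j - j0)) ` J0)"
  proof -
    have "inj_on (\<lambda>j. nat (j - j0)) J0"
      using j0(3) by (auto simp: inj_on_def) (metis diff_ge_0_iff_ge eq_diff_eq eq_nat_nat_iff)
    then show ?thesis by (simp add: sum.reindex)
  qed
  also have "\<dots> \<le> sum u {..<Max ((\<lambda>j. nat (j - j0)) ` J0) + 1 + 3}"
  proof (intro sum_mono2)
    show "(\<lambda>j. nat (j - j0)) ` J0 \<subseteq> {..<Max ((\<lambda>j. nat (j - j0)) ` J0) + 1 + 3}"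
    proof
      fix n assume "n \<in> (\<lambda>j. nat (j - j0)) ` J0"
      then have "n \<le> Max ((\<lambda>j. nat (j - j0)) ` J0)" using J0 by (intro Max_ge) auto
      then show "n \<in> {..<Max ((\<lambda>j. nat (j - j0)) ` J0) + 1 + 3}" by simp
    qed
  qed (use th in \<open>auto simp: u_def\<close>)
  also have "\<dots> = sum u {..<3} + (\<Sum>n<Max ((\<lambda>j. nat (j - j0)) ` J0) + 1. \<theta> ^ n)"
  proof -
    have "sum u {..<M + 3} = sum u {..<3} + (\<Sum>n<M. \<theta> ^ n)" for M
    proof (induction M)
      case (Suc M)
      have "u (M + 3) = \<theta> ^ M" by (simp add: u_def)
      then show ?case using Suc by (simp only: add_Suc sum.lessThan_Suc add.assoc)
    qed simp
    then show ?thesis .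
  qed
  also have "(\<Sum>n<Max ((\<lambda>j. nat (j - j0)) ` J0) + 1. \<theta> ^ n) \<le> (\<Sum>n. \<theta> ^ n)"
    using th by (intro sum_le_suminf summable_geometric) auto
  also have "\<dots> = 1 / (1 - \<theta>)"
    using th by (intro suminf_geometric) auto
  finally show ?thesis by (simp add: u_def)
qed

section \<open>Level sets of the weight and the mixed inequality on one grid\<close>

context A1_weight
begin

lemma K_pos: "0 < K" using K_ge by simp

text \<open>The base is the constant of \<open>nu_decay\<close>, so one step of decay is exactly one
  level.\<close>

definition level :: "int \<Rightarrow> (real^'n) set" where
  "level j = {x. K powr of_int j < \<omega> x \<and> \<omega> x \<le> K powr (of_int j + 1)}"

lemma sets_level [measurable]: "level j \<in> sets lebesgue"
proof -
  have "level j = {x\<in>space lebesgue. K powr of_int j < \<omega> x \<and> \<omega> x \<le> K powr (of_int j + 1)}"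
    by (auto simp: level_def)
  also have "\<dots> \<in> sets lebesgue" by measurable
  finally show ?thesis .
qed

lemma level_exists: "\<exists>j. x \<in> level j"
proof
  have e: "\<omega> x = K powr (log K (\<omega> x))" using K_ge omega_pos[of x] by simp
  have "of_int (\<lceil>log K (\<omega> x)\<rceil> - 1) < log K (\<omega> x)" "log K (\<omega> x) \<le> of_int (\<lceil>log K (\<omega> x)\<rceil> - 1) + 1"
    by linarith+
  then show "x \<in> level (\<lceil>log K (\<omega> x)\<rceil> - 1)"
    unfolding level_def mem_Collect_eq using K_ge by (subst (1 2) e) (auto intro: powr_mono)
qed

lemma level_disjoint: "x \<in> level i \<Longrightarrow> x \<in> level j \<Longrightarrow> i = j"
proof (rule ccontr)
  have *: False if "x \<in> level i" "x \<in> level j" "i < j" for i j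
  proof -
    have "K powr (of_int i + 1) \<le> K powr of_int j" using that K_ge by (intro powr_mono) auto
    then show False using that by (auto simp: level_def)
  qed
  assume "x \<in> level i" "x \<in> level j" "i \<noteq> j"
  then show False using *[of i j] *[of j i] by linarith
qed

text \<open>\<open>share\<close> and \<open>avg\<close> play the roles of \<open>t\<close> and
  \<open>m\<close> in \<open>level_sum_bound\<close>.\<close>

definition share :: "int \<Rightarrow> (real^'n) set \<Rightarrow> real" where
  "share j Q = measure \<nu> (Q \<inter> level j) / measure \<nu> Q"

definition avg :: "(real^'n) set \<Rightarrow> real" where
  "avg Q = measure \<nu> Q / measure lebesgue Q"

lemma share_bounds:
  assumes Q: "Q \<in> dyadic_grid T" shows "0 \<le> share j Q" "share j Q \<le> 1"
proof -
  have "measure \<nu> (Q \<inter> level j) \<le> measure \<nu> Q"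
    using sets_lebesgue_dyadic_grid[OF Q] by (intro measure_mono_fmeasurable fmeasurable_nu[OF Q]) auto
  then show "share j Q \<le> 1" using measure_nu_pos[OF Q] by (simp add: share_def)
qed (simp add: share_def)

text \<open>By A_1 the average is at most A \<omega> almost everywhere on \<open>Q\<close>. If the
  level set has positive mass in \<open>Q\<close>, this can be evaluated at a point of it.\<close>

lemma share_nonzero:
  assumes Q: "Q \<in> dyadic_grid T" and "share j Q \<noteq> 0"
  shows "avg Q \<le> A * K powr (of_int j + 1)"
proof (rule ccontr)
  assume "\<not> ?thesis"
  then have lt: "A * K powr (of_int j + 1) < avg Q" by simp
  have mQ: "0 < measure lebesgue Q" by (rule measure_dyadic_grid_pos[OF Q])
  have "AE x in lebesgue. x \<notin> Q \<inter> level j"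
    using A1_dyadic_measure[OF Q]
  proof (rule eventually_mono, intro notI)
    fix x assume *: "x \<in> Q \<longrightarrow> measure \<nu> Q \<le> A * measure lebesgue Q * \<omega> x" "x \<in> Q \<inter> level j"
    then have "avg Q \<le> A * \<omega> x" using mQ by (auto simp: avg_def field_simps)
    also have "\<dots> \<le> A * K powr (of_int j + 1)" using * A_ge_1 by (auto simp: level_def)
    finally show False using lt by simp
  qed
  then have "AE x in \<nu>. x \<notin> Q \<inter> level j" by (simp only: AE_nu)
  then have "measure \<nu> (Q \<inter> level j) = 0"
    using sets_lebesgue_dyadic_grid[OF Q] by (intro measure_eq_0_null_sets) (auto simp: AE_iff_null_sets)
  then show False using assms(2) by (simp add: share_def)
qed

lemma avg_mono:
  assumes "Q \<in> dyadic_grid T" "P \<in> dyadic_grid T" "P \<subseteq> Q"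
  shows "avg Q \<le> A * avg P"
  using nu_doubling[OF assms(1,3)] sets_lebesgue_dyadic_grid[OF assms(2)]
    measure_dyadic_grid_pos[OF assms(1)] measure_dyadic_grid_pos[OF assms(2)]
  by (simp add: avg_def field_simps)

lemma share_decay:
  assumes Q: "Q \<in> dyadic_grid T" and K: "K ^ i * avg Q \<le> K powr of_int j"
  shows "share j Q \<le> \<theta> ^ i"
proof -
  have "{x\<in>Q. K ^ i * avg Q < \<omega> x} = Q \<inter> {x\<in>space lebesgue. K ^ i * avg Q < \<omega> x}" by auto
  also have "\<dots> \<in> sets lebesgue"
    by (intro sets.Int sets_lebesgue_dyadic_grid[OF Q]) measurable
  finally have "measure \<nu> (Q \<inter> level j) \<le> measure \<nu> {x\<in>Q. K ^ i * avg Q < \<omega> x}"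
    using K sets_lebesgue_dyadic_grid[OF Q] fmeasurable_nu[OF Q]
    by (intro measure_mono_fmeasurable fmeasurableI2[OF fmeasurable_nu[OF Q]]) (auto simp: level_def)
  also have "\<dots> \<le> \<theta> ^ i * measure \<nu> Q"
    using measure_dyadic_grid_pos[OF Q] by (intro nu_decay[OF Q]) (simp add: avg_def)
  finally show ?thesis using measure_nu_pos[OF Q] by (simp add: share_def divide_le_eq)
qed

text \<open>The factor \<open>K\<close> is the oscillation of \<omega> on one level; the other
  factor is the bound of \<open>level_sum_bound\<close> for the overlaps.\<close>

definition CS :: real where "CS = K * (3 + 1 / (1 - \<theta>))"

text \<open>\<beta> = 0 gives \<nu>, \<beta> = 1 gives Lebesgue measure, and \<beta> = 1 - \<rho> D
  gives the product weight of the conclusion. All three values occur.\<close>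

definition mixed :: "real \<Rightarrow> (real^'n) measure" where
  "mixed \<beta> = density lebesgue (\<lambda>x. ennreal (\<omega> x powr (1 - \<beta>)))"

lemma sets_mixed [simp, measurable_cong]: "sets (mixed \<beta>) = sets lebesgue"
  by (simp add: mixed_def)

lemma CS_pos: "0 < CS"
  using K_pos theta by (auto simp: CS_def intro!: mult_pos_pos add_pos_pos)

text \<open>The set where \<omega>^\<beta> times the maximal function of k/\<omega> over the cubes
  in \<open>S\<close>, taken with respect to \<nu>, exceeds \<open>s\<close>; the averages are
  written without division.\<close>

definition bad :: "real \<Rightarrow> real \<Rightarrow> (real^'n \<Rightarrow> ennreal) \<Rightarrow> (real^'n) set set \<Rightarrow> (real^'n) set" where
  "bad s \<beta> k S = (\<Union>Q\<in>S. {x\<in>Q. ennreal (s * measure \<nu> Q) < ennreal (\<omega> x powr \<beta>) * (\<integral>\<^sup>+y\<in>Q. k y \<partial>lebesgue)})"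

lemma sets_bad:
  assumes "countable S" "S \<subseteq> dyadic_grid T"
  shows "bad s \<beta> k S \<in> sets lebesgue"
  unfolding bad_def
proof (rule sets.countable_UN''[OF assms(1)])
  fix Q assume "Q \<in> S"
  then have Q: "Q \<in> sets lebesgue" using assms sets_lebesgue_dyadic_grid by auto
  have "{x\<in>Q. ennreal (s * measure \<nu> Q) < ennreal (\<omega> x powr \<beta>) * (\<integral>\<^sup>+y\<in>Q. k y \<partial>lebesgue)}
     = Q \<inter> {x\<in>space lebesgue. ennreal (s * measure \<nu> Q) < ennreal (\<omega> x powr \<beta>) * (\<integral>\<^sup>+y\<in>Q. k y \<partial>lebesgue)}"
    by auto
  also have "{x\<in>space lebesgue. a < ennreal (\<omega> x powr \<beta>) * b} \<in> sets lebesgue" for a b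
    by measurable
  then have "Q \<inter> {x\<in>space lebesgue. ennreal (s * measure \<nu> Q) < ennreal (\<omega> x powr \<beta>) * (\<integral>\<^sup>+y\<in>Q. k y \<partial>lebesgue)} \<in> sets lebesgue"
    using Q by auto
  finally show "{x\<in>Q. ennreal (s * measure \<nu> Q) < ennreal (\<omega> x powr \<beta>) * (\<integral>\<^sup>+y\<in>Q. k y \<partial>lebesgue)} \<in> sets lebesgue" .
qed

text \<open>On a level set of \<open>\<omega>\<close> the two weights are almost constant, so one can use the maximal cubes of
  a family which increases with the level. The families of all levels overlap, but the overlaps
  are summable by the decay of \<open>share\<close>.\<close>
lemma mixed_weak_type_levels:
  assumes S: "finite S" "S \<subseteq> dyadic_grid T" and J: "finite J"
    and s: "0 < s" and \<beta>: "0 \<le> \<beta>" "\<beta> \<le> 1"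
    and [measurable]: "k \<in> borel_measurable lebesgue"
  shows "(\<Sum>j\<in>J. ennreal s * emeasure (mixed \<beta>) (bad s \<beta> k S \<inter> level j)) \<le> ennreal CS * (\<integral>\<^sup>+x. k x \<partial>lebesgue)"
proof -
  define I where "I Q = (\<integral>\<^sup>+y\<in>Q. k y \<partial>lebesgue)" for Q
  \<comment> \<open>With \<omega>^\<beta> replaced by its largest value on the level, the condition
    concerns the cube alone. Since \<beta> >= 0, these families increase with
    \<open>j\<close>.\<close>
  define Sj where "Sj j = {Q\<in>S. ennreal (s * measure \<nu> Q) < ennreal (K powr ((of_int j + 1) * \<beta>)) * I Q}" for j
  define F where "F j = {P \<in> Sj j. \<forall>R\<in>Sj j. P \<subseteq> R \<longrightarrow> R = P}" for j
  have SjS: "Sj j \<subseteq> S" "F j \<subseteq> Sj j" "Sj j \<subseteq> dyadic_grid T" "F j \<subseteq> dyadic_grid T" for j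
    using S by (auto simp: Sj_def F_def)
  have finF: "finite (F j)" for j using SjS S(1) finite_subset by (metis order_trans)
  have fin: "finite {R \<in> Sj j. Q \<subseteq> R}" for j Q
    by (rule finite_subset[OF _ S(1)]) (auto simp: Sj_def)
  have lam: "\<And>P Q. P \<in> Sj j \<Longrightarrow> Q \<in> Sj j \<Longrightarrow> P \<inter> Q \<noteq> {} \<Longrightarrow> P \<subseteq> Q \<or> Q \<subseteq> P" for j
    using laminar_dyadic_grid SjS by blast
  have F: "disjoint (F j)" "\<Union>(F j) = \<Union>(Sj j)" for j
    using laminar_maximal[OF lam fin] unfolding F_def[symmetric] by auto
  have Fs: "Q \<in> sets lebesgue" if "Q \<in> F j" for Q j
    using that SjS sets_lebesgue_dyadic_grid by blast
  have badF: "bad s \<beta> k S \<inter> level j \<subseteq> (\<Union>Q\<in>F j. Q \<inter> level j)" for j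
  proof
    fix x assume x: "x \<in> bad s \<beta> k S \<inter> level j"
    then obtain Q where Q: "Q \<in> S" "x \<in> Q" "ennreal (s * measure \<nu> Q) < ennreal (\<omega> x powr \<beta>) * I Q"
      by (auto simp: bad_def I_def)
    have "\<omega> x powr \<beta> \<le> (K powr (of_int j + 1)) powr \<beta>"
      using x \<beta> omega_pos[of x] by (intro powr_mono2) (auto simp: level_def)
    then have "ennreal (\<omega> x powr \<beta>) * I Q \<le> ennreal (K powr ((of_int j + 1) * \<beta>)) * I Q"
      by (intro mult_right_mono ennreal_leI) (auto simp: powr_powr)
    then have "Q \<in> Sj j" using Q by (auto simp: Sj_def)
    then show "x \<in> (\<Union>Q\<in>F j. Q \<inter> level j)" using x Q F(2)[of j] by auto
  qed
  have lev: "emeasure (mixed \<beta>) (Q \<inter> level j) \<le> ennreal (K powr (- of_int j * \<beta>)) * emeasure \<nu> (Q \<inter> level j)"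
    if "Q \<in> sets lebesgue" for Q j
  proof -
    have "emeasure (mixed \<beta>) (Q \<inter> level j) = (\<integral>\<^sup>+x\<in>Q \<inter> level j. ennreal (\<omega> x powr (1 - \<beta>)) \<partial>lebesgue)"
      using that unfolding mixed_def by (subst emeasure_density) auto
    also have "\<dots> \<le> (\<integral>\<^sup>+x. ennreal (K powr (- of_int j * \<beta>)) * (ennreal (\<omega> x) * indicator (Q \<inter> level j) x) \<partial>lebesgue)"
    proof (intro nn_integral_mono)
      fix x
      have "\<omega> x powr (1 - \<beta>) \<le> K powr (- of_int j * \<beta>) * \<omega> x" if "x \<in> level j"
      proof -
        have "\<omega> x powr (- \<beta>) \<le> (K powr of_int j) powr (- \<beta>)"
          using that \<beta> K_pos by (intro powr_mono2') (auto simp: level_def)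
        then have "\<omega> x powr (- \<beta>) \<le> K powr (- of_int j * \<beta>)" by (simp add: powr_powr)
        then have "\<omega> x powr (- \<beta>) * \<omega> x \<le> K powr (- of_int j * \<beta>) * \<omega> x"
          using omega_pos[of x] by (intro mult_right_mono) auto
        moreover have "\<omega> x powr (1 - \<beta>) = \<omega> x powr (- \<beta>) * \<omega> x"
          using omega_pos[of x] by (simp add: powr_diff powr_minus field_simps)
        ultimately show ?thesis by simp
      qed
      then show "ennreal (\<omega> x powr (1 - \<beta>)) * indicator (Q \<inter> level j) x
          \<le> ennreal (K powr (- of_int j * \<beta>)) * (ennreal (\<omega> x) * indicator (Q \<inter> level j) x)"
        using omega_pos[of x]
        by (auto split: split_indicator simp: ennreal_mult[symmetric] less_imp_le ennreal_leI)
    qed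
    also have "\<dots> = ennreal (K powr (- of_int j * \<beta>)) * emeasure \<nu> (Q \<inter> level j)"
      using that by (subst nn_integral_cmult) (auto simp: emeasure_nu)
    finally show ?thesis .
  qed
  have cube: "ennreal s * emeasure (mixed \<beta>) (Q \<inter> level j) \<le> ennreal (K * share j Q) * I Q"
    if Q: "Q \<in> F j" for Q j
  proof -
    have Qg: "Q \<in> dyadic_grid T" using Q SjS(4)[of j] by blast
    have [measurable]: "Q \<in> sets lebesgue" using Fs Q .
    have nuQ: "emeasure \<nu> (Q \<inter> level j) = ennreal (share j Q * measure \<nu> Q)"
      using measure_nu_pos[OF Qg] emeasure_nu_eq[OF Qg, of "Q \<inter> level j"] by (simp add: share_def)
    have sh: "0 \<le> share j Q" using share_bounds[OF Qg] by simp
    have "ennreal s * emeasure (mixed \<beta>) (Q \<inter> level j)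
       \<le> ennreal s * (ennreal (K powr (- of_int j * \<beta>)) * ennreal (share j Q * measure \<nu> Q))"
      using lev[of Q j] nuQ by (intro mult_left_mono) auto
    also have "\<dots> = ennreal (share j Q * K powr (- of_int j * \<beta>)) * ennreal (s * measure \<nu> Q)"
      using s sh by (simp add: ennreal_mult[symmetric] mult_ac)
    also have "\<dots> \<le> ennreal (share j Q * K powr (- of_int j * \<beta>)) * (ennreal (K powr ((of_int j + 1) * \<beta>)) * I Q)"
    proof (intro mult_left_mono)
      have "Q \<in> Sj j" using Q SjS(2)[of j] by blast
      then show "ennreal (s * measure \<nu> Q) \<le> ennreal (K powr ((of_int j + 1) * \<beta>)) * I Q"
        by (simp add: Sj_def less_imp_le)
    qed simp
    also have "\<dots> = ennreal (share j Q * (K powr (- of_int j * \<beta>) * K powr ((of_int j + 1) * \<beta>))) * I Q"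
      using sh by (simp add: ennreal_mult mult_ac)
    \<comment> \<open>The measure was estimated with the lower bound of \<omega> on the level and
      the maximal function with the upper one. The discrepancy costs K^\<beta>, at most
      \<open>K\<close> because \<beta> <= 1.\<close>
    also have "K powr (- of_int j * \<beta>) * K powr ((of_int j + 1) * \<beta>) = K powr \<beta>"
      by (simp add: powr_add[symmetric] algebra_simps)
    also have "ennreal (share j Q * K powr \<beta>) * I Q \<le> ennreal (K * share j Q) * I Q"
    proof (intro mult_right_mono ennreal_leI)
      have "K powr \<beta> \<le> K powr 1" using K_ge \<beta> by (intro powr_mono) auto
      then show "share j Q * K powr \<beta> \<le> K * share j Q"
        using sh K_pos mult_left_mono[of "K powr \<beta>" K "share j Q"] by (simp add: mult.commute)
    qed simp
    finally show ?thesis .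
  qed
  have one: "ennreal s * emeasure (mixed \<beta>) (bad s \<beta> k S \<inter> level j)
      \<le> (\<integral>\<^sup>+x. (\<Sum>Q\<in>F j. ennreal (K * share j Q) * (k x * indicator Q x)) \<partial>lebesgue)" for j
  proof -
    have "emeasure (mixed \<beta>) (bad s \<beta> k S \<inter> level j) \<le> emeasure (mixed \<beta>) (\<Union>Q\<in>F j. Q \<inter> level j)"
      unfolding sets_mixed
      by (intro emeasure_mono badF) (simp only: sets_mixed, intro sets.finite_UN finF sets.Int Fs sets_level)
    also have "\<dots> \<le> (\<Sum>Q\<in>F j. emeasure (mixed \<beta>) (Q \<inter> level j))"
      using finF Fs by (intro emeasure_subadditive_finite) auto
    finally have "ennreal s * emeasure (mixed \<beta>) (bad s \<beta> k S \<inter> level j)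
      \<le> (\<Sum>Q\<in>F j. ennreal s * emeasure (mixed \<beta>) (Q \<inter> level j))"
      by (simp add: sum_distrib_left[symmetric] mult_left_mono)
    also have "\<dots> \<le> (\<Sum>Q\<in>F j. ennreal (K * share j Q) * I Q)"
      by (intro sum_mono cube)
    also have "\<dots> = (\<integral>\<^sup>+x. (\<Sum>Q\<in>F j. ennreal (K * share j Q) * (k x * indicator Q x)) \<partial>lebesgue)"
      using Fs by (subst nn_integral_sum) (auto simp: I_def nn_integral_cmult)
    finally show ?thesis .
  qed
  have mono: "Sj i \<subseteq> Sj j" if "i \<le> j" for i j
  proof -
    have "K powr ((of_int i + 1) * \<beta>) \<le> K powr ((of_int j + 1) * \<beta>)"
      using K_ge \<beta> that by (intro powr_mono mult_right_mono) auto
    then have "ennreal (K powr ((of_int i + 1) * \<beta>)) * I Q \<le> ennreal (K powr ((of_int j + 1) * \<beta>)) * I Q" for Q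
      by (intro mult_right_mono ennreal_leI) auto
    then show ?thesis unfolding Sj_def by (blast intro: less_le_trans)
  qed
  \<comment> \<open>At each level at most one maximal cube contains \<open>x\<close>. It remains to
    sum the shares along the resulting chain of cubes.\<close>
  have point: "(\<Sum>j\<in>J. \<Sum>Q\<in>F j. share j Q * indicator Q x) \<le> 3 + 1 / (1 - \<theta>)" for x
  proof -
    define J' where "J' = {j\<in>J. x \<in> \<Union>(F j)}"
    define q where "q j = (SOME Q. Q \<in> F j \<and> x \<in> Q)" for j
    have q: "q j \<in> F j" "x \<in> q j" if "j \<in> J'" for j
      using someI_ex[of "\<lambda>Q. Q \<in> F j \<and> x \<in> Q"] that by (auto simp: J'_def q_def)
    have qg: "q j \<in> dyadic_grid T" if "j \<in> J'" for j using q[OF that] SjS(4)[of j] by blast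
    have in0: "(\<Sum>Q\<in>F j. share j Q * indicator Q x) = 0" if "j \<in> J - J'" for j
      using that by (auto simp: J'_def intro!: sum.neutral)
    have in1: "(\<Sum>Q\<in>F j. share j Q * indicator Q x) = share j (q j)" if j: "j \<in> J'" for j
    proof -
      have "(\<Sum>Q\<in>F j. share j Q * indicator Q x) = (\<Sum>Q\<in>{q j}. share j Q * indicator Q x)"
      proof (rule sum.mono_neutral_right[OF finF])
        show "\<forall>Q\<in>F j - {q j}. share j Q * indicator Q x = 0"
          using F(1)[of j] q[OF j] by (auto simp: disjoint_def indicator_def)
      qed (use q[OF j] in auto)
      then show ?thesis using q[OF j] by simp
    qed
    have "(\<Sum>j\<in>J. \<Sum>Q\<in>F j. share j Q * indicator Q x) = (\<Sum>j\<in>J'. \<Sum>Q\<in>F j. share j Q * indicator Q x)"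
      using J in0 by (intro sum.mono_neutral_right) (auto simp: J'_def)
    also have "\<dots> = (\<Sum>j\<in>J'. share j (q j))" using in1 by (intro sum.cong) auto
    also have "\<dots> \<le> 3 + 1 / (1 - \<theta>)"
    proof (rule level_sum_bound[where m = "\<lambda>j. avg (q j)" and A = A and K = K])
      show "finite J'" using J by (simp add: J'_def)
      show "\<And>j. j \<in> J' \<Longrightarrow> 0 \<le> share j (q j) \<and> share j (q j) \<le> 1"
        using share_bounds[OF qg] by auto
      show "\<And>j. j \<in> J' \<Longrightarrow> share j (q j) \<noteq> 0 \<Longrightarrow> avg (q j) \<le> A * K powr (of_int j + 1)"
        using share_nonzero[OF qg] by auto
      show "\<And>j i. j \<in> J' \<Longrightarrow> K ^ i * avg (q j) \<le> K powr of_int j \<Longrightarrow> share j (q j) \<le> \<theta> ^ i"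
        using share_decay[OF qg] by auto
      fix i j assume ij: "i \<in> J'" "j \<in> J'" "i \<le> j"
      \<comment> \<open>Because the families increase, both cubes belong to the family of level
        \<open>j\<close>, in which \<open>q j\<close> is maximal. Both contain \<open>x\<close>, so
        the chain increases with the level and \<open>avg_mono\<close> applies.\<close>
      have "q i \<in> Sj j" using q(1)[OF ij(1)] SjS(2)[of i] mono[OF ij(3)] by blast
      moreover have "q j \<in> Sj j" using q(1)[OF ij(2)] SjS(2)[of j] by blast
      ultimately have "q j \<subseteq> q i \<or> q i \<subseteq> q j" using lam[of "q i" j "q j"] q(2)[OF ij(1)] q(2)[OF ij(2)] by blast
      then have "q i \<subseteq> q j" using q[OF ij(2)] \<open>q i \<in> Sj j\<close> by (auto simp: F_def)
      then show "avg (q j) \<le> A * avg (q i)" using avg_mono qg ij by blast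
    qed (use A_ge_1 K_ge theta in \<open>auto simp: avg_def\<close>)
    finally show ?thesis .
  qed
  have shF: "0 \<le> share j Q" if "Q \<in> F j" for j Q
    using share_bounds(1) SjS(4)[of j] that by blast
  have "(\<Sum>j\<in>J. ennreal s * emeasure (mixed \<beta>) (bad s \<beta> k S \<inter> level j))
     \<le> (\<Sum>j\<in>J. \<integral>\<^sup>+x. (\<Sum>Q\<in>F j. ennreal (K * share j Q) * (k x * indicator Q x)) \<partial>lebesgue)"
    by (intro sum_mono one)
  also have "\<dots> = (\<integral>\<^sup>+x. (\<Sum>j\<in>J. \<Sum>Q\<in>F j. ennreal (K * share j Q) * (k x * indicator Q x)) \<partial>lebesgue)"
    using Fs by (subst nn_integral_sum) auto
  also have "\<dots> \<le> (\<integral>\<^sup>+x. ennreal CS * k x \<partial>lebesgue)"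
  proof (intro nn_integral_mono)
    fix x
    have "(\<Sum>j\<in>J. \<Sum>Q\<in>F j. ennreal (K * share j Q) * (k x * indicator Q x))
       = (\<Sum>j\<in>J. \<Sum>Q\<in>F j. ennreal (K * (share j Q * indicator Q x))) * k x"
      unfolding sum_distrib_right by (intro sum.cong refl) (auto split: split_indicator)
    also have "(\<Sum>j\<in>J. \<Sum>Q\<in>F j. ennreal (K * (share j Q * indicator Q x)))
       = (\<Sum>j\<in>J. ennreal (\<Sum>Q\<in>F j. K * (share j Q * indicator Q x)))"
      using shF K_pos by (intro sum.cong refl sum_ennreal) (auto intro!: mult_nonneg_nonneg)
    also have "\<dots> = ennreal (\<Sum>j\<in>J. \<Sum>Q\<in>F j. K * (share j Q * indicator Q x))"
      using shF K_pos by (intro sum_ennreal sum_nonneg) (auto intro!: mult_nonneg_nonneg)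
    also have "(\<Sum>j\<in>J. \<Sum>Q\<in>F j. K * (share j Q * indicator Q x)) = K * (\<Sum>j\<in>J. \<Sum>Q\<in>F j. share j Q * indicator Q x)"
      by (simp add: sum_distrib_left)
    also have "ennreal \<dots> \<le> ennreal CS"
      unfolding CS_def using point[of x] K_pos by (intro ennreal_leI mult_left_mono) auto
    finally show "(\<Sum>j\<in>J. \<Sum>Q\<in>F j. ennreal (K * share j Q) * (k x * indicator Q x)) \<le> ennreal CS * k x"
      by (simp add: mult_right_mono)
  qed
  also have "\<dots> = ennreal CS * (\<integral>\<^sup>+x. k x \<partial>lebesgue)"
    by (intro nn_integral_cmult) simp
  finally show ?thesis .
qed

lemma mixed_weak_type_finite:
  assumes S: "finite S" "S \<subseteq> dyadic_grid T"
    and s: "0 < s" and \<beta>: "0 \<le> \<beta>" "\<beta> \<le> 1"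
    and k: "k \<in> borel_measurable lebesgue"
  shows "ennreal s * emeasure (mixed \<beta>) (bad s \<beta> k S) \<le> ennreal CS * (\<integral>\<^sup>+x. k x \<partial>lebesgue)"
proof -
  have [measurable]: "bad s \<beta> k S \<in> sets lebesgue"
    using S by (intro sets_bad[of _ T] countable_finite)
  define G where "G n = bad s \<beta> k S \<inter> level (int_decode n)" for n
  have "bad s \<beta> k S = (\<Union>n. G n)"
  proof (intro equalityI subsetI)
    fix x assume x: "x \<in> bad s \<beta> k S"
    obtain j where "x \<in> level j" using level_exists by blast
    then have "x \<in> G (int_encode j)" using x by (simp add: G_def)
    then show "x \<in> (\<Union>n. G n)" by blast
  qed (auto simp: G_def)
  moreover have "disjoint_family G"
    unfolding disjoint_family_on_def G_def
  proof (intro ballI impI)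
    fix m n :: nat assume "m \<noteq> n"
    then have "int_decode m \<noteq> int_decode n" by (metis int_decode_inverse)
    then show "bad s \<beta> k S \<inter> level (int_decode m) \<inter> (bad s \<beta> k S \<inter> level (int_decode n)) = {}"
      using level_disjoint by blast
  qed
  moreover have Gs: "range G \<subseteq> sets (mixed \<beta>)" by (auto simp: G_def)
  ultimately have "emeasure (mixed \<beta>) (bad s \<beta> k S) = (\<Sum>n. emeasure (mixed \<beta>) (G n))"
    using suminf_emeasure[of G "mixed \<beta>"] by simp
  then have "ennreal s * emeasure (mixed \<beta>) (bad s \<beta> k S) = (\<Sum>n. ennreal s * emeasure (mixed \<beta>) (G n))"
    by simp
  also have "\<dots> \<le> ennreal CS * (\<integral>\<^sup>+x. k x \<partial>lebesgue)"
  proof (rule suminf_le_const)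
    fix n
    have "(\<Sum>i<n. ennreal s * emeasure (mixed \<beta>) (G i))
      = (\<Sum>j\<in>int_decode ` {..<n}. ennreal s * emeasure (mixed \<beta>) (bad s \<beta> k S \<inter> level j))"
      by (subst sum.reindex) (auto simp: G_def inj_int_decode)
    then show "(\<Sum>i<n. ennreal s * emeasure (mixed \<beta>) (G i)) \<le> ennreal CS * (\<integral>\<^sup>+x. k x \<partial>lebesgue)"
      using mixed_weak_type_levels[OF S _ s \<beta> k, of "int_decode ` {..<n}"] by simp
  qed simp
  finally show ?thesis .
qed

text \<open>A grid has infinite increasing chains, so an arbitrary family may have no maximal cubes.
  The estimate is uniform over finite subfamilies and passes to the increasing union.\<close>

lemma mixed_weak_type:
  assumes S: "S \<subseteq> dyadic_grid T"
    and s: "0 < s" and \<beta>: "0 \<le> \<beta>" "\<beta> \<le> 1"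
    and k: "k \<in> borel_measurable lebesgue"
  shows "ennreal s * emeasure (mixed \<beta>) (bad s \<beta> k S) \<le> ennreal CS * (\<integral>\<^sup>+x. k x \<partial>lebesgue)"
proof (cases "S = {}")
  case True
  then show ?thesis by (simp add: bad_def)
next
  case False
  have cS: "countable S" using S countable_dyadic_grid countable_subset by blast
  define H where "H n = bad s \<beta> k (from_nat_into S ` {..n})" for n
  have HS: "from_nat_into S ` {..n} \<subseteq> dyadic_grid T" for n
    using S from_nat_into[OF False] by auto
  have "bad s \<beta> k S = (\<Union>n. H n)"
  proof -
    have "S = (\<Union>n. from_nat_into S ` {..n})"
    proof -
      have "(\<Union>n. from_nat_into S ` {..n}) = range (from_nat_into S)"
        by (auto intro: exI[of _ "_::nat"])
      then show ?thesis using range_from_nat_into[OF False cS] by simp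
    qed
    then have "bad s \<beta> k S = bad s \<beta> k (\<Union>n. from_nat_into S ` {..n})" by (rule arg_cong)
    also have "\<dots> = (\<Union>n. H n)"
      unfolding bad_def H_def by blast
    finally show ?thesis .
  qed
  moreover have "incseq H" unfolding incseq_def H_def bad_def by (auto, force)
  moreover have "range H \<subseteq> sets (mixed \<beta>)"
    using HS by (auto simp: H_def intro!: sets_bad[of _ T])
  ultimately have "emeasure (mixed \<beta>) (bad s \<beta> k S) = (SUP n. emeasure (mixed \<beta>) (H n))"
    using SUP_emeasure_incseq[of H "mixed \<beta>"] by simp
  then have "ennreal s * emeasure (mixed \<beta>) (bad s \<beta> k S) = (SUP n. ennreal s * emeasure (mixed \<beta>) (H n))"
    by (simp add: SUP_mult_left_ennreal)
  also have "\<dots> \<le> ennreal CS * (\<integral>\<^sup>+x. k x \<partial>lebesgue)"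
    unfolding H_def by (intro SUP_least mixed_weak_type_finite[OF _ HS s \<beta> k]) auto
  finally show ?thesis .
qed

end

section \<open>An A_1-majorant of an integrable function\<close>

lemma ennreal_divide_le_iff:
  fixes a b c :: ennreal
  assumes "0 < c" "c < \<infinity>"
  shows "a / c \<le> b \<longleftrightarrow> a \<le> c * b"
proof
  assume "a / c \<le> b"
  then have "c * (a / c) \<le> c * b" by (rule mult_left_mono) simp
  moreover have "c * (a / c) = a"
    using assms ennreal_mult_divide_eq[of c a] by (simp add: ennreal_times_divide mult.commute)
  ultimately show "a \<le> c * b" by simp
next
  assume "a \<le> c * b"
  then show "a / c \<le> b" using assms by (intro divide_le_posI_ennreal) (auto simp: mult.commute)
qed

lemma sets_lebesgue_Collect_in:
  assumes "Q \<in> sets lebesgue" "{x\<in>space lebesgue. R x} \<in> sets lebesgue"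
  shows "{x\<in>Q. R x} \<in> sets lebesgue"
proof -
  have "{x\<in>Q. R x} = Q \<inter> {x\<in>space lebesgue. R x}" by auto
  then show ?thesis using assms by auto
qed

lemma INF_ennreal_mult_left_le:
  fixes X :: "'a \<Rightarrow> ennreal"
  assumes "\<And>y. y \<in> Q \<Longrightarrow> a \<le> c * X y" "0 < c" "c < \<infinity>"
  shows "a \<le> c * (INF y\<in>Q. X y)"
  using assms by (simp add: ennreal_divide_le_iff[symmetric] le_INF_iff)

section \<open>The maximal function over all grids\<close>

context A1_weight
begin

definition grids :: "(real^'n) set set" where "grids = (\<Union>T. dyadic_grid T)"

lemma countable_grids: "countable grids"
  unfolding grids_def by (intro countable_UN countable_dyadic_grid) (simp add: countable_finite)

text \<open>Taking the supremum with \<open>k/\<omega>\<close> makes the differentiation theorem unnecessary.\<close>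
definition maximal :: "(real^'n \<Rightarrow> real) \<Rightarrow> real^'n \<Rightarrow> ennreal" where
  "maximal k x = sup (ennreal (k x / \<omega> x))
     (SUP P\<in>grids. (\<integral>\<^sup>+y\<in>P. ennreal (k y) \<partial>lebesgue) / emeasure \<nu> P * indicator P x)"

lemma sets_grids: "P \<in> grids \<Longrightarrow> P \<in> sets lebesgue"
  by (auto simp: grids_def sets_lebesgue_dyadic_grid)

lemma borel_measurable_maximal [measurable]:
  assumes [measurable]: "k \<in> borel_measurable lebesgue"
  shows "maximal k \<in> borel_measurable lebesgue"
proof -
  have "(\<lambda>x. c * indicator P x :: ennreal) \<in> borel_measurable lebesgue" if "P \<in> grids" for c P
    using sets_grids[OF that] by measurable
  then have "(\<lambda>x. SUP P\<in>grids. (\<integral>\<^sup>+y\<in>P. ennreal (k y) \<partial>lebesgue) / emeasure \<nu> P * indicator P x) \<in> borel_measurable lebesgue"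
    by (intro borel_measurable_SUP countable_grids)
  then show ?thesis unfolding maximal_def by measurable
qed

lemma integral_le_maximal:
  assumes P: "P \<in> dyadic_grid T" and y: "y \<in> P"
  shows "(\<integral>\<^sup>+y\<in>P. ennreal (k y) \<partial>lebesgue) \<le> emeasure \<nu> P * maximal k y"
proof -
  have g: "P \<in> grids" using P by (auto simp: grids_def)
  have pos: "0 < emeasure \<nu> P" "emeasure \<nu> P < \<infinity>"
    using emeasure_nu_pos[OF sets_lebesgue_dyadic_grid[OF P] emeasure_dyadic_grid_pos(1)[OF P]]
      emeasure_nu_dyadic_finite[OF P] by auto
  have "(\<integral>\<^sup>+y\<in>P. ennreal (k y) \<partial>lebesgue) / emeasure \<nu> P * indicator P y \<le> maximal k y"
    unfolding maximal_def by (rule le_supI2, rule SUP_upper[OF g])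
  then have "(\<integral>\<^sup>+y\<in>P. ennreal (k y) \<partial>lebesgue) / emeasure \<nu> P \<le> maximal k y" using y by simp
  then show ?thesis using ennreal_divide_le_iff[OF pos] by simp
qed

lemma less_divide_nu:
  assumes P: "P \<in> dyadic_grid T" and s: "0 < s" and lt: "ennreal s < (I / emeasure \<nu> P * indicator P x) * ennreal c"
  shows "x \<in> P" "ennreal (s * measure \<nu> P) < ennreal c * I"
proof -
  show x: "x \<in> P" using lt by (auto split: split_indicator_asm)
  have e: "emeasure \<nu> P = ennreal (measure \<nu> P)"
    using emeasure_nu_eq[OF P] sets_lebesgue_dyadic_grid[OF P] by simp
  have pos: "0 < measure \<nu> P" by (rule measure_nu_pos[OF P])
  have "ennreal (measure \<nu> P) * ennreal s < ennreal (measure \<nu> P) * ((I / emeasure \<nu> P) * ennreal c)"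
    using lt x pos by (intro ennreal_mult_strict_left_mono) auto
  also have "\<dots> = (I / ennreal (measure \<nu> P) * ennreal (measure \<nu> P)) * ennreal c"
    by (simp add: e mult_ac)
  also have "I / ennreal (measure \<nu> P) * ennreal (measure \<nu> P) = I"
    using pos by (metis ennreal_less_zero_iff ennreal_mult_divide_eq ennreal_neq_top ennreal_times_divide less_irrefl mult.commute)
  finally show "ennreal (s * measure \<nu> P) < ennreal c * I"
    using s by (simp add: ennreal_mult mult_ac)
qed

lemma less_maximalE:
  assumes "ennreal s < maximal k x * ennreal c" "0 < s"
  obtains "ennreal s < ennreal (k x / \<omega> x) * ennreal c"
  | T P where "P \<in> dyadic_grid T" "x \<in> P"
      "ennreal s < ((\<integral>\<^sup>+y\<in>P. ennreal (k y) \<partial>lebesgue) / emeasure \<nu> P * indicator P x) * ennreal c"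
proof -
  consider "maximal k x = ennreal (k x / \<omega> x)" |
    "maximal k x = (SUP P\<in>grids. (\<integral>\<^sup>+y\<in>P. ennreal (k y) \<partial>lebesgue) / emeasure \<nu> P * indicator P x)"
    by (cases "ennreal (k x / \<omega> x) \<le>
        (SUP P\<in>grids. (\<integral>\<^sup>+y\<in>P. ennreal (k y) \<partial>lebesgue) / emeasure \<nu> P * indicator P x)")
      (simp_all add: maximal_def sup.absorb1 sup.absorb2)
  then show thesis
  proof cases
    case 1
    then show ?thesis using assms that(1) by simp
  next
    case 2
    then have "ennreal s < (SUP P\<in>grids. ((\<integral>\<^sup>+y\<in>P. ennreal (k y) \<partial>lebesgue) / emeasure \<nu> P * indicator P x) * ennreal c)"
      using assms by (simp add: SUP_mult_right_ennreal)
    then obtain P where P: "P \<in> grids"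
      "ennreal s < ((\<integral>\<^sup>+y\<in>P. ennreal (k y) \<partial>lebesgue) / emeasure \<nu> P * indicator P x) * ennreal c"
      by (auto simp: less_SUP_iff)
    then obtain T where T: "P \<in> dyadic_grid T" by (auto simp: grids_def)
    show ?thesis using that(2)[OF T less_divide_nu(1)[OF T assms(2) P(2)] P(2)] .
  qed
qed

text \<open>One unit for the pointwise term k/\<omega>, and \<open>CS\<close> for each of the 2^n
  grids.\<close>

definition CM :: real where "CM = 1 + real CARD('n set) * CS"

lemma CM_pos: "0 < CM"
  using CS_pos by (auto simp: CM_def intro!: add_pos_nonneg)

lemma emeasure_UN_grids_le:
  assumes sets: "sets M = sets lebesgue" and s: "0 \<le> s"
    and B: "B \<in> sets lebesgue" "ennreal s * emeasure M B \<le> I"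
    and X: "\<And>T. X T \<in> sets lebesgue" "\<And>T::'n set. ennreal s * emeasure M (X T) \<le> ennreal CS * I"
    and sub: "Y \<subseteq> B \<union> (\<Union>T. X T)"
  shows "ennreal s * emeasure M Y \<le> ennreal CM * I"
proof -
  have m: "(\<Union>T. X T) \<in> sets M" "B \<in> sets M" "X T \<in> sets M" for T
    using X(1) B(1) sets by (auto intro!: sets.finite_UN)
  have "emeasure M Y \<le> emeasure M (B \<union> (\<Union>T. X T))"
    using m by (intro emeasure_mono sub) auto
  also have "\<dots> \<le> emeasure M B + emeasure M (\<Union>T. X T)"
    using m by (intro emeasure_subadditive) auto
  also have "\<dots> \<le> emeasure M B + (\<Sum>T\<in>UNIV. emeasure M (X T))"
    using m by (intro add_left_mono emeasure_subadditive_finite) auto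
  finally have "ennreal s * emeasure M Y \<le> ennreal s * (emeasure M B + (\<Sum>T\<in>UNIV. emeasure M (X T)))"
    by (rule mult_left_mono) simp
  also have "\<dots> = ennreal s * emeasure M B + (\<Sum>T\<in>UNIV. ennreal s * emeasure M (X T))"
    by (simp add: distrib_left sum_distrib_left)
  also have "\<dots> \<le> I + (\<Sum>T\<in>(UNIV::'n set set). ennreal CS * I)"
    by (intro add_mono B sum_mono X)
  also have "\<dots> = ennreal CM * I"
  proof -
    have "ennreal CM = 1 + of_nat CARD('n set) * ennreal CS"
      using CS_pos by (simp only: CM_def ennreal_plus ennreal_mult ennreal_1 ennreal_of_nat_eq_real_of_nat mult_nonneg_nonneg less_imp_le of_nat_0_le_iff zero_le_one)
    then show ?thesis by (simp only: distrib_right mult_1 sum_constant mult.assoc)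
  qed
  finally show ?thesis .
qed

text \<open>A large value comes either from an average in one of the grids, hence from a set
  \<open>bad\<close>, or from k/\<omega> itself. In the second case the powers of \<omega> cancel to
  s \<omega>^(1-\<beta>) <= k, which is integrated directly.\<close>

lemma maximal_weak_type:
  assumes k: "k \<in> borel_measurable lebesgue" "\<And>x. 0 \<le> k x"
    and s: "0 < s" and \<beta>: "0 \<le> \<beta>" "\<beta> \<le> 1"
  shows "ennreal s * emeasure (mixed \<beta>) {x. ennreal s < maximal k x * ennreal (\<omega> x powr \<beta>)}
    \<le> ennreal CM * (\<integral>\<^sup>+x. ennreal (k x) \<partial>lebesgue)"
proof -
  note [measurable] = k(1)
  define B where "B = {x\<in>space lebesgue. ennreal s < ennreal (k x / \<omega> x) * ennreal (\<omega> x powr \<beta>)}"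
  have Bm[measurable]: "B \<in> sets lebesgue" unfolding B_def by measurable
  show ?thesis
  proof (rule emeasure_UN_grids_le[where X = "\<lambda>T. bad s \<beta> (\<lambda>x. ennreal (k x)) (dyadic_grid T)"])
    show "ennreal s * emeasure (mixed \<beta>) B \<le> (\<integral>\<^sup>+x. ennreal (k x) \<partial>lebesgue)"
    proof -
      have "ennreal s * emeasure (mixed \<beta>) B = (\<integral>\<^sup>+x. ennreal s * (ennreal (\<omega> x powr (1 - \<beta>)) * indicator B x) \<partial>lebesgue)"
        unfolding mixed_def by (subst emeasure_density, simp_all, subst nn_integral_cmult) auto
      also have "\<dots> \<le> (\<integral>\<^sup>+x. ennreal (k x) \<partial>lebesgue)"
      proof (intro nn_integral_mono)
        fix x
        show "ennreal s * (ennreal (\<omega> x powr (1 - \<beta>)) * indicator B x) \<le> ennreal (k x)"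
        proof (cases "x \<in> B")
          case True
          then have "ennreal s < ennreal (k x / \<omega> x * \<omega> x powr \<beta>)"
            using k(2)[of x] omega_pos[of x] by (simp only: B_def mem_Collect_eq ennreal_mult divide_nonneg_pos powr_ge_zero)
          then have "s < k x / \<omega> x * \<omega> x powr \<beta>" using s by (simp add: ennreal_less_iff)
          then have "s * \<omega> x powr (1 - \<beta>) \<le> (k x / \<omega> x * \<omega> x powr \<beta>) * \<omega> x powr (1 - \<beta>)"
            by (intro mult_right_mono) auto
          also have "\<dots> = k x"
            using omega_pos[of x] by (simp add: mult.assoc powr_add[symmetric])
          finally show ?thesis using True s by (simp add: ennreal_mult[symmetric] ennreal_leI)
        qed simp
      qed
      finally show ?thesis .
    qed
    show "{x. ennreal s < maximal k x * ennreal (\<omega> x powr \<beta>)} \<subseteq> B \<union> (\<Union>T. bad s \<beta> (\<lambda>x. ennreal (k x)) (dyadic_grid T))"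
    proof
      fix x assume "x \<in> {x. ennreal s < maximal k x * ennreal (\<omega> x powr \<beta>)}"
      then have "ennreal s < maximal k x * ennreal (\<omega> x powr \<beta>)" by simp
      from this s show "x \<in> B \<union> (\<Union>T. bad s \<beta> (\<lambda>x. ennreal (k x)) (dyadic_grid T))"
      proof (cases rule: less_maximalE)
        case 1
        then show ?thesis by (auto simp: B_def)
      next
        case (2 T P)
        then show ?thesis using less_divide_nu(2)[OF 2(1) s 2(3)] unfolding bad_def by blast
      qed
    qed
    show "ennreal s * emeasure (mixed \<beta>) (bad s \<beta> (\<lambda>x. ennreal (k x)) (dyadic_grid T))
        \<le> ennreal CS * (\<integral>\<^sup>+x. ennreal (k x) \<partial>lebesgue)" for T
      by (rule mixed_weak_type[OF order_refl s \<beta>]) simp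
    show "bad s \<beta> (\<lambda>x. ennreal (k x)) (dyadic_grid T) \<in> sets lebesgue" for T
      by (intro sets_bad[of _ T] countable_dyadic_grid) simp
  qed (use s in auto)
qed

text \<open>A cube of side 3 l lies in a dyadic cube of side at most 18 l. Doubling from the
  original cube of side l then costs A 18^n.\<close>

definition CQ :: real where "CQ = A * 18 ^ CARD('n)"

lemma CQ_pos: "0 < CQ" using A_ge_1 by (simp add: CQ_def)

lemma nu_doubling_ennreal:
  assumes P: "P \<in> dyadic_grid T" and X: "X \<subseteq> P" "X \<in> sets lebesgue"
    and vol: "measure lebesgue P \<le> 18 ^ CARD('n) * measure lebesgue X" "0 < measure lebesgue X"
  shows "emeasure \<nu> P \<le> ennreal CQ * emeasure \<nu> X"
proof -
  have "measure \<nu> P * measure lebesgue X \<le> A * measure lebesgue P * measure \<nu> X"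
    by (rule nu_doubling[OF P X])
  also have "\<dots> \<le> A * (18 ^ CARD('n) * measure lebesgue X) * measure \<nu> X"
    using vol A_ge_1 by (intro mult_right_mono mult_left_mono) auto
  finally have "measure \<nu> P * measure lebesgue X \<le> (CQ * measure \<nu> X) * measure lebesgue X"
    by (simp add: CQ_def mult_ac)
  then have "measure \<nu> P \<le> CQ * measure \<nu> X" using vol(2) by (rule mult_right_le_imp_le)
  then show ?thesis
    using emeasure_nu_eq[OF P X] emeasure_nu_eq[OF P order_refl] sets_lebesgue_dyadic_grid[OF P] CQ_pos
    by (simp add: ennreal_mult[symmetric] ennreal_leI)
qed

lemma cube_tripled:
  fixes a :: "real^'n"
  assumes l: "0 < l"
  obtains T P where "P \<in> dyadic_grid T" "cbox (\<chi> i. a $ i - l) (\<chi> i. a $ i + 2 * l) \<subseteq> P"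
    "measure lebesgue P \<le> 18 ^ CARD('n) * l ^ CARD('n)"
proof -
  define b where "b = (\<chi> i. a $ i - l)"
  have "0 < 3 * l" using l by simp
  from cube_subset_dyadic[OF this, of b] obtain T P where P: "P \<in> dyadic_grid T"
    "cube b (3 * l) \<subseteq> P" "emeasure lebesgue P \<le> ennreal ((6 * (3 * l)) ^ CARD('n))" .
  have "cbox (\<chi> i. a $ i - l) (\<chi> i. a $ i + 2 * l) \<subseteq> P"
    using P(2) by (simp add: b_def algebra_simps)
  moreover have "measure lebesgue P \<le> 18 ^ CARD('n) * l ^ CARD('n)"
    using P(3) l unfolding emeasure_eq_measure_dyadic[OF P(1)] by (simp add: ennreal_le_iff power_mult_distrib)
  ultimately show thesis using that P(1) by blast
qed

text \<open>A grid cube through a point of \<open>Q\<close> which is not longer than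
  \<open>Q\<close> stays in the tripled cube of \<open>Q\<close>; such cubes see only
  \<open>k\<close> restricted to \<open>P\<close>, and \<beta> = 1 of the mixed inequality applies.
  The triple of a longer one contains \<open>y\<close>, so its average is at most \<open>CQ\<close>
  times the maximal function at \<open>y\<close>; this leaves the set \<open>D\<close>, estimated by
  integrating \<omega> over \<open>Q\<close>. As \<open>y\<close> is arbitrary in \<open>Q\<close>,
  the infimum can be taken later.\<close>

lemma maximal_cube:
  fixes a :: "real^'n"
  assumes k: "k \<in> borel_measurable lebesgue" "\<And>x. 0 \<le> k x" and l: "0 < l" and s: "0 < s"
  defines "Q \<equiv> cube a l"
  assumes y: "y \<in> Q"
  shows "ennreal s * emeasure lebesgue {x\<in>Q. ennreal s < maximal k x * ennreal (\<omega> x)}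
    \<le> ennreal ((CM + 1) * CQ) * emeasure \<nu> Q * maximal k y"
proof -
  note [measurable] = k(1)
  have Qs[measurable]: "Q \<in> sets lebesgue" by (simp add: Q_def)
  have mQ: "measure lebesgue Q = l ^ CARD('n)"
    using emeasure_cube(1)[OF l, of a] l by (simp add: Q_def measure_def)
  obtain T P where P: "P \<in> dyadic_grid T" "cbox (\<chi> i. a $ i - l) (\<chi> i. a $ i + 2 * l) \<subseteq> P"
    "measure lebesgue P \<le> 18 ^ CARD('n) * l ^ CARD('n)"
    by (rule cube_tripled[OF l])
  have Ps[measurable]: "P \<in> sets lebesgue" by (rule sets_lebesgue_dyadic_grid[OF P(1)])
  have QP: "Q \<subseteq> P"
  proof
    fix u assume "u \<in> Q"
    then have u: "a $ i \<le> u $ i" "u $ i \<le> a $ i + l" for i by (auto simp: Q_def mem_box_cart)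
    have "a $ i - l \<le> u $ i \<and> u $ i \<le> a $ i + 2 * l" for i
      using u[of i] l by linarith
    then show "u \<in> P" using P(2) by (auto simp: mem_box_cart subset_iff)
  qed
  have nuP: "emeasure \<nu> P \<le> ennreal CQ * emeasure \<nu> Q"
    using P(3) l by (intro nu_doubling_ennreal[OF P(1) QP Qs]) (auto simp: mQ)
  define I where "I = (\<integral>\<^sup>+x. ennreal (k x) * indicator P x \<partial>lebesgue)"
  have I: "I \<le> ennreal CQ * emeasure \<nu> Q * maximal k y"
    using integral_le_maximal[OF P(1), of y k] y QP mult_right_mono[OF nuP, of "maximal k y"]
    by (auto simp: I_def)
  define D where "D = {x\<in>Q. ennreal s < ennreal CQ * maximal k y * ennreal (\<omega> x)}"
  define B where "B = {x\<in>Q. ennreal s < ennreal (k x)}"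
  have "D = Q \<inter> {x\<in>space lebesgue. ennreal s < ennreal CQ * maximal k y * ennreal (\<omega> x)}"
    by (auto simp: D_def)
  also have "{x\<in>space lebesgue. ennreal s < c * ennreal (\<omega> x)} \<in> sets lebesgue" for c by measurable
  then have "Q \<inter> {x\<in>space lebesgue. ennreal s < ennreal CQ * maximal k y * ennreal (\<omega> x)} \<in> sets lebesgue"
    by auto
  finally have Ds: "D \<in> sets lebesgue" .
  have "B = Q \<inter> {x\<in>space lebesgue. ennreal s < ennreal (k x)}" by (auto simp: B_def)
  also have "\<dots> \<in> sets lebesgue" by measurable
  finally have Bs: "B \<in> sets lebesgue" .
  \<comment> \<open>The total integral in the weak type bound thereby becomes the integral over
    \<open>P\<close>, which the maximal function at \<open>y\<close> controls.\<close>
  define k' where "k' x = ennreal (k x) * indicator P x" for x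
  have k'[measurable]: "k' \<in> borel_measurable lebesgue" unfolding k'_def by measurable
  have mixed1: "emeasure (mixed 1) X = emeasure lebesgue X" if "X \<in> sets lebesgue" for X
    using that omega_pos unfolding mixed_def
    by (subst emeasure_density) (auto simp: less_imp_neq[symmetric] nn_integral_indicator)
  define E where "E = {x\<in>Q. ennreal s < maximal k x * ennreal (\<omega> x)}"
  have cover: "E - D \<subseteq> B \<union> (\<Union>T. bad s 1 k' (dyadic_grid T))"
  proof
    fix x assume x: "x \<in> E - D"
    then have "ennreal s < maximal k x * ennreal (\<omega> x)" "x \<in> Q" by (auto simp: E_def)
    from this(1) s show "x \<in> B \<union> (\<Union>T. bad s 1 k' (dyadic_grid T))"
    proof (cases rule: less_maximalE)
      case 1
      have "ennreal (k x / \<omega> x) * ennreal (\<omega> x) = ennreal (k x)"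
        using omega_pos[of x] k(2)[of x] by (subst ennreal_mult[symmetric]) auto
      then show ?thesis using 1 \<open>x \<in> Q\<close> by (auto simp: B_def)
    next
      case (2 T' R)
      obtain j z where Rjz: "R = dyadic_cube T' j z" using 2 by (auto simp: dyadic_grid_def)
      define r :: real where "r = 2 powi (- j)"
      have r: "0 < r" by (simp add: r_def)
      obtain c where c: "R \<subseteq> cube c r" unfolding Rjz r_def by (rule dyadic_cube_box)
      have mR: "measure lebesgue R = r ^ CARD('n)"
        using emeasure_dyadic_cube[of T' j z] by (simp add: Rjz r_def measure_def)
      have cx: "c $ i \<le> x $ i" "x $ i \<le> c $ i + r" "a $ i \<le> x $ i" "x $ i \<le> a $ i + l" for i
        using c 2(2) \<open>x \<in> Q\<close> by (auto simp: Q_def mem_box_cart)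
      have Rs: "R \<in> sets lebesgue" by (rule sets_lebesgue_dyadic_grid[OF 2(1)])
      show ?thesis
      proof (cases "r \<le> l")
        case True
        have "R \<subseteq> P"
        proof
          fix u assume "u \<in> R"
          then have u: "c $ i \<le> u $ i" "u $ i \<le> c $ i + r" for i using c by (auto simp: mem_box_cart)
          have "a $ i - l \<le> u $ i \<and> u $ i \<le> a $ i + 2 * l" for i
            using u[of i] cx[of i] True by linarith
          then show "u \<in> P" using P(2) by (auto simp: mem_box_cart subset_iff)
        qed
        then have "(\<integral>\<^sup>+y\<in>R. k' y \<partial>lebesgue) = (\<integral>\<^sup>+y\<in>R. ennreal (k y) \<partial>lebesgue)"
          by (intro nn_integral_cong) (auto simp: k'_def split: split_indicator)
        then have "ennreal (s * measure \<nu> R) < ennreal (\<omega> x powr 1) * (\<integral>\<^sup>+y\<in>R. k' y \<partial>lebesgue)"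
          using less_divide_nu(2)[OF 2(1) s 2(3)] omega_pos[of x] by simp
        then show ?thesis using 2 unfolding bad_def by blast
      next
        case False
        obtain T'' P' where P': "P' \<in> dyadic_grid T''" "cbox (\<chi> i. c $ i - r) (\<chi> i. c $ i + 2 * r) \<subseteq> P'"
          "measure lebesgue P' \<le> 18 ^ CARD('n) * r ^ CARD('n)"
          by (rule cube_tripled[OF r])
        have "R \<subseteq> P'"
        proof
          fix u assume "u \<in> R"
          then have u: "c $ i \<le> u $ i" "u $ i \<le> c $ i + r" for i using c by (auto simp: mem_box_cart)
          have "c $ i - r \<le> u $ i \<and> u $ i \<le> c $ i + 2 * r" for i
            using u[of i] r by linarith
          then show "u \<in> P'" using P'(2) by (auto simp: mem_box_cart subset_iff)
        qed
        have "y \<in> P'"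
        proof -
          have "a $ i \<le> y $ i" "y $ i \<le> a $ i + l" for i using y by (auto simp: Q_def mem_box_cart)
          then have "c $ i - r \<le> y $ i \<and> y $ i \<le> c $ i + 2 * r" for i
            using cx[of i] False by (smt (verit))
          then show "y \<in> P'" using P'(2) by (auto simp: mem_box_cart subset_iff)
        qed
        have "(\<integral>\<^sup>+y\<in>R. ennreal (k y) \<partial>lebesgue) \<le> (\<integral>\<^sup>+y\<in>P'. ennreal (k y) \<partial>lebesgue)"
          using \<open>R \<subseteq> P'\<close> by (intro nn_integral_mono) (auto split: split_indicator)
        also have "\<dots> \<le> emeasure \<nu> P' * maximal k y"
          by (rule integral_le_maximal[OF P'(1) \<open>y \<in> P'\<close>])
        also have "\<dots> \<le> ennreal CQ * emeasure \<nu> R * maximal k y"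
          using P'(3) r by (intro mult_right_mono nu_doubling_ennreal[OF P'(1) \<open>R \<subseteq> P'\<close> Rs]) (auto simp: mR)
        finally have le: "(\<integral>\<^sup>+y\<in>R. ennreal (k y) \<partial>lebesgue) \<le> emeasure \<nu> R * (ennreal CQ * maximal k y)"
          by (simp add: mult_ac)
        have e: "emeasure \<nu> R = ennreal (measure \<nu> R)" "0 < measure \<nu> R"
          using emeasure_nu_eq[OF 2(1) order_refl Rs] measure_nu_pos[OF 2(1)] by auto
        have "(\<integral>\<^sup>+y\<in>R. ennreal (k y) \<partial>lebesgue) / emeasure \<nu> R \<le> ennreal CQ * maximal k y"
          using le e by (subst ennreal_divide_le_iff) auto
        then have "(\<integral>\<^sup>+y\<in>R. ennreal (k y) \<partial>lebesgue) / emeasure \<nu> R * indicator R x * ennreal (\<omega> x)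
           \<le> ennreal CQ * maximal k y * ennreal (\<omega> x)"
          by (intro mult_right_mono) (auto split: split_indicator)
        then have "x \<in> D" using 2(3) \<open>x \<in> Q\<close> by (auto simp: D_def)
        then show ?thesis using x by simp
      qed
    qed
  qed
  have Es: "E \<in> sets lebesgue"
  proof -
    have "E = Q \<inter> {x\<in>space lebesgue. ennreal s < maximal k x * ennreal (\<omega> x)}" by (auto simp: E_def)
    also have "\<dots> \<in> sets lebesgue" by measurable
    finally show ?thesis .
  qed
  have "ennreal s * emeasure lebesgue (E - D) \<le> ennreal CM * I"
  proof (rule emeasure_UN_grids_le[OF refl _ Bs _ _ _ cover])
    have "ennreal s * emeasure lebesgue B = (\<integral>\<^sup>+x. ennreal s * indicator B x \<partial>lebesgue)"
      using Bs by (simp add: nn_integral_cmult_indicator)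
    also have "\<dots> \<le> I"
      unfolding I_def using QP by (intro nn_integral_mono) (auto simp: B_def split: split_indicator)
    finally show "ennreal s * emeasure lebesgue B \<le> I" .
    have sb: "bad s 1 k' (dyadic_grid T) \<in> sets lebesgue" for T
      by (intro sets_bad[of _ T] countable_dyadic_grid) simp
    then show "bad s 1 k' (dyadic_grid T) \<in> sets lebesgue" for T .
    show "ennreal s * emeasure lebesgue (bad s 1 k' (dyadic_grid T)) \<le> ennreal CS * I" for T
      using mixed_weak_type[OF order_refl s, of 1 k' T] mixed1[OF sb, of T] by (simp add: I_def k'_def)
  qed (use s in auto)
  moreover have "ennreal s * emeasure lebesgue D \<le> ennreal CQ * emeasure \<nu> Q * maximal k y"
  proof -
    have "ennreal s * emeasure lebesgue D = (\<integral>\<^sup>+x. ennreal s * indicator D x \<partial>lebesgue)"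
      using Ds by (simp add: nn_integral_cmult_indicator)
    also have "\<dots> \<le> (\<integral>\<^sup>+x. (ennreal CQ * maximal k y) * (ennreal (\<omega> x) * indicator Q x) \<partial>lebesgue)"
      by (intro nn_integral_mono) (auto simp: D_def mult.assoc split: split_indicator)
    also have "\<dots> = (ennreal CQ * maximal k y) * emeasure \<nu> Q"
      by (subst nn_integral_cmult) (auto simp: emeasure_nu)
    finally show ?thesis by (simp add: mult_ac)
  qed
  moreover have "emeasure lebesgue E \<le> emeasure lebesgue (E - D) + emeasure lebesgue D"
    using emeasure_subadditive[of "E - D" lebesgue D] emeasure_mono[of E "(E - D) \<union> D" lebesgue] Es Ds
    by (auto intro: order_trans)
  then have "ennreal s * emeasure lebesgue E \<le> ennreal s * emeasure lebesgue (E - D) + ennreal s * emeasure lebesgue D"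
    by (metis distrib_left mult_left_mono zero_le)
  ultimately have "ennreal s * emeasure lebesgue E \<le> ennreal CM * I + ennreal CQ * emeasure \<nu> Q * maximal k y"
    by (meson add_mono order_trans)
  also have "\<dots> \<le> ennreal CM * (ennreal CQ * emeasure \<nu> Q * maximal k y) + ennreal CQ * emeasure \<nu> Q * maximal k y"
    by (intro add_right_mono mult_left_mono I) simp
  also have "\<dots> = ennreal ((CM + 1) * CQ) * emeasure \<nu> Q * maximal k y"
    using CM_pos CQ_pos by (simp add: ennreal_mult ennreal_plus distrib_right distrib_left mult_ac)
  finally show ?thesis by (simp add: E_def)
qed

text \<open>The two estimates for \<open>h\<close> serve different ends: the local one bounds the
  class constant of the new weight, the global one bounds the exceptional set where the weights
  cannot be compared.\<close>

lemma A1_majorant: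
  assumes k: "k \<in> borel_measurable lebesgue" "\<And>x. 0 \<le> k x"
    and B: "(\<integral>\<^sup>+x. ennreal (k x) \<partial>lebesgue) \<le> ennreal B" "0 \<le> B"
  obtains h where "h \<in> borel_measurable lebesgue" "\<And>x. 0 < h x"
    "AE x in lebesgue. k x \<le> h x * \<omega> x"
    "\<And>a l. 0 < l \<Longrightarrow> \<exists>L>0. (AE x in lebesgue. x \<in> cube a l \<longrightarrow> L \<le> h x) \<and>
       (\<forall>s>0. ennreal s * emeasure lebesgue {x\<in>cube a l. s < h x * \<omega> x}
          \<le> ennreal ((CM + 1) * CQ * L) * emeasure \<nu> (cube a l))"
    "\<And>s \<beta>. 0 < s \<Longrightarrow> 0 \<le> \<beta> \<Longrightarrow> \<beta> \<le> 1 \<Longrightarrow>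
       ennreal s * emeasure (mixed \<beta>) {x. s < h x * \<omega> x powr \<beta>} \<le> ennreal (CM * (B + 1))"
proof -
  \<comment> \<open>If \<open>k\<close> vanished, so would its maximal function, and negative powers
    of it are needed. Adding the indicator of a unit cube makes the infimum over every cube positive
    and costs 1 in the integral, whence B + 1.\<close>
  define k1 where "k1 x = k x + indicator (cube 0 1) x" for x :: "real^'n"
  have k1: "k1 \<in> borel_measurable lebesgue" "\<And>x. 0 \<le> k1 x"
  proof -
    show "0 \<le> k1 x" for x using k(2)[of x] by (simp add: k1_def)
    note [measurable] = k(1)
    have [measurable]: "cube 0 1 \<in> sets (lebesgue :: (real^'n) measure)" by simp
    show "k1 \<in> borel_measurable lebesgue" unfolding k1_def[abs_def] by measurable
  qed
  have U: "emeasure lebesgue (cube (0::real^'n) 1) = 1"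
    by (subst emeasure_cube) auto
  have int: "(\<integral>\<^sup>+x. ennreal (k1 x) \<partial>lebesgue) \<le> ennreal (B + 1)"
  proof -
    have "(\<integral>\<^sup>+x. ennreal (k1 x) \<partial>lebesgue) = (\<integral>\<^sup>+x. ennreal (k x) + indicator (cube 0 1) x \<partial>lebesgue)"
      using k(2) by (intro nn_integral_cong) (auto simp: k1_def split: split_indicator)
    also have "\<dots> = (\<integral>\<^sup>+x. ennreal (k x) \<partial>lebesgue) + 1"
    proof -
      have [measurable]: "cube 0 1 \<in> sets (lebesgue :: (real^'n) measure)" by simp
      note [measurable] = k(1)
      have "(\<integral>\<^sup>+x. ennreal (k x) + indicator (cube 0 1) x \<partial>lebesgue)
        = (\<integral>\<^sup>+x. ennreal (k x) \<partial>lebesgue) + (\<integral>\<^sup>+x. indicator (cube 0 1) (x::real^'n) \<partial>lebesgue)"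
        by (rule nn_integral_add) measurable
      moreover have "(\<integral>\<^sup>+x. indicator (cube 0 1) (x::real^'n) \<partial>lebesgue) = 1"
        unfolding U[symmetric] by (rule nn_integral_indicator) simp
      ultimately show ?thesis by simp
    qed
    also have "\<dots> \<le> ennreal (B + 1)"
      using B by (simp add: ennreal_plus add_right_mono)
    finally show ?thesis .
  qed
  define \<Lambda> where "\<Lambda> = maximal k1"
  have [measurable]: "\<Lambda> \<in> borel_measurable lebesgue" unfolding \<Lambda>_def using k1 by measurable
  have weak: "ennreal s * emeasure (mixed \<beta>) {x. ennreal s < \<Lambda> x * ennreal (\<omega> x powr \<beta>)} \<le> ennreal (CM * (B + 1))"
    if "0 < s" "0 \<le> \<beta>" "\<beta> \<le> 1" for s \<beta>
  proof -
    have "ennreal s * emeasure (mixed \<beta>) {x. ennreal s < \<Lambda> x * ennreal (\<omega> x powr \<beta>)}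
        \<le> ennreal CM * (\<integral>\<^sup>+x. ennreal (k1 x) \<partial>lebesgue)"
      unfolding \<Lambda>_def by (rule maximal_weak_type[OF k1 that])
    also have "\<dots> \<le> ennreal CM * ennreal (B + 1)" by (intro mult_left_mono int) simp
    also have "\<dots> = ennreal (CM * (B + 1))" using CM_pos B by (simp add: ennreal_mult)
    finally show ?thesis .
  qed
  \<comment> \<open>For \<beta> = 0 the measure is \<nu>. Letting \<open>s\<close> grow in the weak
    type inequality shows that the set of infinite values is null.\<close>
  have finite: "AE x in lebesgue. \<Lambda> x < \<infinity>"
  proof -
    define Z where "Z = {x\<in>space lebesgue. \<Lambda> x = \<infinity>}"
    have Zs: "Z \<in> sets lebesgue" unfolding Z_def by measurable
    have "emeasure (mixed 0) Z = 0"
    proof (rule ccontr)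
      assume nz: "emeasure (mixed 0) Z \<noteq> 0"
      have *: "ennreal s * emeasure (mixed 0) Z \<le> ennreal (CM * (B + 1))" if s: "0 < s" for s
      proof -
        have "{x\<in>space lebesgue. ennreal s < \<Lambda> x * ennreal (\<omega> x powr 0)} \<in> sets lebesgue" by measurable
        then have "emeasure (mixed 0) Z \<le> emeasure (mixed 0) {x. ennreal s < \<Lambda> x * ennreal (\<omega> x powr 0)}"
          using omega_pos by (intro emeasure_mono) (auto simp: Z_def less_imp_neq[symmetric])
        then have "ennreal s * emeasure (mixed 0) Z \<le> ennreal s * emeasure (mixed 0) {x. ennreal s < \<Lambda> x * ennreal (\<omega> x powr 0)}"
          by (rule mult_left_mono) simp
        also have "\<dots> \<le> ennreal (CM * (B + 1))" using weak[OF s, of 0] by simp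
        finally show ?thesis .
      qed
      have "ennreal 1 * emeasure (mixed 0) Z < \<infinity>" using *[of 1] by (auto intro: order_le_less_trans)
      then obtain z where z: "emeasure (mixed 0) Z = ennreal z" "0 \<le> z" by (cases "emeasure (mixed 0) Z") auto
      with nz have "0 < z" by auto
      define c where "c = CM * (B + 1)"
      have c: "0 < c" using CM_pos B by (simp add: c_def)
      have "ennreal ((c + 1) / z) * ennreal z \<le> ennreal c"
        using *[of "(c + 1) / z"] c \<open>0 < z\<close> z by (simp add: c_def)
      then have "ennreal (c + 1) \<le> ennreal c"
        using c \<open>0 < z\<close> by (subst (asm) ennreal_mult[symmetric]) auto
      then show False using c by (simp add: ennreal_le_iff)
    qed
    then have "AE x in mixed 0. x \<notin> Z" using Zs by (intro AE_not_in) (auto simp: null_sets_def)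
    then have "AE x in lebesgue. x \<notin> Z"
      unfolding mixed_def using omega_pos by (subst (asm) AE_density) (auto simp: less_imp_neq[symmetric])
    then show ?thesis by (auto simp: Z_def less_top elim!: eventually_mono)
  qed
  \<comment> \<open>Some dyadic cube contains both the given cube and the unit cube of
    \<open>k1\<close>. Its average is at least 1 over its \<nu>-measure and bounds the maximal
    function from below on the given cube.\<close>
  have pos: "0 < \<Lambda> x" and INF_pos: "0 < l \<Longrightarrow> 0 < (INF y\<in>cube a l. \<Lambda> y)" for x a l
  proof -
    have *: "0 < (INF y\<in>cube a l. \<Lambda> y)" if l: "0 < l" for a :: "real^'n" and l :: real
    proof -
      define N where "N = norm a"
      have N0: "0 \<le> N" by (simp add: N_def)
      define R where "R = N + l + 1"
      define b :: "real^'n" where "b = (\<chi> i. - R)"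
      have "0 < R" using l N0 unfolding R_def by linarith
      then have R: "0 < 2 * R" by simp
      from cube_subset_dyadic[OF R, of b] obtain T P where P: "P \<in> dyadic_grid T"
        "cube b (2 * R) \<subseteq> P" by metis
      have bi: "b $ i = - N - l - 1" "b $ i + 2 * R = N + l + 1" for i by (simp_all add: b_def R_def)
      have ai: "\<bar>a $ i\<bar> \<le> N" for i unfolding N_def by (rule component_le_norm_cart)
      have sub1: "cube a l \<subseteq> P"
      proof
        fix u assume "u \<in> cube a l"
        then have u: "a $ i \<le> u $ i" "u $ i \<le> a $ i + l" for i by (auto simp: mem_box_cart)
        have "b $ i \<le> u $ i \<and> u $ i \<le> b $ i + 2 * R" for i
          using u[of i] ai[of i] N0 l unfolding bi(2) unfolding bi(1) abs_le_iff by linarith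
        then show "u \<in> P" using P(2) by (auto simp: mem_box_cart subset_iff)
      qed
      have sub2: "cube 0 1 \<subseteq> P"
      proof
        fix u :: "real^'n" assume "u \<in> cube 0 1"
        then have u: "0 \<le> u $ i" "u $ i \<le> 1" for i by (auto simp: mem_box_cart)
        have "b $ i \<le> u $ i \<and> u $ i \<le> b $ i + 2 * R" for i
          using u[of i] N0 l unfolding bi(2) unfolding bi(1) by linarith
        then show "u \<in> P" using P(2) by (auto simp: mem_box_cart subset_iff)
      qed
      have e: "emeasure \<nu> P = ennreal (measure \<nu> P)" "0 < measure \<nu> P"
        using emeasure_nu_eq[OF P(1) order_refl sets_lebesgue_dyadic_grid[OF P(1)]] measure_nu_pos[OF P(1)] by auto
      have "1 = (\<integral>\<^sup>+x. indicator (cube 0 1) (x::real^'n) \<partial>lebesgue)" using U by simp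
      also have "\<dots> \<le> (\<integral>\<^sup>+y\<in>P. ennreal (k1 y) \<partial>lebesgue)"
        using sub2 k(2) by (intro nn_integral_mono) (auto simp: k1_def split: split_indicator)
      finally have one: "1 \<le> (\<integral>\<^sup>+y\<in>P. ennreal (k1 y) \<partial>lebesgue)" .
      have "ennreal (1 / measure \<nu> P) \<le> \<Lambda> y" if "y \<in> cube a l" for y
      proof -
        have "1 \<le> emeasure \<nu> P * \<Lambda> y"
          using integral_le_maximal[OF P(1), of y k1] that sub1 one by (auto simp: \<Lambda>_def)
        then have "ennreal (1 / measure \<nu> P) * 1 \<le> ennreal (1 / measure \<nu> P) * (ennreal (measure \<nu> P) * \<Lambda> y)"
          unfolding e by (intro mult_left_mono) auto
        also have "\<dots> = \<Lambda> y"
          using e(2) by (simp add: mult.assoc[symmetric] ennreal_mult[symmetric] del: ennreal_1) simp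
        finally show ?thesis by simp
      qed
      then have "ennreal (1 / measure \<nu> P) \<le> (INF y\<in>cube a l. \<Lambda> y)"
        by (intro INF_greatest)
      moreover have "0 < ennreal (1 / measure \<nu> P)" using e(2) by (simp only: ennreal_less_zero_iff) simp
      ultimately show ?thesis by (rule less_le_trans[rotated])
    qed
    then show "0 < l \<Longrightarrow> 0 < (INF y\<in>cube a l. \<Lambda> y)" .
    have "(INF y\<in>cube x 1. \<Lambda> y) \<le> \<Lambda> x" by (intro INF_lower) (auto simp: mem_box_cart)
    then show "0 < \<Lambda> x" using *[of 1 x] by simp
  qed
  \<comment> \<open>Infinite values occur only on a null set and are replaced by 1, so that
    \<open>h\<close> is real and positive everywhere.\<close>
  define h where "h x = (if \<Lambda> x = \<infinity> then 1 else enn2real (\<Lambda> x))" for x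
  have hm[measurable]: "h \<in> borel_measurable lebesgue" unfolding h_def[abs_def] by measurable
  have hL: "AE x in lebesgue. ennreal (h x) = \<Lambda> x"
    using finite by (auto simp: h_def elim!: eventually_mono)
  have hpos: "0 < h x" for x using pos[of x] by (auto simp: h_def enn2real_positive_iff less_top)
  have ineq: "s < h x * c \<longleftrightarrow> ennreal s < \<Lambda> x * ennreal c" if "ennreal (h x) = \<Lambda> x" "0 < s" "0 < c" for s c x
    using that hpos[of x] by (simp add: that(1)[symmetric] ennreal_mult[symmetric] ennreal_less_iff)
  show thesis
  proof (rule that[of h])
    show "AE x in lebesgue. k x \<le> h x * \<omega> x"
      using hL
    proof (rule eventually_mono)
      fix x assume e: "ennreal (h x) = \<Lambda> x"
      have "ennreal (k1 x / \<omega> x) \<le> \<Lambda> x" by (simp add: \<Lambda>_def maximal_def)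
      then have "k1 x / \<omega> x \<le> h x" unfolding e[symmetric] using hpos[of x] by (simp add: ennreal_le_iff)
      then have "k1 x \<le> h x * \<omega> x" using omega_pos[of x] by (simp add: divide_le_eq)
      then show "k x \<le> h x * \<omega> x" by (auto simp: k1_def split: split_indicator_asm)
    qed
    show "ennreal s * emeasure (mixed \<beta>) {x. s < h x * \<omega> x powr \<beta>} \<le> ennreal (CM * (B + 1))"
      if "0 < s" "0 \<le> \<beta>" "\<beta> \<le> 1" for s \<beta>
    proof -
      have m1: "{x\<in>space lebesgue. ennreal s < \<Lambda> x * ennreal (\<omega> x powr \<beta>)} \<in> sets lebesgue"
        and m2: "{x\<in>space lebesgue. s < h x * \<omega> x powr \<beta>} \<in> sets lebesgue"
        by measurable
      have "AE x in mixed \<beta>. ennreal (h x) = \<Lambda> x"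
        unfolding mixed_def using hL by (subst AE_density) (auto elim!: eventually_mono)
      then have "AE x in mixed \<beta>. x \<in> {x. s < h x * \<omega> x powr \<beta>} \<longleftrightarrow> x \<in> {x. ennreal s < \<Lambda> x * ennreal (\<omega> x powr \<beta>)}"
        using ineq that omega_pos by (auto elim!: eventually_mono simp: less_imp_neq[symmetric])
      then have "emeasure (mixed \<beta>) {x. s < h x * \<omega> x powr \<beta>} = emeasure (mixed \<beta>) {x. ennreal s < \<Lambda> x * ennreal (\<omega> x powr \<beta>)}"
        using m1 m2 by (intro emeasure_eq_AE) auto
      then show ?thesis using weak[OF that] by simp
    qed
    fix a :: "real^'n" and l :: real assume l: "0 < l"
    define Q where "Q = cube a l"
    define L where "L = enn2real (INF y\<in>Q. \<Lambda> y)"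
    \<comment> \<open>A point with a finite value makes the infimum over the cube a real number,
      which serves as \<open>L\<close>.\<close>
    have "\<exists>y\<in>Q. \<Lambda> y < \<infinity>"
    proof (rule ccontr)
      assume "\<not> ?thesis"
      then have "AE x in lebesgue. x \<notin> Q" using finite by (auto elim!: eventually_mono)
      then show False unfolding Q_def using cube_not_null[OF l] by blast
    qed
    then have fin: "(INF y\<in>Q. \<Lambda> y) < \<infinity>" by (auto simp: INF_less_iff)
    have eL: "(INF y\<in>Q. \<Lambda> y) = ennreal L" using fin by (simp add: L_def)
    have Lpos: "0 < L" using INF_pos[OF l, of a] fin by (simp add: L_def Q_def enn2real_positive_iff)
    have 1: "AE x in lebesgue. x \<in> Q \<longrightarrow> L \<le> h x"
      using hL
    proof (rule eventually_mono, intro impI)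
      fix x assume e: "ennreal (h x) = \<Lambda> x" and "x \<in> Q"
      then have "ennreal L \<le> ennreal (h x)" unfolding eL[symmetric] e by (intro INF_lower)
      then show "L \<le> h x" using hpos[of x] by (simp add: ennreal_le_iff)
    qed
    have 2: "ennreal s * emeasure lebesgue {x\<in>Q. s < h x * \<omega> x} \<le> ennreal ((CM + 1) * CQ * L) * emeasure \<nu> Q"
      if s: "0 < s" for s
    proof -
      obtain T P where P: "P \<in> dyadic_grid T" "Q \<subseteq> P"
        using cube_subset_dyadic[OF l, of a] unfolding Q_def by metis
      have nuQ: "emeasure \<nu> Q < \<infinity>"
        using emeasure_nu_eq[OF P] by (simp add: Q_def)
      have m: "{x\<in>Q. ennreal s < \<Lambda> x * ennreal (\<omega> x)} \<in> sets lebesgue" "{x\<in>Q. s < h x * \<omega> x} \<in> sets lebesgue"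
      proof -
        have Qs: "Q \<in> sets lebesgue" by (simp add: Q_def)
        show "{x\<in>Q. ennreal s < \<Lambda> x * ennreal (\<omega> x)} \<in> sets lebesgue"
          by (rule sets_lebesgue_Collect_in[OF Qs]) measurable
        show "{x\<in>Q. s < h x * \<omega> x} \<in> sets lebesgue"
          by (rule sets_lebesgue_Collect_in[OF Qs]) measurable
      qed
      have "emeasure lebesgue {x\<in>Q. s < h x * \<omega> x} = emeasure lebesgue {x\<in>Q. ennreal s < \<Lambda> x * ennreal (\<omega> x)}"
        using m ineq[OF _ s omega_pos] hL by (intro emeasure_eq_AE) (auto elim!: eventually_mono)
      also have "ennreal s * \<dots> \<le> ennreal ((CM + 1) * CQ) * emeasure \<nu> Q * (INF y\<in>Q. \<Lambda> y)"
      proof (rule INF_ennreal_mult_left_le)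
        have "0 < emeasure \<nu> Q" using l by (intro emeasure_nu_pos) (auto simp only: Q_def emeasure_cube(1)[OF l] ennreal_less_zero_iff zero_less_power lmeasurable_cbox fmeasurableD)
        moreover have "0 < ennreal ((CM + 1) * CQ)" using CM_pos CQ_pos by simp
        ultimately show "0 < ennreal ((CM + 1) * CQ) * emeasure \<nu> Q" by (simp add: ennreal_zero_less_mult_iff)
        show "ennreal ((CM + 1) * CQ) * emeasure \<nu> Q < \<infinity>" using nuQ by (simp add: ennreal_mult_less_top)
      qed (use maximal_cube[OF k1 l s, of _ a] in \<open>auto simp: \<Lambda>_def Q_def\<close>)
      also have "\<dots> = ennreal ((CM + 1) * CQ * L) * emeasure \<nu> Q"
        using CM_pos CQ_pos Lpos by (simp add: eL ennreal_mult mult_ac)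
      finally show ?thesis .
    qed
    show "\<exists>L>0. (AE x in lebesgue. x \<in> cube a l \<longrightarrow> L \<le> h x) \<and>
       (\<forall>s>0. ennreal s * emeasure lebesgue {x\<in>cube a l. s < h x * \<omega> x}
          \<le> ennreal ((CM + 1) * CQ * L) * emeasure \<nu> (cube a l))"
      using Lpos 1 2 unfolding Q_def by blast
  qed (use hm hpos in auto)
qed

end

section \<open>Lorentz norms\<close>

lemma epowr_ennreal: "0 \<le> x \<Longrightarrow> ennreal x epowr a = ennreal (x powr a)"
  by (simp add: epowr_def)

lemma epowr_top [simp]: "\<infinity> epowr a = \<infinity>" "top epowr a = top"
  by (simp_all add: epowr_def)

lemma epowr_zero [simp]: "0 epowr a = 0"
  by (simp add: epowr_def)

lemma epowr_one [simp]: "x epowr 1 = x"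
  by (cases x) (auto simp: epowr_ennreal)

lemma epowr_mono:
  assumes "x \<le> y" "0 \<le> a" shows "x epowr a \<le> y epowr a"
proof (cases y)
  case (real y')
  then obtain x' where x': "x = ennreal x'" "0 \<le> x'" using assms by (cases x) (auto simp: top_unique)
  then show ?thesis using assms real by (simp add: epowr_ennreal powr_mono2 ennreal_leI)
qed (simp add: epowr_def)

lemma epowr_pos: "0 < x \<Longrightarrow> 0 < x epowr a"
  by (cases x) (auto simp: epowr_ennreal)

lemma epowr_mult: "(x * y) epowr a = x epowr a * y epowr a"
proof -
  have *: "ennreal r * top epowr a = ennreal (r powr a) * top" if "0 \<le> r" for r :: real
    using that by (cases "r = 0") (auto simp: ennreal_mult_top)
  show ?thesis
  proof (cases x; cases y)
    fix r q :: real assume "x = ennreal r" "0 \<le> r" "y = ennreal q" "0 \<le> q"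
    then show ?thesis by (simp add: ennreal_mult[symmetric] epowr_ennreal powr_mult)
  next
    fix r :: real assume "x = ennreal r" "0 \<le> r" "y = top"
    then show ?thesis by (cases "r = 0") (auto simp: ennreal_mult_top epowr_ennreal)
  next
    fix r :: real assume "y = ennreal r" "0 \<le> r" "x = top"
    then show ?thesis by (cases "r = 0") (auto simp: ennreal_top_mult epowr_ennreal)
  qed auto
qed

lemma epowr_epowr: "(x epowr a) epowr b = x epowr (a * b)"
  by (cases x) (auto simp: epowr_ennreal powr_powr)

text \<open>Valid without conditions on the exponents, because \<open>0 epowr 0 = 0\<close> and
  \<open>top epowr 0 = top\<close>. It is applied below with an exponent difference that may be
  zero.\<close>

lemma epowr_add: "x epowr (a + b) = x epowr a * x epowr b"
  by (cases x) (auto simp: epowr_ennreal powr_add ennreal_mult)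

lemma epowr_eq_0_iff: "x epowr a = 0 \<longleftrightarrow> x = 0"
  using epowr_pos[of x a] by (cases "x = 0") (auto simp: zero_less_iff_neq_zero)

lemma prod_mono_ennreal:
  fixes f g :: "'i \<Rightarrow> ennreal"
  assumes "\<And>i. i \<in> I \<Longrightarrow> f i \<le> g i"
  shows "prod f I \<le> prod g I"
  using assms by (induction I rule: infinite_finite_induct) (auto intro!: mult_mono)

lemma prod_pos_ennreal:
  fixes f :: "'i \<Rightarrow> ennreal"
  assumes "\<And>i. i \<in> I \<Longrightarrow> 0 < f i"
  shows "0 < prod f I"
  using assms by (induction I rule: infinite_finite_induct) (auto simp: ennreal_zero_less_mult_iff)

lemma borel_measurable_epowr [measurable]:
  assumes [measurable]: "f \<in> borel_measurable M"
  shows "(\<lambda>x. f x epowr a) \<in> borel_measurable M"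
  unfolding epowr_def by measurable

section \<open>Layer cake and comparison of Lorentz norms\<close>

lemma sigma_finite_lebesgue: "sigma_finite_measure (lebesgue :: 'a::euclidean_space measure)"
proof
  obtain A :: "'a set set" where A: "countable A" "A \<subseteq> sets lborel" "\<Union>A = space lborel"
    "\<forall>a\<in>A. emeasure lborel a \<noteq> \<infinity>"
    using lborel.sigma_finite_countable by blast
  then show "\<exists>A::'a set set. countable A \<and> A \<subseteq> sets lebesgue \<and> \<Union>A = space lebesgue \<and> (\<forall>a\<in>A. emeasure lebesgue a \<noteq> \<infinity>)"
    by (intro exI[of _ A]) (auto simp: subset_iff)
qed

lemma nn_integral_powr_lessThan:
  assumes "0 < q" "0 \<le> t"
  shows "(\<integral>\<^sup>+s\<in>{0<..}. ennreal (s powr (q - 1)) * indicator {..<t} s \<partial>lborel) = ennreal (t powr q / q)"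
proof -
  have "((\<lambda>s. s powr (q - 1)) has_integral (t powr (q - 1 + 1) / (q - 1 + 1))) {0..t}"
    using assms by (intro has_integral_powr_from_0) auto
  then have "((\<lambda>s. s powr (q - 1)) has_integral (t powr q / q)) {0..t}" by simp
  then have "((\<lambda>s. s powr (q - 1) * indicator {0..t} s) has_integral (t powr q / q)) UNIV"
    by (subst (asm) has_integral_restrict_UNIV[symmetric])
      (auto elim!: has_integral_eq[rotated] split: split_indicator)
  then have "(\<integral>\<^sup>+s. ennreal (s powr (q - 1) * indicator {0..t} s) \<partial>lborel) = ennreal (t powr q / q)"
    by (intro nn_integral_has_integral_lborel) auto
  moreover have "(\<integral>\<^sup>+s. ennreal (s powr (q - 1) * indicator {0..t} s) \<partial>lborel)
      = (\<integral>\<^sup>+s\<in>{0<..}. ennreal (s powr (q - 1)) * indicator {..<t} s \<partial>lborel)"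
  proof (rule nn_integral_cong_AE)
    have "AE s in lborel. s \<noteq> t" "AE s in lborel. s \<noteq> (0::real)"
      by (rule AE_lborel_singleton)+
    then show "AE s in lborel. ennreal (s powr (q - 1) * indicator {0..t} s)
       = ennreal (s powr (q - 1)) * indicator {..<t} s * indicator {0<..} s"
      by eventually_elim (auto split: split_indicator)
  qed
  ultimately show ?thesis by simp
qed

lemma borel_measurable_distribution:
  fixes f :: "'a \<Rightarrow> 'b::real_normed_vector"
  assumes "sigma_finite_measure M" and [measurable]: "(\<lambda>x. norm (f x)) \<in> borel_measurable M"
  shows "(\<lambda>s. emeasure M {x\<in>space M. s < norm (f x)}) \<in> borel_measurable borel"
proof -
  interpret M: sigma_finite_measure M by fact
  have "(\<lambda>s. \<integral>\<^sup>+x. (if s < norm (f x) then 1 else 0) \<partial>M) \<in> borel_measurable borel"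
    by measurable
  moreover have "(\<integral>\<^sup>+x. (if s < norm (f x) then 1 else 0) \<partial>M) = emeasure M {x\<in>space M. s < norm (f x)}" for s
  proof -
    have "(\<integral>\<^sup>+x. (if s < norm (f x) then 1 else 0) \<partial>M) = (\<integral>\<^sup>+x. indicator {x\<in>space M. s < norm (f x)} x \<partial>M)"
      by (intro nn_integral_cong) auto
    then show ?thesis by simp
  qed
  ultimately show ?thesis by simp
qed

lemma nn_integral_layer_cake:
  fixes f :: "'a \<Rightarrow> 'b::real_normed_vector"
  assumes "sigma_finite_measure M" and [measurable]: "(\<lambda>x. norm (f x)) \<in> borel_measurable M" and r: "0 < r"
  shows "(\<integral>\<^sup>+x. ennreal (norm (f x) powr r) \<partial>M) =
    ennreal r * (\<integral>\<^sup>+s\<in>{0<..}. ennreal (s powr (r - 1)) * emeasure M {x\<in>space M. s < norm (f x)} \<partial>lborel)"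
proof -
  interpret M: sigma_finite_measure M by fact
  interpret pair_sigma_finite M "lborel :: real measure" ..
  define J where "J s x = (if 0 < s \<and> s < norm (f x) then ennreal (s powr (r - 1)) else 0)" for s x
  have J1[measurable]: "(\<lambda>(x, s). J s x) \<in> borel_measurable (M \<Otimes>\<^sub>M lborel)"
    unfolding J_def by measurable
  have inner: "(\<integral>\<^sup>+s. J s x \<partial>lborel) = ennreal (norm (f x) powr r / r)" for x
  proof -
    have "(\<integral>\<^sup>+s. J s x \<partial>lborel) = (\<integral>\<^sup>+s\<in>{0<..}. ennreal (s powr (r - 1)) * indicator {..<norm (f x)} s \<partial>lborel)"
      by (intro nn_integral_cong) (auto simp: J_def)
    then show ?thesis using r by (simp add: nn_integral_powr_lessThan)
  qed
  have "(\<integral>\<^sup>+x. ennreal (norm (f x) powr r) \<partial>M) = (\<integral>\<^sup>+x. ennreal r * (\<integral>\<^sup>+s. J s x \<partial>lborel) \<partial>M)"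
    using r by (simp add: inner ennreal_mult[symmetric])
  also have "\<dots> = ennreal r * (\<integral>\<^sup>+x. (\<integral>\<^sup>+s. J s x \<partial>lborel) \<partial>M)"
    by (rule nn_integral_cmult) (simp add: inner)
  also have "(\<integral>\<^sup>+x. (\<integral>\<^sup>+s. J s x \<partial>lborel) \<partial>M) = (\<integral>\<^sup>+s. (\<integral>\<^sup>+x. J s x \<partial>M) \<partial>lborel)"
    by (rule Fubini'[symmetric]) (rule J1)
  also have "\<dots> = (\<integral>\<^sup>+s\<in>{0<..}. ennreal (s powr (r - 1)) * emeasure M {x\<in>space M. s < norm (f x)} \<partial>lborel)"
  proof (rule nn_integral_cong)
    fix s :: real
    have "(\<integral>\<^sup>+x. J s x \<partial>M)
      = (\<integral>\<^sup>+x. (ennreal (s powr (r - 1)) * indicator {0<..} s) * indicator {x\<in>space M. s < norm (f x)} x \<partial>M)"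
      by (intro nn_integral_cong) (auto simp: J_def)
    also have "\<dots> = (ennreal (s powr (r - 1)) * indicator {0<..} s) * emeasure M {x\<in>space M. s < norm (f x)}"
      by (rule nn_integral_cmult_indicator) measurable
    finally show "(\<integral>\<^sup>+x. J s x \<partial>M) = ennreal (s powr (r - 1)) * emeasure M {x\<in>space M. s < norm (f x)} * indicator {0<..} s"
      by (simp add: mult_ac)
  qed
  finally show ?thesis .
qed

lemma lorentz_norm_epowr:
  assumes "0 < q"
  shows "lorentz_norm M r q f epowr q = ennreal r * (\<integral>\<^sup>+ s\<in>{0<..}. ennreal (s powr (q - 1)) *
        emeasure M {x \<in> space M. norm (f x) > s} epowr (q / r) \<partial>lborel)"
  using assms by (simp add: lorentz_norm_def epowr_epowr)

text \<open>The distribution function decreases, so integrating over (0, t) alone already produces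
  its value at \<open>t\<close> times t^q / q. The normalizing factor \<open>r\<close> gives r/q >=
  1, hence constant 1.\<close>

lemma weak_le_lorentz:
  fixes f :: "'a \<Rightarrow> 'b::real_normed_vector"
  assumes [measurable]: "(\<lambda>x. norm (f x)) \<in> borel_measurable M" and q: "0 < q" "q \<le> r" and t: "0 < t"
  shows "ennreal t * emeasure M {x\<in>space M. t < norm (f x)} epowr (1 / r) \<le> lorentz_norm M r q f"
proof -
  define D where "D s = emeasure M {x\<in>space M. s < norm (f x)}" for s
  have anti: "D t \<le> D s" if "s \<le> t" for s
    unfolding D_def using that by (intro emeasure_mono) auto
  have "ennreal (t powr q) * D t epowr (q / r) \<le> ennreal r * (ennreal (t powr q / q) * D t epowr (q / r))"
  proof -
    have "t powr q \<le> r * (t powr q / q)" using q t by (simp add: field_simps)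
    then have "ennreal (t powr q) \<le> ennreal r * ennreal (t powr q / q)"
      using q by (simp add: ennreal_mult[symmetric] ennreal_leI)
    then show ?thesis by (simp add: mult.assoc[symmetric] mult_right_mono)
  qed
  also have "ennreal (t powr q / q) * D t epowr (q / r)
    = (\<integral>\<^sup>+s. (ennreal (s powr (q - 1)) * indicator {..<t} s * indicator {0<..} s) * D t epowr (q / r) \<partial>lborel)"
    using q t by (subst nn_integral_multc) (auto simp: nn_integral_powr_lessThan)
  also have "\<dots> \<le> (\<integral>\<^sup>+ s\<in>{0<..}. ennreal (s powr (q - 1)) * D s epowr (q / r) \<partial>lborel)"
    using q by (intro nn_integral_mono) (auto split: split_indicator intro!: mult_left_mono epowr_mono anti)
  finally have "ennreal (t powr q) * D t epowr (q / r) \<le> lorentz_norm M r q f epowr q"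
    using q by (simp add: lorentz_norm_epowr D_def mult_left_mono)
  then have "(ennreal (t powr q) * D t epowr (q / r)) epowr (1 / q) \<le> (lorentz_norm M r q f epowr q) epowr (1 / q)"
    using q by (intro epowr_mono) auto
  then show ?thesis
    using q t by (simp add: epowr_mult epowr_epowr epowr_ennreal powr_powr D_def)
qed

text \<open>In the layer cake formula split s^(r-1) D = (s D^(1/r))^(r-q) * s^(q-1) D^(q/r). The
  first factor is bounded by the weak norm, hence by the Lorentz norm, and the second integrates to
  its \<open>q\<close>-th power.\<close>

lemma nn_integral_le_lorentz:
  fixes f :: "'a \<Rightarrow> 'b::real_normed_vector"
  assumes M: "sigma_finite_measure M" and f[measurable]: "(\<lambda>x. norm (f x)) \<in> borel_measurable M"
    and q: "0 < q" "q \<le> r"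
  shows "(\<integral>\<^sup>+x. ennreal (norm (f x) powr r) \<partial>M) \<le> lorentz_norm M r q f epowr r"
proof -
  define D where "D s = emeasure M {x\<in>space M. s < norm (f x)}" for s
  define N where "N = lorentz_norm M r q f"
  have [measurable]: "D \<in> borel_measurable borel"
    unfolding D_def[abs_def] using M f by (rule borel_measurable_distribution)
  have pt: "ennreal (s powr (r - 1)) * D s \<le> N epowr (r - q) * (ennreal (s powr (q - 1)) * D s epowr (q / r))"
    if s: "0 < s" for s
  proof -
    have "(ennreal s * D s epowr (1 / r)) epowr (r - q) \<le> N epowr (r - q)"
      using q weak_le_lorentz[OF f q s] by (intro epowr_mono) (auto simp: D_def N_def)
    then have "(ennreal (s powr (r - q)) * D s epowr ((r - q) / r)) * (ennreal (s powr (q - 1)) * D s epowr (q / r))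
       \<le> N epowr (r - q) * (ennreal (s powr (q - 1)) * D s epowr (q / r))"
      using s by (intro mult_right_mono) (auto simp: epowr_mult epowr_epowr epowr_ennreal)
    also have "(ennreal (s powr (r - q)) * D s epowr ((r - q) / r)) * (ennreal (s powr (q - 1)) * D s epowr (q / r))
      = ennreal (s powr (r - q) * s powr (q - 1)) * (D s epowr ((r - q) / r) * D s epowr (q / r))"
      by (simp add: ennreal_mult mult_ac)
    also have "\<dots> = ennreal (s powr (r - 1)) * D s"
    proof -
      have "(r - q) / r + q / r = 1" using q by (simp add: field_simps)
      then show ?thesis by (simp add: epowr_add[symmetric] powr_add[symmetric])
    qed
    finally show ?thesis .
  qed
  have "(\<integral>\<^sup>+x. ennreal (norm (f x) powr r) \<partial>M)
    = ennreal r * (\<integral>\<^sup>+s\<in>{0<..}. ennreal (s powr (r - 1)) * D s \<partial>lborel)"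
    unfolding D_def using q by (intro nn_integral_layer_cake M f) auto
  also have "\<dots> \<le> ennreal r * (\<integral>\<^sup>+s. N epowr (r - q) * (ennreal (s powr (q - 1)) * D s epowr (q / r) * indicator {0<..} s) \<partial>lborel)"
    using pt by (intro mult_left_mono nn_integral_mono) (auto split: split_indicator)
  also have "\<dots> = ennreal r * (N epowr (r - q) * (\<integral>\<^sup>+s\<in>{0<..}. ennreal (s powr (q - 1)) * D s epowr (q / r) \<partial>lborel))"
    by (subst nn_integral_cmult) auto
  also have "\<dots> = N epowr (r - q) * N epowr q"
    using q by (simp add: N_def lorentz_norm_epowr D_def mult_ac)
  also have "\<dots> = N epowr r" by (simp add: epowr_add[symmetric])
  finally show ?thesis by (simp add: N_def)
qed

text \<open>On {|f| > s} the weight \<open>w\<close> is at most (c/s)^(p-r) v, which compares the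
  distribution functions. Raised to \<alpha>/p, the power of \<open>s\<close> turns s^(\<alpha>-1)
  into exactly s^(q-1) with q = \<alpha> r / p: this is the origin of the second Lorentz index in
  the conclusion. The constant reflects the two normalizing factors \<open>p\<close> and
  \<open>r\<close>.\<close>

lemma lorentz_norm_reweight:
  fixes f :: "'a \<Rightarrow> 'b::real_normed_vector"
  assumes M: "sigma_finite_measure (density M (\<lambda>x. ennreal (v x)))"
    and f[measurable]: "(\<lambda>x. norm (f x)) \<in> borel_measurable M"
    and v[measurable]: "v \<in> borel_measurable M" and w[measurable]: "w \<in> borel_measurable M"
    and r: "0 < r" "r \<le> p" and \<alpha>: "0 < \<alpha>" and c: "0 < c"
    and N: "lorentz_norm (density M (\<lambda>x. ennreal (v x))) r (\<alpha> * r / p) f \<le> ennreal c"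
    and wv: "AE x in M. f x \<noteq> 0 \<longrightarrow> w x \<le> v x * (c / norm (f x)) powr (p - r)"
    and v0: "\<And>x. 0 \<le> v x"
  shows "lorentz_norm (density M (\<lambda>x. ennreal (w x))) p \<alpha> f \<le> ennreal ((p / r) powr (1 / \<alpha>) * c)"
proof -
  define Mv where "Mv = density M (\<lambda>x. ennreal (v x))"
  define Mw where "Mw = density M (\<lambda>x. ennreal (w x))"
  define q where "q = \<alpha> * r / p"
  have p: "0 < p" using r by simp
  have q: "0 < q" "q / r = \<alpha> / p" using r p \<alpha> by (auto simp: q_def)
  define D where "D s = emeasure Mv {x\<in>space Mv. s < norm (f x)}" for s
  have [measurable]: "D \<in> borel_measurable borel"
    unfolding D_def[abs_def] Mv_def using M by (rule borel_measurable_distribution) simp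
  have Dw: "emeasure Mw {x\<in>space Mw. s < norm (f x)} \<le> ennreal ((c / s) powr (p - r)) * D s" if s: "0 < s" for s
  proof -
    have "emeasure Mw {x\<in>space Mw. s < norm (f x)} = (\<integral>\<^sup>+x. ennreal (w x) * indicator {x\<in>space M. s < norm (f x)} x \<partial>M)"
      unfolding Mw_def by (subst emeasure_density) auto
    also have "\<dots> \<le> (\<integral>\<^sup>+x. ennreal ((c / s) powr (p - r)) * (ennreal (v x) * indicator {x\<in>space M. s < norm (f x)} x) \<partial>M)"
    proof (rule nn_integral_mono_AE)
      show "AE x in M. ennreal (w x) * indicator {x\<in>space M. s < norm (f x)} x
        \<le> ennreal ((c / s) powr (p - r)) * (ennreal (v x) * indicator {x\<in>space M. s < norm (f x)} x)"
        using wv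
      proof (rule eventually_mono)
        fix x assume *: "f x \<noteq> 0 \<longrightarrow> w x \<le> v x * (c / norm (f x)) powr (p - r)"
        have "w x \<le> (c / s) powr (p - r) * v x" if "s < norm (f x)"
        proof -
          have "f x \<noteq> 0" using that s by auto
          then have "w x \<le> v x * (c / norm (f x)) powr (p - r)" using * by simp
          also have "\<dots> \<le> v x * (c / s) powr (p - r)"
            using that s c r v0 \<open>f x \<noteq> 0\<close> by (intro mult_left_mono powr_mono2 divide_left_mono) auto
          finally show ?thesis by (simp add: mult.commute)
        qed
        then show "ennreal (w x) * indicator {x\<in>space M. s < norm (f x)} x
          \<le> ennreal ((c / s) powr (p - r)) * (ennreal (v x) * indicator {x\<in>space M. s < norm (f x)} x)"
          using v0[of x] by (auto split: split_indicator simp: ennreal_mult[symmetric] ennreal_leI)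
      qed
    qed
    also have "\<dots> = ennreal ((c / s) powr (p - r)) * D s"
      unfolding D_def Mv_def by (subst nn_integral_cmult) (auto simp: emeasure_density)
    finally show ?thesis .
  qed
  have "(\<integral>\<^sup>+ s\<in>{0<..}. ennreal (s powr (\<alpha> - 1)) * emeasure Mw {x \<in> space Mw. norm (f x) > s} epowr (\<alpha> / p) \<partial>lborel)
    \<le> (\<integral>\<^sup>+ s. ennreal (c powr ((p - r) * (\<alpha> / p))) * (ennreal (s powr (q - 1)) * D s epowr (q / r) * indicator {0<..} s) \<partial>lborel)"
  proof (rule nn_integral_mono)
    fix s :: real
    have "ennreal (s powr (\<alpha> - 1)) * emeasure Mw {x \<in> space Mw. norm (f x) > s} epowr (\<alpha> / p)
      \<le> ennreal (c powr ((p - r) * (\<alpha> / p))) * (ennreal (s powr (q - 1)) * D s epowr (q / r))" if s: "0 < s"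
    proof -
      have "emeasure Mw {x \<in> space Mw. norm (f x) > s} epowr (\<alpha> / p)
         \<le> (ennreal ((c / s) powr (p - r)) * D s) epowr (\<alpha> / p)"
        using Dw[OF s] \<alpha> p by (intro epowr_mono) auto
      also have "\<dots> = ennreal ((c / s) powr ((p - r) * (\<alpha> / p))) * D s epowr (q / r)"
        using q by (simp add: epowr_mult epowr_ennreal powr_powr)
      finally have "ennreal (s powr (\<alpha> - 1)) * emeasure Mw {x \<in> space Mw. norm (f x) > s} epowr (\<alpha> / p)
        \<le> ennreal (s powr (\<alpha> - 1)) * (ennreal ((c / s) powr ((p - r) * (\<alpha> / p))) * D s epowr (q / r))"
        by (rule mult_left_mono) simp
      also have "\<dots> = ennreal (s powr (\<alpha> - 1) * (c / s) powr ((p - r) * (\<alpha> / p))) * D s epowr (q / r)"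
        by (simp add: ennreal_mult mult_ac)
      also have "s powr (\<alpha> - 1) * (c / s) powr ((p - r) * (\<alpha> / p)) = c powr ((p - r) * (\<alpha> / p)) * s powr (q - 1)"
      proof -
        have e: "q - 1 = (\<alpha> - 1) - (p - r) * (\<alpha> / p)" using p by (simp add: q_def field_simps)
        show ?thesis unfolding e using s c by (simp add: powr_divide powr_diff)
      qed
      finally show ?thesis by (simp add: ennreal_mult mult_ac)
    qed
    then show "ennreal (s powr (\<alpha> - 1)) * emeasure Mw {x \<in> space Mw. norm (f x) > s} epowr (\<alpha> / p) * indicator {0<..} s
      \<le> ennreal (c powr ((p - r) * (\<alpha> / p))) * (ennreal (s powr (q - 1)) * D s epowr (q / r) * indicator {0<..} s)"
      by (auto split: split_indicator)
  qed
  also have "\<dots> = ennreal (c powr ((p - r) * (\<alpha> / p))) * (\<integral>\<^sup>+ s\<in>{0<..}. ennreal (s powr (q - 1)) * D s epowr (q / r) \<partial>lborel)"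
    by (rule nn_integral_cmult) measurable
  finally have "ennreal p * (\<integral>\<^sup>+ s\<in>{0<..}. ennreal (s powr (\<alpha> - 1)) * emeasure Mw {x \<in> space Mw. norm (f x) > s} epowr (\<alpha> / p) \<partial>lborel)
    \<le> ennreal p * (ennreal (c powr ((p - r) * (\<alpha> / p))) * (\<integral>\<^sup>+ s\<in>{0<..}. ennreal (s powr (q - 1)) * D s epowr (q / r) \<partial>lborel))"
    by (rule mult_left_mono) simp
  also have "\<dots> = ennreal (p / r * c powr ((p - r) * (\<alpha> / p))) * (ennreal r * (\<integral>\<^sup>+ s\<in>{0<..}. ennreal (s powr (q - 1)) * D s epowr (q / r) \<partial>lborel))"
  proof -
    have "ennreal p = ennreal (p / r) * ennreal r" using r p by (simp add: ennreal_mult[symmetric])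
    moreover have "ennreal (p / r * c powr ((p - r) * (\<alpha> / p))) = ennreal (p / r) * ennreal (c powr ((p - r) * (\<alpha> / p)))"
      using r p by (intro ennreal_mult) auto
    ultimately show ?thesis by (simp only: mult_ac)
  qed
  also have "ennreal r * (\<integral>\<^sup>+ s\<in>{0<..}. ennreal (s powr (q - 1)) * D s epowr (q / r) \<partial>lborel) = lorentz_norm Mv r q f epowr q"
    using q by (simp add: lorentz_norm_epowr D_def)
  also have "ennreal (p / r * c powr ((p - r) * (\<alpha> / p))) * (lorentz_norm Mv r q f epowr q)
     \<le> ennreal (p / r * c powr ((p - r) * (\<alpha> / p))) * ennreal (c powr q)"
    using epowr_mono[OF N, of q] q c by (intro mult_left_mono) (auto simp: Mv_def q_def epowr_ennreal)
  also have "\<dots> = ennreal (p / r * c powr \<alpha>)"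
  proof -
    have "(p - r) * (\<alpha> / p) + q = \<alpha>" using p by (simp add: q_def field_simps)
    then have "p / r * c powr \<alpha> = p / r * c powr ((p - r) * (\<alpha> / p)) * c powr q"
      by (simp add: mult.assoc powr_add[symmetric])
    moreover have "ennreal (p / r * c powr ((p - r) * (\<alpha> / p)) * c powr q)
        = ennreal (p / r * c powr ((p - r) * (\<alpha> / p))) * ennreal (c powr q)"
      using r p by (intro ennreal_mult) auto
    ultimately show ?thesis by (simp only:)
  qed
  finally have "lorentz_norm Mw p \<alpha> f \<le> ennreal (p / r * c powr \<alpha>) epowr (1 / \<alpha>)"
    unfolding lorentz_norm_def using \<alpha> by (intro epowr_mono) auto
  also have "\<dots> = ennreal ((p / r) powr (1 / \<alpha>) * c)"
  proof -
    have "(p / r * c powr \<alpha>) powr (1 / \<alpha>) = (p / r) powr (1 / \<alpha>) * (c powr \<alpha>) powr (1 / \<alpha>)"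
      by (intro powr_mult)
    then show ?thesis using r p \<alpha> c by (simp add: epowr_ennreal powr_powr)
  qed
  finally show ?thesis by (simp add: Mw_def)
qed

section \<open>Exponents and the classes of weights\<close>

lemma prod_powr_right:
  fixes b :: "'i \<Rightarrow> real"
  assumes "finite I" "0 < x"
  shows "(\<Prod>i\<in>I. x powr b i) = x powr (\<Sum>i\<in>I. b i)"
  using assms by (induction I rule: finite_induct) (auto simp: powr_add)

lemma prod_ennreal_eq:
  assumes "finite I" "\<And>i. i \<in> I \<Longrightarrow> 0 \<le> b i"
  shows "(\<Prod>i\<in>I. ennreal (b i)) = ennreal (\<Prod>i\<in>I. b i)"
  using assms by (simp add: prod_ennreal)

lemma ennreal_mult_less_topD:
  fixes x y :: ennreal
  assumes "x * y < \<infinity>" "0 < x" "0 < y" shows "x < \<infinity>" "y < \<infinity>"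
  using assms by (auto simp: ennreal_mult_less_top)

lemma prod_ennreal_less_top:
  fixes E :: "'i \<Rightarrow> ennreal"
  assumes "finite I" "\<And>i. i \<in> I \<Longrightarrow> 0 < E i" "(\<Prod>i\<in>I. E i) < \<infinity>" "j \<in> I"
  shows "E j < \<infinity>"
proof -
  have "(\<Prod>i\<in>I. E i) = E j * (\<Prod>i\<in>I - {j}. E i)" using assms by (intro prod.remove) auto
  moreover have "(\<Prod>i\<in>I - {j}. E i) \<noteq> 0"
    using assms(1,2) by (force simp: prod_zero_iff)
  ultimately show ?thesis using assms(3) by (auto simp: ennreal_mult_less_top)
qed

locale exponents =
  fixes m :: nat and ps r :: "nat \<Rightarrow> real"
  assumes m1: "1 \<le> m"
    and r_ps: "i \<in> {1..m} \<Longrightarrow> 1 \<le> r i \<and> r i \<le> ps i"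
    and r_last: "1 \<le> r (m + 1)"
    and subcritical: "1 / total_exp m ps > inv_conj (r (m + 1))"
begin

definition p :: real where "p = total_exp m ps"
definition \<rho> :: real where "\<rho> = total_exp m r"
text \<open>Working with reciprocal exponents makes the endpoint \<delta>_i = \<infinity> the
  ordinary value 0, and sums of them are linear.\<close>

definition \<gamma> :: "nat \<Rightarrow> real" where "\<gamma> i = 1 / r i - 1 / ps i"
definition G :: real where "G = (\<Sum>i=1..m. \<gamma> i)"
definition D :: real where "D = 1 / \<rho> - inv_conj (r (m + 1))"
definition D' :: real where "D' = 1 / p - inv_conj (r (m + 1))"

lemma r_pos: "i \<in> {1..m} \<Longrightarrow> 0 < r i" and ps_pos: "i \<in> {1..m} \<Longrightarrow> 0 < ps i"
  using r_ps[of i] by auto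

lemma inv_p: "1 / p = (\<Sum>i=1..m. 1 / ps i)" and inv_rho: "1 / \<rho> = (\<Sum>i=1..m. 1 / r i)"
  by (simp_all add: p_def \<rho>_def total_exp_def)

lemma p_pos: "0 < p" and rho_pos: "0 < \<rho>"
proof -
  have "0 < 1 / p" unfolding inv_p using m1 ps_pos by (intro sum_pos) auto
  then show "0 < p" by simp
  have "0 < 1 / \<rho>" unfolding inv_rho using m1 r_pos by (intro sum_pos) auto
  then show "0 < \<rho>" by simp
qed

lemma gamma_nonneg: "i \<in> {1..m} \<Longrightarrow> 0 \<le> \<gamma> i"
  using r_ps[of i] by (auto simp: \<gamma>_def field_simps)

lemma G_nonneg: "0 \<le> G"
  unfolding G_def by (intro sum_nonneg gamma_nonneg)

lemma G_eq: "G = 1 / \<rho> - 1 / p"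
  unfolding G_def inv_p inv_rho \<gamma>_def by (simp add: sum_subtractf)

lemma D'_pos: "0 < D'" and D_eq: "D = D' + G"
  using subcritical by (simp_all add: D'_def D_def G_eq p_def)

lemma D_pos: "0 < D" using D'_pos D_eq G_nonneg by simp

lemma delta_exp_eq:
  "delta_exp m ps r (m + 1) = 1 / D'" "delta_exp m r r (m + 1) = 1 / D"
  "i \<in> {1..m} \<Longrightarrow> delta_exp m ps r i = 1 / \<gamma> i"
  by (auto simp: delta_exp_def inv_exp_def inv_conj_def D_def D'_def p_def \<rho>_def \<gamma>_def)

text \<open>These bounds place \<beta> = 1 - \<rho> D in the range of the mixed inequality. The
  upper one holds because 1/r' is nonnegative for r >= 1.\<close>

lemma rho_D: "0 < \<rho> * D" "\<rho> * D \<le> 1"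
proof -
  show "0 < \<rho> * D" using rho_pos D_pos by simp
  have "0 \<le> inv_conj (r (m + 1))" using r_last by (simp add: inv_conj_def)
  then have "D \<le> 1 / \<rho>" by (simp add: D_def)
  then show "\<rho> * D \<le> 1" using rho_pos by (simp add: field_simps)
qed

definition V :: "(nat \<Rightarrow> 'a \<Rightarrow> real) \<Rightarrow> 'a \<Rightarrow> real" where
  "V v x = (\<Prod>i=1..m. v i x powr (1 / r i))"

text \<open>The weight omega of the overview.\<close>

definition base :: "(nat \<Rightarrow> 'a \<Rightarrow> real) \<Rightarrow> 'a \<Rightarrow> real" where
  "base v x = V v x powr (1 / D)"

lemma V_pos: "(\<And>i. i \<in> {1..m} \<Longrightarrow> 0 < v i x) \<Longrightarrow> 0 < V v x"
  unfolding V_def by (rule prod_pos) (metis less_irrefl powr_gt_zero)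

lemma base_pos: "(\<And>i. i \<in> {1..m} \<Longrightarrow> 0 < v i x) \<Longrightarrow> 0 < base v x"
  using V_pos[of v x] by (simp add: base_def)

lemma prod_weight_r: "prod_weight m r v x = V v x powr \<rho>"
  unfolding prod_weight_def V_def \<rho>_def[symmetric]
  by (subst prod_powr_distrib) (auto simp: powr_powr intro!: prod.cong)

lemma borel_measurable_V:
  assumes "\<And>i. i \<in> {1..m} \<Longrightarrow> v i \<in> borel_measurable M"
  shows "V v \<in> borel_measurable M"
  unfolding V_def[abs_def] using assms by (intro borel_measurable_prod powr_real_measurable) auto

lemma borel_measurable_prod_weight:
  assumes "\<And>i. i \<in> {1..m} \<Longrightarrow> v i \<in> borel_measurable M"
  shows "prod_weight m s v \<in> borel_measurable M"
  unfolding prod_weight_def[abs_def] using assms by (intro borel_measurable_prod powr_real_measurable) auto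

text \<open>The condition on \<open>AR_const m r r v\<close> with the essential suprema and the average of \<open>base v\<close>
  over the cube replaced by real numbers \<open>S i\<close> and \<open>X\<close>.\<close>
definition cube_bound :: "(nat \<Rightarrow> real^'n \<Rightarrow> real) \<Rightarrow> real \<Rightarrow> bool" where
  "cube_bound v a \<longleftrightarrow> (\<forall>c l. 0 < l \<longrightarrow> (\<exists>S X. (\<forall>i\<in>{1..m}. 0 < S i \<and>
      (AE x in lebesgue. x \<in> cube c l \<longrightarrow> v i x powr (- 1 / r i) \<le> S i)) \<and> 0 < X \<and>
      (\<integral>\<^sup>+x\<in>cube c l. ennreal (base v x) \<partial>lebesgue) = ennreal (X * l ^ CARD('n)) \<and>
      X powr D * (\<Prod>i=1..m. S i) \<le> a))"

text \<open>The class constant bounds a product in [0, \<infinity>]. Every factor is positive, since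
  cubes are not null and the weights are positive, so finiteness of the product passes to each
  factor and real values can be extracted. The passage from \<open>u\<close> to \<open>v\<close>
  permits a change on a null set.\<close>

lemma cube_boundI:
  fixes v u :: "nat \<Rightarrow> real^'n \<Rightarrow> real"
  assumes v: "\<And>i. i \<in> {1..m} \<Longrightarrow> v i \<in> borel_measurable lebesgue" "\<And>i x. i \<in> {1..m} \<Longrightarrow> 0 < v i x"
    and u: "\<And>i. i \<in> {1..m} \<Longrightarrow> u i \<in> borel_measurable lebesgue"
    and uv: "\<And>i. i \<in> {1..m} \<Longrightarrow> AE x in lebesgue. u i x = v i x"
    and a: "AR_const m r r u \<le> ennreal a" "0 \<le> a"
  shows "cube_bound v a"
  unfolding cube_bound_def
proof (intro allI impI)
  fix c :: "real^'n" and l :: real assume l: "0 < l"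
  define Q where "Q = cube c l"
  have Qs[measurable]: "Q \<in> sets lebesgue" by (simp add: Q_def)
  have mQ: "emeasure lebesgue Q = ennreal (l ^ CARD('n))" unfolding Q_def by (rule emeasure_cube(1)[OF l])
  have lpos: "0 < l ^ CARD('n)" using l by simp
  have Qc: "Q \<in> cubes" using l by (auto simp: cubes_def Q_def)
  define E where "E i = esssup (restrict_space lebesgue Q) (\<lambda>x. ennreal (u i x powr (- 1 / r i)))" for i
  define I where "I = (\<integral>\<^sup>+x\<in>Q. ennreal (base v x) \<partial>lebesgue)"
  have pw: "AE x in lebesgue. prod_weight m r u x powr (delta_exp m r r (m + 1) / total_exp m r) = base v x"
  proof -
    have "AE x in lebesgue. \<forall>i\<in>{1..m}. u i x = v i x"
      using uv by (intro AE_finite_allI) auto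
    then show ?thesis
    proof (rule eventually_mono)
      fix x assume *: "\<forall>i\<in>{1..m}. u i x = v i x"
      have "V u x = V v x" unfolding V_def using * by (intro prod.cong) auto
      then show "prod_weight m r u x powr (delta_exp m r r (m + 1) / total_exp m r) = base v x"
        using rho_pos unfolding delta_exp_eq(2) by (simp add: prod_weight_r base_def powr_powr \<rho>_def[symmetric])
    qed
  qed
  have I_eq: "(\<integral>\<^sup>+x\<in>Q. ennreal (prod_weight m r u x powr (delta_exp m r r (m + 1) / total_exp m r)) \<partial>lebesgue) = I"
    unfolding I_def using pw by (intro nn_integral_cong_AE) (auto elim!: eventually_mono)
  have "(I / emeasure lebesgue Q) epowr (1 / delta_exp m r r (m + 1)) * (\<Prod>i=1..m. E i) \<le> AR_const m r r u"
    unfolding AR_const_def I_eq[symmetric] E_def by (rule SUP_upper2[OF Qc]) simp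
  then have bound: "(I / emeasure lebesgue Q) epowr D * (\<Prod>i=1..m. E i) \<le> ennreal a"
    using a D_pos unfolding delta_exp_eq(2) by simp
  have nonnull: False if "AE x in lebesgue. x \<notin> Q"
    using that cube_not_null[OF l] unfolding Q_def by blast
  have E_AE: "AE x in lebesgue. x \<in> Q \<longrightarrow> ennreal (v i x powr (- 1 / r i)) \<le> E i" if i: "i \<in> {1..m}" for i
  proof -
    have "AE x in restrict_space lebesgue Q. ennreal (u i x powr (- 1 / r i)) \<le> E i"
      unfolding E_def by (rule esssup_AE)
    then have "AE x in lebesgue. x \<in> Q \<longrightarrow> ennreal (u i x powr (- 1 / r i)) \<le> E i"
      by (subst (asm) AE_restrict_space_iff) auto
    with uv[OF i] show ?thesis by eventually_elim auto
  qed
  have E_pos: "0 < E i" if i: "i \<in> {1..m}" for i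
  proof (rule ccontr)
    assume "\<not> 0 < E i"
    then have "E i = 0" by simp
    then have "AE x in lebesgue. x \<notin> Q"
      using E_AE[OF i] v(2)[OF i] by (auto elim!: eventually_mono simp: less_imp_neq[symmetric])
    then show False by (rule nonnull)
  qed
  have bp: "0 < base v x" for x using v(2) by (intro base_pos)
  have bm[measurable]: "base v \<in> borel_measurable lebesgue"
    unfolding base_def[abs_def] using v(1) by (intro powr_real_measurable borel_measurable_V) auto
  have I_pos: "0 < I"
  proof (rule ccontr)
    assume "\<not> 0 < I"
    then have "I = 0" by simp
    then have "AE x in lebesgue. ennreal (base v x) * indicator Q x = 0"
      unfolding I_def by (subst (asm) nn_integral_0_iff_AE) auto
    then have "AE x in lebesgue. x \<notin> Q"
      by (rule eventually_mono) (use bp in \<open>auto split: split_indicator_asm simp: ennreal_eq_0_iff not_less[symmetric]\<close>)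
    then show False by (rule nonnull)
  qed
  have XQ_pos: "0 < I / emeasure lebesgue Q" using I_pos mQ by (simp add: ennreal_zero_less_divide)
  have prod_pos: "0 < (\<Prod>i=1..m. E i)"
    using E_pos by (simp add: zero_less_iff_neq_zero)
  have "(I / emeasure lebesgue Q) epowr D * (\<Prod>i=1..m. E i) < \<infinity>" using bound by (rule order_le_less_trans) simp
  then have fin: "(I / emeasure lebesgue Q) epowr D < \<infinity>" "(\<Prod>i=1..m. E i) < \<infinity>"
    using ennreal_mult_less_topD[OF _ epowr_pos[OF XQ_pos, of D] prod_pos] by blast+
  then have "I / emeasure lebesgue Q < \<infinity>"
    by (auto simp: epowr_def less_top split: if_splits)
  then obtain X where X: "I / emeasure lebesgue Q = ennreal X" "0 \<le> X"
    by (cases "I / emeasure lebesgue Q") auto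
  have Xpos: "0 < X" using X XQ_pos by simp
  have I_X: "I = ennreal (X * l ^ CARD('n))"
  proof -
    have "I = I / emeasure lebesgue Q * emeasure lebesgue Q"
      unfolding mQ ennreal_divide_times using l by (subst ennreal_divide_self) auto
    also have "\<dots> = ennreal (X * l ^ CARD('n))" using X mQ lpos by (simp add: ennreal_mult)
    finally show ?thesis .
  qed
  define S where "S i = enn2real (E i)" for i
  have ES: "E i = ennreal (S i)" "0 < S i" if i: "i \<in> {1..m}" for i
  proof -
    have "E i < \<infinity>" using prod_ennreal_less_top[of "{1..m}" E i] E_pos fin i by auto
    then show "E i = ennreal (S i)" "0 < S i" using E_pos[OF i] by (auto simp: S_def enn2real_positive_iff)
  qed
  have "(\<Prod>i=1..m. E i) = (\<Prod>i=1..m. ennreal (S i))" using ES by (intro prod.cong) auto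
  also have "\<dots> = ennreal (\<Prod>i=1..m. S i)" using ES by (intro prod_ennreal_eq) (auto intro: less_imp_le)
  finally have pS: "(\<Prod>i=1..m. E i) = ennreal (\<Prod>i=1..m. S i)" .
  have "ennreal (X powr D * (\<Prod>i=1..m. S i)) \<le> ennreal a"
  proof -
    have "0 \<le> (\<Prod>i=1..m. S i)" using ES(2) by (intro prod_nonneg) (auto intro: less_imp_le)
    then have "ennreal (X powr D * (\<Prod>i=1..m. S i)) = ennreal (X powr D) * ennreal (\<Prod>i=1..m. S i)"
      by (intro ennreal_mult) auto
    then show ?thesis using bound unfolding X(1) pS by (simp add: epowr_ennreal X(2))
  qed
  then have "X powr D * (\<Prod>i=1..m. S i) \<le> a" using a(2) by (simp add: ennreal_le_iff)
  moreover have "AE x in lebesgue. x \<in> Q \<longrightarrow> v i x powr (- 1 / r i) \<le> S i" if i: "i \<in> {1..m}" for i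
    using E_AE[OF i] ES[OF i] by (auto elim!: eventually_mono simp: ennreal_le_iff)
  ultimately show "\<exists>S X. (\<forall>i\<in>{1..m}. 0 < S i \<and>
      (AE x in lebesgue. x \<in> cube c l \<longrightarrow> v i x powr (- 1 / r i) \<le> S i)) \<and> 0 < X \<and>
      (\<integral>\<^sup>+x\<in>cube c l. ennreal (base v x) \<partial>lebesgue) = ennreal (X * l ^ CARD('n)) \<and>
      X powr D * (\<Prod>i=1..m. S i) \<le> a"
    using ES(2) Xpos I_X unfolding Q_def I_def by (intro exI[of _ S] exI[of _ X]) auto
qed

text \<open>Multiplying the bounds v_i^(-1/r_i) <= S_i gives 1/V <= prod S_i almost everywhere on
  the cube, hence X^D <= a V. The power 1/D turns this into the A_1 condition.\<close>

lemma A1_weight_base: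
  fixes v :: "nat \<Rightarrow> real^'n \<Rightarrow> real"
  assumes v: "\<And>i. i \<in> {1..m} \<Longrightarrow> v i \<in> borel_measurable lebesgue" "\<And>i x. i \<in> {1..m} \<Longrightarrow> 0 < v i x"
    and a: "cube_bound v a" "1 \<le> a"
  shows "A1_weight (base v) (a powr (1 / D))"
proof
  show "base v \<in> borel_measurable lebesgue"
    unfolding base_def[abs_def] using v(1) by (intro powr_real_measurable borel_measurable_V) auto
  show "0 < base v x" for x using v(2) by (intro base_pos)
  show "1 \<le> a powr (1 / D)" using a(2) D_pos by (intro ge_one_powr_ge_zero) auto
  fix l :: real and c :: "real^'n" assume l: "0 < l"
  obtain S X where SX: "\<forall>i\<in>{1..m}. 0 < S i \<and>
      (AE x in lebesgue. x \<in> cube c l \<longrightarrow> v i x powr (- 1 / r i) \<le> S i)" "0 < X"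
      "(\<integral>\<^sup>+x\<in>cube c l. ennreal (base v x) \<partial>lebesgue) = ennreal (X * l ^ CARD('n))"
      "X powr D * (\<Prod>i=1..m. S i) \<le> a"
    using a(1)[unfolded cube_bound_def, rule_format, OF l, of c] by blast
  have "AE x in lebesgue. \<forall>i\<in>{1..m}. x \<in> cube c l \<longrightarrow> v i x powr (- 1 / r i) \<le> S i"
    using SX(1) by (intro AE_finite_allI) auto
  then show "AE x in lebesgue. x \<in> cube c l \<longrightarrow>
      (\<integral>\<^sup>+x\<in>cube c l. ennreal (base v x) \<partial>lebesgue)
      \<le> ennreal (a powr (1 / D) * l ^ CARD('n) * base v x)"
  proof (rule eventually_mono, intro impI)
    fix x assume *: "\<forall>i\<in>{1..m}. x \<in> cube c l \<longrightarrow> v i x powr (- 1 / r i) \<le> S i"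
      "x \<in> cube c l"
    have Vp: "0 < V v x" using v(2) by (intro V_pos)
    have "1 / V v x = (\<Prod>i=1..m. v i x powr (- 1 / r i))"
      unfolding V_def by (simp add: prod_dividef powr_minus_divide)
    also have "\<dots> \<le> (\<Prod>i=1..m. S i)" using * by (intro prod_mono) auto
    finally have "X powr D * (1 / V v x) \<le> X powr D * (\<Prod>i=1..m. S i)" by (intro mult_left_mono) auto
    with SX(4) have "X powr D * (1 / V v x) \<le> a" by linarith
    then have "X powr D \<le> a * V v x" using Vp by (simp add: field_simps)
    then have "(X powr D) powr (1 / D) \<le> (a * V v x) powr (1 / D)"
      using D_pos by (intro powr_mono2) auto
    then have "X \<le> a powr (1 / D) * base v x"
      using D_pos SX(2) a(2) Vp by (simp add: powr_powr powr_mult base_def)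
    then have "X * l ^ CARD('n) \<le> (a powr (1 / D) * base v x) * l ^ CARD('n)"
      using l by (intro mult_right_mono) auto
    then show "(\<integral>\<^sup>+x\<in>cube c l. ennreal (base v x) \<partial>lebesgue)
      \<le> ennreal (a powr (1 / D) * l ^ CARD('n) * base v x)"
      unfolding SX(3) by (intro ennreal_leI) (simp add: mult_ac)
  qed
qed


text \<open>\<open>\<gamma> i = 1/\<delta>_i\<close>, \<open>D = 1/\<delta>\<close> and \<open>D' = 1/\<delta>_(m+1)\<close>, so that \<open>D = D' + G\<close>. The power of \<open>base v\<close> is
  chosen such that the \<open>\<delta>_(m+1)\<close>-th power of the product of the \<open>w_i^(1/p_i)\<close> is \<open>base v\<close> times a
  power of \<open>h\<close>.\<close>
definition new_weight :: "(nat \<Rightarrow> 'a \<Rightarrow> real) \<Rightarrow> ('a \<Rightarrow> real) \<Rightarrow> nat \<Rightarrow> 'a \<Rightarrow> real" where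
  "new_weight v h i x = (h x * base v x) powr (- (ps i * \<gamma> i)) * v i x powr (ps i / r i)"

section \<open>The modified weights and their class constant\<close>

context
  fixes v :: "nat \<Rightarrow> real^'n \<Rightarrow> real" and h :: "real^'n \<Rightarrow> real"
  assumes v_pos: "\<And>i x. i \<in> {1..m} \<Longrightarrow> 0 < v i x" and h_pos: "\<And>x. 0 < h x"
begin

lemma new_weight_pos: "i \<in> {1..m} \<Longrightarrow> 0 < new_weight v h i x"
  using v_pos[of i x] h_pos[of x] base_pos[of v x, OF v_pos] by (simp add: new_weight_def)

lemma new_weight_powr:
  assumes i: "i \<in> {1..m}"
  shows "new_weight v h i x powr (s / ps i) = (h x * base v x) powr (- (s * \<gamma> i)) * v i x powr (s / r i)"
  using ps_pos[OF i] by (simp add: new_weight_def powr_mult powr_powr mult.commute)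

lemma V_eq_base: "V v x = base v x powr D"
  using V_pos[of v x, OF v_pos] D_pos by (simp add: base_def powr_powr)

lemma prod_weight_new_weight:
  "prod_weight m ps (new_weight v h) x = h x powr (- (p * G)) * base v x powr (p * D')"
proof -
  have y: "0 < h x" "0 < base v x" using h_pos base_pos[of v x, OF v_pos] by auto
  have "prod_weight m ps (new_weight v h) x
    = (\<Prod>i=1..m. (h x * base v x) powr (- (p * \<gamma> i)) * v i x powr (p / r i))"
    unfolding prod_weight_def p_def[symmetric] by (intro prod.cong refl new_weight_powr)
  also have "\<dots> = (\<Prod>i=1..m. (h x * base v x) powr (- (p * \<gamma> i))) * (\<Prod>i=1..m. (v i x powr (1 / r i)) powr p)"
    by (simp add: prod.distrib powr_powr)
  also have "(\<Prod>i=1..m. (h x * base v x) powr (- (p * \<gamma> i))) = (h x * base v x) powr (- (p * G))"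
    using y by (subst prod_powr_right) (auto simp: G_def sum_negf sum_distrib_left)
  also have "(\<Prod>i=1..m. (v i x powr (1 / r i)) powr p) = V v x powr p"
    unfolding V_def by (subst prod_powr_distrib) auto
  also have "(h x * base v x) powr (- (p * G)) * V v x powr p
    = h x powr (- (p * G)) * (base v x powr (- (p * G)) * base v x powr (D * p))"
    using y by (simp add: powr_mult V_eq_base powr_powr mult.assoc)
  also have "base v x powr (- (p * G)) * base v x powr (D * p) = base v x powr (p * D')"
    unfolding powr_add[symmetric] by (simp add: D_eq algebra_simps)
  finally show ?thesis .
qed

end

lemma borel_measurable_base:
  assumes "\<And>i. i \<in> {1..m} \<Longrightarrow> v i \<in> borel_measurable M"
  shows "base v \<in> borel_measurable M"
  unfolding base_def[abs_def] using assms by (intro powr_real_measurable borel_measurable_V) auto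

lemma borel_measurable_new_weight:
  assumes "\<And>i. i \<in> {1..m} \<Longrightarrow> v i \<in> borel_measurable M" "h \<in> borel_measurable M" "i \<in> {1..m}"
  shows "new_weight v h i \<in> borel_measurable M"
  unfolding new_weight_def[abs_def] using assms borel_measurable_base[of v M]
  by (intro borel_measurable_times powr_real_measurable) auto

text \<open>The \<open>g\<close>-th power of a function in weak L^1 lies in weak L^(1/g), with norm
  raised to the power \<open>g\<close>; here the function is \<open>h x * b x\<close>, on the cube
  with normalized measure.\<close>

lemma weak_factor_le:
  fixes w h b :: "real^'n \<Rightarrow> real" and c :: "real^'n"
  assumes g: "0 < g" and S: "0 < S" and B: "0 < B" and l: "0 < l"
    and mb: "h \<in> borel_measurable lebesgue" "b \<in> borel_measurable lebesgue"
    and pos: "\<And>x. 0 < h x" "\<And>x. 0 < b x"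
  defines "Q \<equiv> cube c l"
  assumes w: "AE x in lebesgue. x \<in> Q \<longrightarrow> \<bar>w x\<bar> \<le> (h x * b x) powr g * S"
    and weak: "\<And>s. 0 < s \<Longrightarrow> ennreal s * emeasure lebesgue {x\<in>Q. s < h x * b x} \<le> ennreal (B * l ^ CARD('n))"
  shows "weak_lorentz_norm (normalized_lebesgue Q) (1 / g) (\<lambda>x. indicator Q x * w x) \<le> ennreal (S * B powr g)"
  unfolding weak_lorentz_norm_def
proof (rule SUP_least)
  fix t :: real assume "t \<in> {0<..}"
  then have t: "0 < t" by simp
  have Qs: "Q \<in> sets lebesgue" by (simp add: Q_def)
  have mQ: "emeasure lebesgue Q = ennreal (l ^ CARD('n))" unfolding Q_def by (rule emeasure_cube(1)[OF l])
  have lpos: "0 < l ^ CARD('n)" using l by simp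
  \<comment> \<open>The level of \<open>h x * b x\<close> at which its power \<open>g\<close> times
    \<open>S\<close> reaches \<open>t\<close>.\<close>
  define s where "s = (t / S) powr (1 / g)"
  have s: "0 < s" using t S by (simp add: s_def)
  have ms: "{x\<in>Q. s < h x * b x} \<in> sets lebesgue"
    by (rule sets_lebesgue_Collect_in[OF Qs]) (use mb in measurable)
  have "emeasure lebesgue {x. t < norm (indicator Q x * w x)} \<le> emeasure lebesgue {x\<in>Q. s < h x * b x}"
  proof (rule emeasure_mono_AE[OF _ ms])
    show "AE x in lebesgue. x \<in> {x. t < norm (indicator Q x * w x)} \<longrightarrow> x \<in> {x\<in>Q. s < h x * b x}"
      using w
    proof (rule eventually_mono, intro impI)
      fix x assume *: "x \<in> Q \<longrightarrow> \<bar>w x\<bar> \<le> (h x * b x) powr g * S" "x \<in> {x. t < norm (indicator Q x * w x)}"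
      have xQ: "x \<in> Q" using * t by (auto split: split_indicator_asm)
      then have "t < (h x * b x) powr g * S" using * by (auto simp: abs_mult)
      then have "t / S < (h x * b x) powr g" using S by (simp add: field_simps)
      then have "(t / S) powr (1 / g) < ((h x * b x) powr g) powr (1 / g)"
        using t S g by (intro powr_less_mono2) auto
      then have "s < h x * b x" using g pos[of x] by (simp add: s_def powr_powr)
      then show "x \<in> {x\<in>Q. s < h x * b x}" using xQ by simp
    qed
  qed
  also have "\<dots> \<le> ennreal (B * l ^ CARD('n) / s)"
  proof -
    have "ennreal (1 / s) * (ennreal s * emeasure lebesgue {x\<in>Q. s < h x * b x}) \<le> ennreal (1 / s) * ennreal (B * l ^ CARD('n))"
      using weak[OF s] by (intro mult_left_mono) auto
    moreover have "ennreal (1 / s) * (ennreal s * Z) = Z" for Z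
      using s by (simp add: mult.assoc[symmetric] ennreal_mult[symmetric] del: ennreal_1) simp
    moreover have "ennreal (1 / s) * ennreal (B * l ^ CARD('n)) = ennreal (B * l ^ CARD('n) / s)"
      using s B lpos by (simp add: ennreal_mult[symmetric])
    ultimately show ?thesis by simp
  qed
  finally have e: "emeasure lebesgue {x. t < norm (indicator Q x * w x)} \<le> ennreal (B * l ^ CARD('n) / s)" .
  have one: "1 / emeasure lebesgue Q = ennreal (1 / l ^ CARD('n))"
    unfolding mQ using lpos divide_ennreal[of 1 "l ^ CARD('n)"] by simp
  have "emeasure (normalized_lebesgue Q) {x \<in> space (normalized_lebesgue Q). t < norm (indicator Q x * w x)}
     = ennreal (1 / l ^ CARD('n)) * emeasure lebesgue {x. t < norm (indicator Q x * w x)}"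
    by (simp add: normalized_lebesgue_def one[symmetric] space_scale_measure)
  also have "\<dots> \<le> ennreal (1 / l ^ CARD('n)) * ennreal (B * l ^ CARD('n) / s)"
    by (intro mult_left_mono e) simp
  also have "\<dots> = ennreal (B / s)"
    using l B s by (subst ennreal_mult[symmetric]) auto
  finally have "emeasure (normalized_lebesgue Q) {x \<in> space (normalized_lebesgue Q). t < norm (indicator Q x * w x)} epowr (1 / (1 / g))
    \<le> ennreal (B / s) epowr (1 / (1 / g))"
    using g by (intro epowr_mono) auto
  then have "ennreal t * emeasure (normalized_lebesgue Q) {x \<in> space (normalized_lebesgue Q). t < norm (indicator Q x * w x)} epowr (1 / (1 / g))
    \<le> ennreal t * ennreal (B / s) epowr (1 / (1 / g))"
    by (rule mult_left_mono) simp
  also have "ennreal (B / s) epowr (1 / (1 / g)) = ennreal (B powr g / (t / S))"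
    using B s t S g by (simp add: epowr_ennreal powr_divide powr_mult s_def powr_powr)
  also have "ennreal t * \<dots> = ennreal (S * B powr g)"
    using t S by (simp add: ennreal_mult[symmetric] field_simps)
  finally show "ennreal t * emeasure (normalized_lebesgue Q) {x \<in> space (normalized_lebesgue Q). t < norm (indicator Q x * w x)} epowr (1 / (1 / g))
    \<le> ennreal (S * B powr g)" .
qed

abbreviation AR_average :: "(nat \<Rightarrow> real^'n \<Rightarrow> real) \<Rightarrow> (real^'n) set \<Rightarrow> ennreal" where
  "AR_average w Q \<equiv>
    ((\<integral>\<^sup>+ x\<in>Q. ennreal (prod_weight m ps w x powr (delta_exp m ps r (m + 1) / total_exp m ps)) \<partial>lebesgue)
      / emeasure lebesgue Q) epowr (1 / delta_exp m ps r (m + 1))"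

abbreviation AR_factor :: "(nat \<Rightarrow> real^'n \<Rightarrow> real) \<Rightarrow> (real^'n) set \<Rightarrow> nat \<Rightarrow> ennreal" where
  "AR_factor w Q i \<equiv> (if r i = ps i
    then esssup (restrict_space lebesgue Q) (\<lambda>x. ennreal (w i x powr (- 1 / ps i)))
    else weak_lorentz_norm (normalized_lebesgue Q) (delta_exp m ps r i)
      (\<lambda>x. indicator Q x * w i x powr (- 1 / ps i)))"

text \<open>On a cube the average factor is at most L^(-G) X^D', because h >= L, and the
  \<open>i\<close>-th factor is at most S_i (C L X)^(\<gamma> i). As the \<gamma> i add up to
  \<open>G\<close>, the powers of \<open>L\<close> cancel and those of \<open>X\<close> combine to
  X^D, which leaves the bound for \<open>v\<close>.\<close>

lemma AR_const_new_weight_le: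
  fixes v :: "nat \<Rightarrow> real^'n \<Rightarrow> real"
  assumes v: "\<And>i. i \<in> {1..m} \<Longrightarrow> v i \<in> borel_measurable lebesgue" "\<And>i x. i \<in> {1..m} \<Longrightarrow> 0 < v i x"
    and h: "h \<in> borel_measurable lebesgue" "\<And>x. 0 < h x"
    and a: "cube_bound v a" and C: "0 < C"
    and hL: "\<And>c l. 0 < l \<Longrightarrow> \<exists>L>0. (AE x in lebesgue. x \<in> cube c l \<longrightarrow> L \<le> h x) \<and>
       (\<forall>s>0. ennreal s * emeasure lebesgue {x\<in>cube c l. s < h x * base v x}
          \<le> ennreal (C * L) * (\<integral>\<^sup>+x\<in>cube c l. ennreal (base v x) \<partial>lebesgue))"
  shows "AR_const m ps r (new_weight v h) \<le> ennreal (C powr G * a)"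
  unfolding AR_const_def
proof (rule SUP_least)
  fix Q :: "(real^'n) set" assume "Q \<in> cubes"
  then obtain c l where Q: "Q = cube c l" and l: "0 < l" by (auto simp: cubes_def)
  have Qs[measurable]: "Q \<in> sets lebesgue" by (simp add: Q)
  have mQ: "emeasure lebesgue Q = ennreal (l ^ CARD('n))" unfolding Q by (rule emeasure_cube(1)[OF l])
  have lpos: "0 < l ^ CARD('n)" using l by simp
  have bp: "0 < base v x" for x using v(2) by (intro base_pos)
  have bm: "base v \<in> borel_measurable lebesgue" using v(1) by (rule borel_measurable_base)
  obtain S X where SX: "\<And>i. i \<in> {1..m} \<Longrightarrow> 0 < S i"
      "\<And>i. i \<in> {1..m} \<Longrightarrow> AE x in lebesgue. x \<in> Q \<longrightarrow> v i x powr (- 1 / r i) \<le> S i" "0 < X"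
      "(\<integral>\<^sup>+x\<in>Q. ennreal (base v x) \<partial>lebesgue) = ennreal (X * l ^ CARD('n))"
      "X powr D * (\<Prod>i=1..m. S i) \<le> a"
    using a[unfolded cube_bound_def, rule_format, OF l, of c] unfolding Q by blast
  obtain L where L: "0 < L" "AE x in lebesgue. x \<in> Q \<longrightarrow> L \<le> h x"
     "\<And>s. 0 < s \<Longrightarrow> ennreal s * emeasure lebesgue {x\<in>Q. s < h x * base v x}
          \<le> ennreal (C * L) * (\<integral>\<^sup>+x\<in>Q. ennreal (base v x) \<partial>lebesgue)"
    using hL[OF l, of c] unfolding Q by blast
  define B where "B = C * L * X"
  have B: "0 < B" using C L SX by (simp add: B_def)
  have weak: "ennreal s * emeasure lebesgue {x\<in>Q. s < h x * base v x} \<le> ennreal (B * l ^ CARD('n))" if "0 < s" for s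
    using L(3)[OF that] C L(1) SX(3) lpos unfolding SX(4) by (simp add: B_def ennreal_mult[symmetric] mult.assoc)
  have first: "AR_average (new_weight v h) Q \<le> ennreal (L powr (- G) * X powr D')"
  proof -
    have "(\<integral>\<^sup>+ x\<in>Q. ennreal (prod_weight m ps (new_weight v h) x
              powr (delta_exp m ps r (m + 1) / total_exp m ps)) \<partial>lebesgue)
      \<le> (\<integral>\<^sup>+x. ennreal (L powr (- (G / D'))) * (ennreal (base v x) * indicator Q x) \<partial>lebesgue)"
    proof (rule nn_integral_mono_AE, use L(2) in \<open>rule eventually_mono\<close>)
      fix x assume Lx: "x \<in> Q \<longrightarrow> L \<le> h x"
      have "prod_weight m ps (new_weight v h) x powr (delta_exp m ps r (m + 1) / total_exp m ps)
         = h x powr (- (G / D')) * base v x"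
        unfolding delta_exp_eq(1) p_def[symmetric]
        using prod_weight_new_weight[of v h x] v(2) h(2) bp[of x] p_pos D'_pos
        by (simp add: powr_mult powr_powr)
      moreover have "h x powr (- (G / D')) \<le> L powr (- (G / D'))" if "x \<in> Q"
        using Lx that L(1) G_nonneg D'_pos by (intro powr_mono2') auto
      ultimately show "ennreal (prod_weight m ps (new_weight v h) x powr (delta_exp m ps r (m + 1) / total_exp m ps)) * indicator Q x
        \<le> ennreal (L powr (- (G / D'))) * (ennreal (base v x) * indicator Q x)"
        using bp[of x] by (auto split: split_indicator simp: ennreal_mult[symmetric] intro!: ennreal_leI mult_right_mono)
    qed
    also have "\<dots> = ennreal (L powr (- (G / D')) * X * l ^ CARD('n))"
      using bm SX(3,4) lpos by (subst nn_integral_cmult) (auto simp: ennreal_mult[symmetric] mult.assoc)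
    finally have "(\<integral>\<^sup>+ x\<in>Q. ennreal (prod_weight m ps (new_weight v h) x
              powr (delta_exp m ps r (m + 1) / total_exp m ps)) \<partial>lebesgue) / emeasure lebesgue Q
         \<le> ennreal (L powr (- (G / D')) * X * l ^ CARD('n)) / emeasure lebesgue Q"
      by (rule divide_right_mono_ennreal)
    also have "\<dots> = ennreal (L powr (- (G / D')) * X)"
      unfolding mQ using SX(3) lpos l by (subst divide_ennreal) auto
    finally have "AR_average (new_weight v h) Q
       \<le> ennreal (L powr (- (G / D')) * X) epowr (1 / delta_exp m ps r (m + 1))"
      unfolding delta_exp_eq(1) using D'_pos by (intro epowr_mono) auto
    also have "\<dots> = ennreal (L powr (- G) * X powr D')"
      unfolding delta_exp_eq(1) using D'_pos SX(3) by (simp add: epowr_ennreal powr_mult powr_powr)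
    finally show ?thesis .
  qed
  have factor: "AR_factor (new_weight v h) Q i \<le> ennreal (S i * B powr \<gamma> i)"
    if i: "i \<in> {1..m}" for i
  proof -
    have e: "new_weight v h i x powr (- 1 / ps i) = (h x * base v x) powr (\<gamma> i) * v i x powr (- 1 / r i)" for x
      using new_weight_powr[where v=v and h=h and i=i and s="-1" and x=x] v(2) h(2) i by simp
    have wm: "(\<lambda>x. ennreal (new_weight v h i x powr (- 1 / ps i))) \<in> borel_measurable lebesgue"
      using borel_measurable_new_weight[OF v(1) h(1) i] by measurable
    show ?thesis
    proof (cases "r i = ps i")
      case True
      \<comment> \<open>At this endpoint the power of \<open>h x * base v x\<close> in the weight is
        trivial, so the essential supremum is that of \<open>v\<close>.\<close>
      then have g0: "\<gamma> i = 0" by (simp add: \<gamma>_def)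
      have "esssup (restrict_space lebesgue Q) (\<lambda>x. ennreal (new_weight v h i x powr (- 1 / ps i))) \<le> ennreal (S i)"
      proof (rule esssup_I)
        show "(\<lambda>x. ennreal (new_weight v h i x powr (- 1 / ps i))) \<in> borel_measurable (restrict_space lebesgue Q)"
          using wm by (rule measurable_restrict_space1)
        have "AE x in lebesgue. x \<in> Q \<longrightarrow> ennreal (new_weight v h i x powr (- 1 / ps i)) \<le> ennreal (S i)"
          using SX(2)[OF i]
        proof (rule eventually_mono, intro impI)
          fix x assume "x \<in> Q \<longrightarrow> v i x powr (- 1 / r i) \<le> S i" "x \<in> Q"
          moreover have "h x * base v x \<noteq> 0" using h(2)[of x] bp[of x] by simp
          ultimately show "ennreal (new_weight v h i x powr (- 1 / ps i)) \<le> ennreal (S i)"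
            unfolding e g0 by (intro ennreal_leI) simp
        qed
        then show "AE x in restrict_space lebesgue Q. ennreal (new_weight v h i x powr (- 1 / ps i)) \<le> ennreal (S i)"
          by (subst AE_restrict_space_iff) auto
      qed
      then show ?thesis using True g0 B by simp
    next
      case False
      then have gp: "0 < \<gamma> i" using r_ps[OF i] by (auto simp: \<gamma>_def field_simps)
      have "weak_lorentz_norm (normalized_lebesgue Q) (1 / \<gamma> i)
                   (\<lambda>x. indicator Q x * new_weight v h i x powr (- 1 / ps i)) \<le> ennreal (S i * B powr \<gamma> i)"
        unfolding Q
      proof (rule weak_factor_le[OF gp SX(1)[OF i] B l h(1) bm h(2) bp])
        show "AE x in lebesgue. x \<in> cube c l \<longrightarrow>
           \<bar>new_weight v h i x powr (- 1 / ps i)\<bar> \<le> (h x * base v x) powr \<gamma> i * S i"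
          using SX(2)[OF i] unfolding Q e by (auto elim!: eventually_mono intro!: mult_left_mono simp: abs_mult)
        show "ennreal s * emeasure lebesgue {x \<in> cube c l. s < h x * base v x} \<le> ennreal (B * l ^ CARD('n))"
          if "0 < s" for s using weak[OF that] unfolding Q .
      qed
      then show ?thesis using False i by (simp add: delta_exp_eq(3))
    qed
  qed
  have "AR_average (new_weight v h) Q
        * (\<Prod>i=1..m.
            AR_factor (new_weight v h) Q i)
     \<le> ennreal (L powr (- G) * X powr D') * (\<Prod>i=1..m. ennreal (S i * B powr \<gamma> i))"
    by (intro mult_mono first prod_mono_ennreal factor) auto
  also have "(\<Prod>i=1..m. ennreal (S i * B powr \<gamma> i)) = ennreal ((\<Prod>i=1..m. S i) * B powr G)"
  proof -
    have "(\<Prod>i=1..m. ennreal (S i * B powr \<gamma> i)) = ennreal (\<Prod>i=1..m. S i * B powr \<gamma> i)"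
      by (intro prod_ennreal_eq mult_nonneg_nonneg less_imp_le[OF SX(1)] powr_ge_zero finite_atLeastAtMost)
    then show ?thesis using B by (simp add: prod.distrib prod_powr_right G_def)
  qed
  also have "ennreal (L powr (- G) * X powr D') * ennreal ((\<Prod>i=1..m. S i) * B powr G)
    = ennreal ((L powr (- G) * X powr D') * ((\<Prod>i=1..m. S i) * B powr G))"
    using SX(1) by (intro ennreal_mult[symmetric] mult_nonneg_nonneg prod_nonneg) (auto intro: less_imp_le)
  also have "(L powr (- G) * X powr D') * ((\<Prod>i=1..m. S i) * B powr G) = C powr G * (X powr D * (\<Prod>i=1..m. S i))"
  proof -
    have "B powr G = C powr G * L powr G * X powr G" by (simp add: B_def powr_mult)
    moreover have "X powr D = X powr D' * X powr G" by (simp add: D_eq powr_add)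
    moreover have "L powr (- G) * L powr G = 1" using L(1) by (simp add: powr_add[symmetric])
    ultimately show ?thesis by (simp add: mult_ac)
  qed
  also have "ennreal \<dots> \<le> ennreal (C powr G * a)"
    using SX(5) by (intro ennreal_leI mult_left_mono) auto
  finally show "AR_average (new_weight v h) Q
        * (\<Prod>i=1..m.
            AR_factor (new_weight v h) Q i) \<le> ennreal (C powr G * a)" .
qed

text \<open>The function \<open>\<phi>\<close> is monotone on the positive numbers only; its value at 0 is arbitrary.\<close>
lemma AR_const_pos:
  fixes w :: "nat \<Rightarrow> real^'n \<Rightarrow> real"
  assumes w: "\<And>i. i \<in> {1..m} \<Longrightarrow> w i \<in> borel_measurable lebesgue" "\<And>i x. i \<in> {1..m} \<Longrightarrow> 0 < w i x"
  shows "0 < AR_const m ps r w"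
proof -
  define Q :: "(real^'n) set" where "Q = cube 0 1"
  have Qs[measurable]: "Q \<in> sets lebesgue" by (simp add: Q_def)
  have mQ: "emeasure lebesgue Q = 1" unfolding Q_def by (subst emeasure_cube(1)) auto
  have Qc: "Q \<in> cubes" unfolding cubes_def Q_def by (auto intro!: exI[of _ "0::real^'n"] exI[of _ "1::real"])
  have nonnull: False if "AE x in lebesgue. x \<notin> Q"
    using that cube_not_null[of 1 "0::real^'n"] unfolding Q_def by simp
  have pw: "0 < prod_weight m ps w x" for x
    unfolding prod_weight_def by (rule prod_pos) (metis less_irrefl powr_gt_zero w(2))
  have pm[measurable]: "prod_weight m ps w \<in> borel_measurable lebesgue"
    using w(1) by (rule borel_measurable_prod_weight)
  have "0 < (\<integral>\<^sup>+ x\<in>Q. ennreal (prod_weight m ps w x powr (delta_exp m ps r (m + 1) / total_exp m ps)) \<partial>lebesgue)"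
  proof (rule ccontr)
    assume "\<not> ?thesis"
    then have "AE x in lebesgue. ennreal (prod_weight m ps w x powr (delta_exp m ps r (m + 1) / total_exp m ps)) * indicator Q x = 0"
      by (subst nn_integral_0_iff_AE[symmetric]) auto
    then have "AE x in lebesgue. x \<notin> Q"
      by (rule eventually_mono) (use pw in \<open>auto split: split_indicator_asm simp: less_imp_neq[symmetric]\<close>)
    then show False by (rule nonnull)
  qed
  then have first: "0 < AR_average w Q"
    by (intro epowr_pos) (simp add: mQ ennreal_zero_less_divide)
  have factor: "0 < AR_factor w Q i" (is "0 < ?F i")
    if i: "i \<in> {1..m}" for i
  proof (rule ccontr)
    assume "\<not> 0 < ?F i"
    then have F0: "?F i = 0" by simp
    have wp: "0 < w i x powr (- 1 / ps i)" for x using w(2)[OF i, of x] by simp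
    have "AE x in lebesgue. x \<notin> Q"
    proof (cases "r i = ps i")
      case True
      then have "esssup (restrict_space lebesgue Q) (\<lambda>x. ennreal (w i x powr (- 1 / ps i))) = 0" using F0 by simp
      then have "AE x in restrict_space lebesgue Q. ennreal (w i x powr (- 1 / ps i)) \<le> 0"
        using esssup_AE[of "\<lambda>x. ennreal (w i x powr (- 1 / ps i))" "restrict_space lebesgue Q"] by simp
      then have "AE x in lebesgue. x \<in> Q \<longrightarrow> ennreal (w i x powr (- 1 / ps i)) \<le> 0"
        by (subst (asm) AE_restrict_space_iff) auto
      then show ?thesis
        by (rule eventually_mono) (use wp in \<open>auto simp: ennreal_eq_0_iff not_le[symmetric]\<close>)
    next
      case False
      have z: "weak_lorentz_norm (normalized_lebesgue Q) (delta_exp m ps r i)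
                   (\<lambda>x. indicator Q x * w i x powr (- 1 / ps i)) = 0" using F0 False by simp
      \<comment> \<open>A vanishing weak norm makes every superlevel set null; the countably many
        thresholds 1/(k+1) then exclude positive values almost everywhere on
        \<open>Q\<close>.\<close>
      have "AE x in lebesgue. x \<in> Q \<longrightarrow> w i x powr (- 1 / ps i) \<le> 1 / real (Suc k)" for k
      proof -
        define t where "t = 1 / real (Suc k)"
        have t: "0 < t" by (simp add: t_def)
        define Z where "Z = {x\<in>Q. t < w i x powr (- 1 / ps i)}"
        have Zs: "Z \<in> sets lebesgue" unfolding Z_def
          by (rule sets_lebesgue_Collect_in[OF Qs]) (use w(1)[OF i] in measurable)
        have "ennreal t * emeasure (normalized_lebesgue Q) {x \<in> space (normalized_lebesgue Q).
            t < norm (indicator Q x * w i x powr (- 1 / ps i))} epowr (1 / delta_exp m ps r i) \<le> 0"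
          unfolding z[symmetric] weak_lorentz_norm_def using t by (intro SUP_upper) auto
        then have "emeasure (normalized_lebesgue Q) {x \<in> space (normalized_lebesgue Q).
            t < norm (indicator Q x * w i x powr (- 1 / ps i))} epowr (1 / delta_exp m ps r i) = 0"
          using t by (auto simp: ennreal_eq_0_iff)
        then have "emeasure (normalized_lebesgue Q) {x \<in> space (normalized_lebesgue Q).
            t < norm (indicator Q x * w i x powr (- 1 / ps i))} = 0"
          by (simp only: epowr_eq_0_iff)
        moreover have "{x \<in> space (normalized_lebesgue Q). t < norm (indicator Q x * w i x powr (- 1 / ps i))} = Z"
          using t by (auto simp: Z_def normalized_lebesgue_def space_scale_measure abs_mult split: split_indicator)
        ultimately have "emeasure lebesgue Z = 0" by (simp add: normalized_lebesgue_def mQ)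
        then have "AE x in lebesgue. x \<notin> Z" using Zs by (intro AE_not_in) (auto simp: null_sets_def)
        then show ?thesis by (auto simp: Z_def t_def elim!: eventually_mono)
      qed
      then have "AE x in lebesgue. \<forall>k. x \<in> Q \<longrightarrow> w i x powr (- 1 / ps i) \<le> 1 / real (Suc k)"
        by (subst AE_all_countable) auto
      then show ?thesis
      proof (rule eventually_mono, intro notI)
        fix x assume *: "\<forall>k. x \<in> Q \<longrightarrow> w i x powr (- 1 / ps i) \<le> 1 / real (Suc k)" "x \<in> Q"
        obtain k where "inverse (real (Suc k)) < w i x powr (- 1 / ps i)"
          using reals_Archimedean[OF wp[of x]] by auto
        then show False using * by (auto simp: inverse_eq_divide not_less[symmetric])
      qed
    qed
    then show False by (rule nonnull)
  qed
  have "0 < (\<Prod>i=1..m. ?F i)"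
    by (rule prod_pos_ennreal) (rule factor)
  then have "0 < AR_average w Q * (\<Prod>i=1..m. ?F i)"
    using first by (simp only: ennreal_zero_less_mult_iff)
  also have "\<dots> \<le> AR_const m ps r w"
    unfolding AR_const_def by (rule SUP_upper[OF Qc])
  finally show ?thesis .
qed

end

section \<open>The weak type estimate\<close>

lemma sigma_finite_weight_measure:
  assumes "v \<in> borel_measurable lebesgue"
  shows "sigma_finite_measure (weight_measure v)"
proof -
  interpret sigma_finite_measure "lebesgue :: (real^'n) measure" by (rule sigma_finite_lebesgue)
  show ?thesis
    unfolding weight_measure_def using assms by (subst sigma_finite_iff_density_finite) auto
qed

lemma sets_weight_measure [simp, measurable_cong]: "sets (weight_measure v) = sets lebesgue"
  and space_weight_measure [simp]: "space (weight_measure v) = UNIV"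
  by (simp_all add: weight_measure_def)

lemma ennreal_le_of_mult_epowr:
  assumes "ennreal t * e epowr (1 / q) \<le> ennreal Y" "0 < t" "0 < q" "0 \<le> Y"
  shows "e \<le> ennreal ((Y / t) powr q)"
proof -
  have "ennreal (1 / t) * (ennreal t * e epowr (1 / q)) \<le> ennreal (1 / t) * ennreal Y"
    using assms(1) by (rule mult_left_mono) simp
  moreover have "ennreal (1 / t) * (ennreal t * Z) = Z" for Z
    using assms(2) by (simp add: mult.assoc[symmetric] ennreal_mult[symmetric] del: ennreal_1) simp
  moreover have "ennreal (1 / t) * ennreal Y = ennreal (Y / t)"
    using assms by (simp add: ennreal_mult[symmetric])
  ultimately have "e epowr (1 / q) \<le> ennreal (Y / t)" by simp
  then have "(e epowr (1 / q)) epowr q \<le> ennreal (Y / t) epowr q"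
    using assms by (intro epowr_mono) auto
  then show ?thesis using assms by (simp add: epowr_epowr epowr_ennreal)
qed

section \<open>From the new weights back to the original ones\<close>

context exponents
begin

text \<open>The level set of \<open>g\<close> is split at h \<omega>^\<beta> = s. Where this
  quantity is large, the mixed inequality bounds the measure by M/s. Elsewhere the product weight of
  \<open>v\<close> is at most s^(p G) times that of the new weight, for which the weak norm of
  \<open>g\<close> is known.\<close>

lemma weak_norm_transfer:
  fixes v :: "nat \<Rightarrow> real^'n \<Rightarrow> real" and g :: "real^'n \<Rightarrow> complex"
  assumes v: "\<And>i. i \<in> {1..m} \<Longrightarrow> v i \<in> borel_measurable lebesgue" "\<And>i x. i \<in> {1..m} \<Longrightarrow> 0 < v i x"
    and h: "h \<in> borel_measurable lebesgue" "\<And>x. 0 < h x" and g: "g \<in> borel_measurable lebesgue"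
    and mixed: "\<And>s. 0 < s \<Longrightarrow> ennreal s * emeasure (weight_measure (prod_weight m r v))
        {x. s < h x * base v x powr (1 - \<rho> * D)} \<le> ennreal M" and M: "0 \<le> M"
    and Y: "0 < Y" "weak_lorentz_norm (weight_measure (prod_weight m ps (new_weight v h))) p g \<le> ennreal Y"
  shows "weak_lorentz_norm (weight_measure (prod_weight m r v)) \<rho> g \<le> ennreal ((M + 1) powr (1 / \<rho>) * Y)"
  unfolding weak_lorentz_norm_def
proof (rule SUP_least)
  fix t :: real assume "t \<in> {0<..}"
  then have t: "0 < t" by simp
  define Mw where "Mw = weight_measure (prod_weight m ps (new_weight v h))"
  define Mv where "Mv = weight_measure (prod_weight m r v)"
  define E where "E = {x. t < norm (g x)}"
  define X where "X = Y / t"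
  have X: "0 < X" using Y t by (simp add: X_def)
  have bp: "0 < base v x" for x using v(2) by (intro base_pos)
  have bm[measurable]: "base v \<in> borel_measurable lebesgue" using v(1) by (rule borel_measurable_base)
  have Es: "E \<in> sets lebesgue"
  proof -
    have "E = {x\<in>space lebesgue. t < norm (g x)}" by (simp add: E_def)
    also have "\<dots> \<in> sets lebesgue" using g by measurable
    finally show ?thesis .
  qed
  have "ennreal t * emeasure Mw E epowr (1 / p) \<le> ennreal Y"
    using Y(2) t unfolding weak_lorentz_norm_def Mw_def E_def by (auto simp: SUP_le_iff)
  then have Mw: "emeasure Mw E \<le> ennreal (X powr p)"
    unfolding X_def using t p_pos Y(1) by (intro ennreal_le_of_mult_epowr) auto
  \<comment> \<open>This choice balances the two parts: M/s = M X^\<rho>, and since \<rho> p G = p -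
    \<rho>, the other part s^(p G) X^p is also X^\<rho>.\<close>
  define s where "s = X powr (- \<rho>)"
  have s: "0 < s" using X by (simp add: s_def)
  define Z where "Z = {x. s < h x * base v x powr (1 - \<rho> * D)}"
  have Zs: "Z \<in> sets lebesgue"
  proof -
    have "Z = {x\<in>space lebesgue. s < h x * base v x powr (1 - \<rho> * D)}" by (simp add: Z_def)
    also have "\<dots> \<in> sets lebesgue" using h by measurable
    finally show ?thesis .
  qed
  have Z: "emeasure Mv Z \<le> ennreal (M * X powr \<rho>)"
  proof -
    have "ennreal s * emeasure Mv Z epowr (1 / 1) \<le> ennreal M"
      using mixed[OF s] by (simp add: Z_def Mv_def)
    then have "emeasure Mv Z \<le> ennreal ((M / s) powr 1)"
      using s M by (intro ennreal_le_of_mult_epowr) auto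
    then show ?thesis using M X by (simp add: s_def powr_minus field_simps)
  qed
  have pointwise: "prod_weight m r v x \<le> X powr (- (\<rho> * (p * G))) * prod_weight m ps (new_weight v h) x"
    if "x \<notin> Z" for x
  proof -
    define b where "b = base v x"
    have b: "0 < b" using bp by (simp add: b_def)
    have "h x * b powr (1 - \<rho> * D) \<le> s" using that by (simp add: Z_def b_def not_less)
    then have "h x \<le> s * b powr (\<rho> * D - 1)"
      using b by (simp add: powr_diff field_simps)
    then have "(s * b powr (\<rho> * D - 1)) powr (- (p * G)) \<le> h x powr (- (p * G))"
      using h(2)[of x] p_pos G_nonneg by (intro powr_mono2') auto
    then have "(s * b powr (\<rho> * D - 1)) powr (- (p * G)) * b powr (p * D') \<le> h x powr (- (p * G)) * b powr (p * D')"
      by (rule mult_right_mono) simp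
    also have "h x powr (- (p * G)) * b powr (p * D') = prod_weight m ps (new_weight v h) x"
      unfolding b_def by (rule prod_weight_new_weight[symmetric]) (use v h in auto)
    also have "(s * b powr (\<rho> * D - 1)) powr (- (p * G)) * b powr (p * D')
       = s powr (- (p * G)) * b powr ((\<rho> * D - 1) * (- (p * G)) + p * D')"
      by (simp add: powr_mult powr_powr mult.assoc flip: powr_add)
    \<comment> \<open>This identity dictates \<beta> = 1 - \<rho> D: with it, the power of
      \<open>base v\<close> left over on the set where \<open>h\<close> is controlled is exactly the
      one in the original product weight.\<close>
    also have "(\<rho> * D - 1) * (- (p * G)) + p * D' = \<rho> * D"
    proof -
      have "p * G = p / \<rho> - 1" using p_pos by (simp add: G_eq right_diff_distrib)
      then have e: "\<rho> * (p * G) = p - \<rho>" using rho_pos by (simp add: right_diff_distrib)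
      have "(\<rho> * D - 1) * (- (p * G)) + p * D' = - (D * (\<rho> * (p * G))) + p * (G + D')"
        by (simp add: algebra_simps)
      also have "\<dots> = - (D * (p - \<rho>)) + p * (G + D')" by (simp only: e)
      also have "\<dots> = \<rho> * D" unfolding add.commute[of G] D_eq[symmetric] by (simp add: algebra_simps)
      finally show ?thesis .
    qed
    also have "b powr (\<rho> * D) = prod_weight m r v x"
      unfolding b_def prod_weight_r using V_eq_base[of v h x] v(2) h(2) by (simp add: powr_powr mult.commute)
    finally have "s powr (- (p * G)) * prod_weight m r v x \<le> prod_weight m ps (new_weight v h) x" .
    then have "X powr (- (\<rho> * (p * G))) * (s powr (- (p * G)) * prod_weight m r v x)
       \<le> X powr (- (\<rho> * (p * G))) * prod_weight m ps (new_weight v h) x"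
      by (rule mult_left_mono) simp
    moreover have "X powr (- (\<rho> * (p * G))) * s powr (- (p * G)) = 1"
      using X by (simp add: s_def powr_powr powr_add[symmetric])
    ultimately show ?thesis by (simp add: mult.assoc[symmetric])
  qed
  have rest: "emeasure Mv (E - Z) \<le> ennreal (X powr \<rho>)"
  proof -
    have pm: "prod_weight m r v \<in> borel_measurable lebesgue"
      "prod_weight m ps (new_weight v h) \<in> borel_measurable lebesgue"
      using v(1) h(1) by (auto intro!: borel_measurable_prod_weight borel_measurable_new_weight)
    note [measurable] = pm Es Zs
    have "emeasure Mv (E - Z) = (\<integral>\<^sup>+x. ennreal (prod_weight m r v x) * indicator (E - Z) x \<partial>lebesgue)"
      unfolding Mv_def weight_measure_def by (subst emeasure_density) auto
    also have "\<dots> \<le> (\<integral>\<^sup>+x. ennreal (X powr (- (\<rho> * (p * G)))) *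
        (ennreal (prod_weight m ps (new_weight v h) x) * indicator E x) \<partial>lebesgue)"
    proof (rule nn_integral_mono)
      fix x
      have "0 \<le> prod_weight m ps (new_weight v h) x" by (simp add: prod_weight_def prod_nonneg)
      then show "ennreal (prod_weight m r v x) * indicator (E - Z) x
        \<le> ennreal (X powr (- (\<rho> * (p * G)))) * (ennreal (prod_weight m ps (new_weight v h) x) * indicator E x)"
        using pointwise[of x] by (auto split: split_indicator simp: ennreal_mult[symmetric] intro!: ennreal_leI)
    qed
    also have "\<dots> = ennreal (X powr (- (\<rho> * (p * G)))) * emeasure Mw E"
      unfolding Mw_def weight_measure_def by (subst nn_integral_cmult, measurable, subst emeasure_density) auto
    also have "\<dots> \<le> ennreal (X powr (- (\<rho> * (p * G)))) * ennreal (X powr p)"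
      by (intro mult_left_mono Mw) simp
    also have "\<dots> = ennreal (X powr (- (\<rho> * (p * G)) + p))"
      by (subst ennreal_mult[symmetric]) (simp_all only: powr_add powr_ge_zero)
    also have "- (\<rho> * (p * G)) + p = \<rho>"
      using p_pos rho_pos by (simp add: G_eq field_simps)
    finally show ?thesis .
  qed
  have "emeasure Mv E \<le> emeasure Mv (Z \<union> (E - Z))"
    using Es Zs by (intro emeasure_mono) (auto simp: Mv_def)
  also have "\<dots> \<le> emeasure Mv Z + emeasure Mv (E - Z)"
    using Es Zs by (intro emeasure_subadditive) (auto simp: Mv_def)
  also have "\<dots> \<le> ennreal (M * X powr \<rho>) + ennreal (X powr \<rho>)"
    by (intro add_mono Z rest)
  also have "\<dots> = ennreal ((M + 1) * X powr \<rho>)"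
    using M by (simp add: ennreal_plus[symmetric] distrib_right del: ennreal_plus)
  finally have "emeasure Mv E epowr (1 / \<rho>) \<le> ennreal ((M + 1) * X powr \<rho>) epowr (1 / \<rho>)"
    using rho_pos by (intro epowr_mono) auto
  also have "\<dots> = ennreal ((M + 1) powr (1 / \<rho>) * X)"
    using M X rho_pos by (simp add: epowr_ennreal powr_mult powr_powr)
  finally have "ennreal t * emeasure Mv E epowr (1 / \<rho>) \<le> ennreal t * ennreal ((M + 1) powr (1 / \<rho>) * X)"
    by (rule mult_left_mono) simp
  also have "\<dots> = ennreal ((M + 1) powr (1 / \<rho>) * Y)"
    using t Y(1) by (subst ennreal_mult[symmetric]) (auto simp: X_def)
  finally show "ennreal t * emeasure (weight_measure (prod_weight m r v))
      {x \<in> space (weight_measure (prod_weight m r v)). t < norm (g x)} epowr (1 / \<rho>)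
     \<le> ennreal ((M + 1) powr (1 / \<rho>) * Y)"
    by (simp add: Mv_def E_def)
qed

section \<open>Constants uniform in the weights and functions\<close>

abbreviation start_norm where
  "start_norm \<alpha> (f :: nat \<Rightarrow> real^'n \<Rightarrow> complex) w i \<equiv> lorentz_norm (weight_measure (w i)) (ps i) (\<alpha> i) (f i)"

abbreviation end_norm where
  "end_norm \<alpha> (f :: nat \<Rightarrow> real^'n \<Rightarrow> complex) v i \<equiv>
    lorentz_norm (weight_measure (v i)) (r i) (\<alpha> i * r i / ps i) (f i)"

definition hypothesis ::
    "(nat \<Rightarrow> real) \<Rightarrow> (real \<Rightarrow> real) \<Rightarrow> (nat \<Rightarrow> real^'n \<Rightarrow> complex) \<Rightarrow> (real^'n \<Rightarrow> complex) \<Rightarrow> bool" where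
  "hypothesis \<alpha> \<phi> f g \<longleftrightarrow> (\<forall>w \<in> AR_class m ps r.
        weak_lorentz_norm (weight_measure (prod_weight m ps w)) (total_exp m ps) g
        \<le> ennreal (\<phi> (enn2real (AR_const m ps r w))) *
           norm_prod (\<lambda>i. start_norm \<alpha> f w i) {1..m})"

text \<open>The norms of the f_i enter through positive upper bounds c_i, by which one can divide
  even if a norm vanishes. The constant \<Psi> is fixed before the weights and the
  functions.\<close>

lemma weak_type_positive:
  fixes a :: real and \<alpha> :: "nat \<Rightarrow> real" and \<phi> :: "real \<Rightarrow> real"
  assumes a: "1 \<le> a" and \<alpha>: "\<And>i. i \<in> {1..m} \<Longrightarrow> 0 < \<alpha> i \<and> \<alpha> i \<le> ps i"
    and \<phi>: "\<And>t. 0 < t \<Longrightarrow> 0 < \<phi> t" "mono_on {0<..} \<phi>"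
  shows "\<exists>\<Psi>>0. \<forall>(v :: nat \<Rightarrow> real^'n \<Rightarrow> real) f g c.
    (\<forall>i\<in>{1..m}. v i \<in> borel_measurable lebesgue \<and> (\<forall>x. 0 < v i x) \<and> f i \<in> borel_measurable lebesgue \<and> 0 < c i \<and>
       end_norm \<alpha> f v i \<le> ennreal (c i)) \<longrightarrow>
    g \<in> borel_measurable lebesgue \<longrightarrow> cube_bound v a \<longrightarrow> hypothesis \<alpha> \<phi> f g \<longrightarrow>
    weak_lorentz_norm (weight_measure (prod_weight m r v)) \<rho> g \<le> ennreal (\<Psi> * (\<Prod>i=1..m. c i))"
proof -
  define A where "A = a powr (1 / D)"
  \<comment> \<open>Taken from the locale, these constants depend on the dimension and
    \<open>A\<close> only, so they are the same for every \<open>v\<close> with bound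
    \<open>a\<close>.\<close>
  define CM where "CM = A1_weight.CM TYPE('n) A"
  define CQ where "CQ = A1_weight.CQ TYPE('n) A"
  \<comment> \<open>Each of the \<open>m\<close> terms of \<open>k\<close> below has integral at
    most 1; the additional 1 is the one of \<open>A1_majorant\<close>.\<close>
  define M where "M = CM * (real m + 1)"
  define T where "T = ((CM + 1) * CQ) powr G * a"
  define q where "q = (\<Prod>i=1..m. (ps i / r i) powr (1 / \<alpha> i))"
  \<comment> \<open>The positivity of \<open>CM\<close> and \<open>CQ\<close> is known only once a
    weight is given. The maximum with 1 makes \<Psi> positive beforehand.\<close>
  define \<Psi> where "\<Psi> = max 1 ((M + 1) powr (1 / \<rho>) * (\<phi> T * q))"
  have q: "0 < q" unfolding q_def
  proof (rule prod_pos)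
    fix i assume "i \<in> {1..m}"
    then show "0 < (ps i / r i) powr (1 / \<alpha> i)" using ps_pos[of i] r_pos[of i] by simp
  qed
  show ?thesis
  proof (intro exI[of _ \<Psi>] conjI allI impI)
    show "0 < \<Psi>" by (simp add: \<Psi>_def)
    fix v :: "nat \<Rightarrow> real^'n \<Rightarrow> real" and f g c
    assume all: "\<forall>i\<in>{1..m}. v i \<in> borel_measurable lebesgue \<and> (\<forall>x. 0 < v i x) \<and> f i \<in> borel_measurable lebesgue \<and> 0 < c i \<and>
       end_norm \<alpha> f v i \<le> ennreal (c i)"
      and g: "g \<in> borel_measurable lebesgue" and cb: "cube_bound v a" and hyp: "hypothesis \<alpha> \<phi> f g"
    have v: "\<And>i. i \<in> {1..m} \<Longrightarrow> v i \<in> borel_measurable lebesgue" "\<And>i x. i \<in> {1..m} \<Longrightarrow> 0 < v i x"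
      and f: "\<And>i. i \<in> {1..m} \<Longrightarrow> f i \<in> borel_measurable lebesgue"
      and c: "\<And>i. i \<in> {1..m} \<Longrightarrow> 0 < c i"
      and N: "\<And>i. i \<in> {1..m} \<Longrightarrow> end_norm \<alpha> f v i \<le> ennreal (c i)"
      using all by blast+
    interpret A1: A1_weight "base v" A
      unfolding A_def by (rule A1_weight_base[OF v cb a])
    have CM: "0 < CM" and CQ: "0 < CQ" using A1.CM_pos A1.CQ_pos by (simp_all add: CM_def CQ_def)
    have M: "0 < M" using CM by (simp add: M_def)
    have T: "0 < T" using CM CQ a by (simp add: T_def)
    define k where "k x = (\<Sum>i=1..m. norm (f i x) powr r i * v i x / c i powr r i)" for x
    have term_nonneg: "0 \<le> norm (f i x) powr r i * v i x / c i powr r i" if "i \<in> {1..m}" for i x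
      using v(2)[OF that, of x] by simp
    have km: "k \<in> borel_measurable lebesgue"
      unfolding k_def[abs_def]
    proof (rule borel_measurable_sum)
      fix i assume i: "i \<in> {1..m}"
      note [measurable] = v(1)[OF i] f[OF i]
      show "(\<lambda>x. norm (f i x) powr r i * v i x / c i powr r i) \<in> borel_measurable lebesgue"
        by measurable
    qed
    have k0: "0 \<le> k x" for x unfolding k_def by (intro sum_nonneg term_nonneg)
    have kint: "(\<integral>\<^sup>+x. ennreal (k x) \<partial>lebesgue) \<le> ennreal (real m)"
    proof -
      have one: "(\<integral>\<^sup>+x. ennreal (norm (f i x) powr r i * v i x / c i powr r i) \<partial>lebesgue) \<le> 1" if i: "i \<in> {1..m}" for i
      proof -
        note [measurable] = v(1)[OF i] f[OF i]
        \<comment> \<open>Here \<alpha> i <= ps i is used: it gives q' <= r i, so the Lorentz norm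
          controls the integral of |f_i|^(r_i) v_i.\<close>
        define q' where "q' = \<alpha> i * r i / ps i"
        have q': "0 < q'" "q' \<le> r i"
          using \<alpha>[OF i] r_pos[OF i] ps_pos[OF i] by (auto simp: q'_def field_simps)
        have "(\<integral>\<^sup>+x. ennreal (norm (f i x) powr r i * v i x / c i powr r i) \<partial>lebesgue)
          = (\<integral>\<^sup>+x. ennreal (1 / c i powr r i) * (ennreal (v i x) * ennreal (norm (f i x) powr r i)) \<partial>lebesgue)"
          using v(2)[OF i] by (intro nn_integral_cong) (simp add: ennreal_mult[symmetric] less_imp_le mult.commute)
        also have "\<dots> = ennreal (1 / c i powr r i) * (\<integral>\<^sup>+x. ennreal (v i x) * ennreal (norm (f i x) powr r i) \<partial>lebesgue)"
          by (rule nn_integral_cmult) measurable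
        also have "(\<integral>\<^sup>+x. ennreal (v i x) * ennreal (norm (f i x) powr r i) \<partial>lebesgue)
          = (\<integral>\<^sup>+x. ennreal (norm (f i x) powr r i) \<partial>weight_measure (v i))"
          unfolding weight_measure_def by (rule nn_integral_density[symmetric]) measurable
        also have "\<dots> \<le> lorentz_norm (weight_measure (v i)) (r i) q' (f i) epowr r i"
          using q' sigma_finite_weight_measure[OF v(1)[OF i]] by (intro nn_integral_le_lorentz) auto
        also have "\<dots> \<le> ennreal (c i) epowr r i"
          using N[OF i] r_pos[OF i] by (intro epowr_mono) (auto simp: q'_def)
        also have "ennreal (1 / c i powr r i) * (ennreal (c i) epowr r i) = 1"
          using c[OF i] by (simp add: epowr_ennreal ennreal_mult[symmetric])
        finally show ?thesis by (simp add: mult_left_mono)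
      qed
      have "(\<integral>\<^sup>+x. ennreal (k x) \<partial>lebesgue) = (\<integral>\<^sup>+x. (\<Sum>i=1..m. ennreal (norm (f i x) powr r i * v i x / c i powr r i)) \<partial>lebesgue)"
        unfolding k_def by (intro nn_integral_cong sum_ennreal[symmetric] term_nonneg)
      also have "\<dots> = (\<Sum>i=1..m. \<integral>\<^sup>+x. ennreal (norm (f i x) powr r i * v i x / c i powr r i) \<partial>lebesgue)"
      proof (rule nn_integral_sum)
        fix i assume i: "i \<in> {1..m}"
        note [measurable] = v(1)[OF i] f[OF i]
        show "(\<lambda>x. ennreal (norm (f i x) powr r i * v i x / c i powr r i)) \<in> borel_measurable lebesgue"
          by measurable
      qed
      also have "\<dots> \<le> (\<Sum>i=1..m. 1)" by (intro sum_mono one)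
      finally show ?thesis by (simp add: ennreal_of_nat_eq_real_of_nat)
    qed
    obtain h where h: "h \<in> borel_measurable lebesgue" "\<And>x. 0 < h x"
      "AE x in lebesgue. k x \<le> h x * base v x"
      "\<And>b l. 0 < l \<Longrightarrow> \<exists>L>0. (AE x in lebesgue. x \<in> cube b l \<longrightarrow> L \<le> h x) \<and>
         (\<forall>s>0. ennreal s * emeasure lebesgue {x\<in>cube b l. s < h x * base v x}
            \<le> ennreal ((CM + 1) * CQ * L) * emeasure A1.\<nu> (cube b l))"
      "\<And>s \<beta>. 0 < s \<Longrightarrow> 0 \<le> \<beta> \<Longrightarrow> \<beta> \<le> 1 \<Longrightarrow>
         ennreal s * emeasure (A1.mixed \<beta>) {x. s < h x * base v x powr \<beta>} \<le> ennreal M"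
      using A1.A1_majorant[OF km k0 kint] unfolding CM_def[symmetric] CQ_def[symmetric] M_def by auto
    define w where "w = new_weight v h"
    have wm: "w i \<in> borel_measurable lebesgue" and wpos: "0 < w i x" if "i \<in> {1..m}" for i x
      unfolding w_def using that v h by (auto intro!: borel_measurable_new_weight new_weight_pos)
    have AR: "AR_const m ps r w \<le> ennreal T"
      unfolding w_def T_def
    proof (rule AR_const_new_weight_le[OF v h(1,2) cb])
      show "0 < (CM + 1) * CQ" using CM CQ by simp
      show "\<exists>L>0. (AE x in lebesgue. x \<in> cube b l \<longrightarrow> L \<le> h x) \<and>
         (\<forall>s>0. ennreal s * emeasure lebesgue {x\<in>cube b l. s < h x * base v x}
            \<le> ennreal ((CM + 1) * CQ * L) * (\<integral>\<^sup>+x\<in>cube b l. ennreal (base v x) \<partial>lebesgue))"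
        if "0 < l" for b l
        using h(4)[OF that, of b] A1.emeasure_nu[of "cube b l"] by simp
    qed
    have "0 < AR_const m ps r w" using wm wpos by (intro AR_const_pos)
    then have ARr: "0 < enn2real (AR_const m ps r w)" "enn2real (AR_const m ps r w) \<le> T"
      using AR T by (auto simp: enn2real_positive_iff enn2real_leI order_le_less_trans[OF AR])
    have wclass: "w \<in> AR_class m ps r"
      using wm wpos AR by (auto simp: AR_class_def is_weight_def intro: order_le_less_trans)
    have lor: "start_norm \<alpha> f w i \<le> ennreal ((ps i / r i) powr (1 / \<alpha> i) * c i)"
      if i: "i \<in> {1..m}" for i
      unfolding weight_measure_def
    proof (rule lorentz_norm_reweight[where v = "v i"])
      show "sigma_finite_measure (density lebesgue (\<lambda>x. ennreal (v i x)))"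
        using sigma_finite_weight_measure[OF v(1)[OF i]] by (simp add: weight_measure_def)
      show "lorentz_norm (density lebesgue (\<lambda>x. ennreal (v i x))) (r i) (\<alpha> i * r i / ps i) (f i) \<le> ennreal (c i)"
        using N[OF i] by (simp add: weight_measure_def)
      show "(\<lambda>x. norm (f i x)) \<in> borel_measurable lebesgue" using f[OF i] by measurable
      show "AE x in lebesgue. f i x \<noteq> 0 \<longrightarrow> w i x \<le> v i x * (c i / norm (f i x)) powr (ps i - r i)"
        using h(3)
      proof (rule eventually_mono, intro impI)
        fix x assume kx: "k x \<le> h x * base v x" and fx: "f i x \<noteq> 0"
        define y where "y = h x * base v x"
        have vx: "0 < v i x" using v(2)[OF i] .
        have u: "0 < norm (f i x)" using fx by simp
        have "norm (f i x) powr r i * v i x / c i powr r i \<le> k x"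
          unfolding k_def using i term_nonneg by (intro member_le_sum) auto
        then have ky: "norm (f i x) powr r i * v i x / c i powr r i \<le> y" using kx by (simp add: y_def)
        have z: "0 < norm (f i x) powr r i * v i x / c i powr r i" using u vx c[OF i] by simp
        have y: "0 < y" using z ky by linarith
        \<comment> \<open>In terms of e the new weight is y^(-e) v^(1+e). Inserting the lower bound
          |f|^r v / c^r for y removes v^e and leaves v (c/|f|)^(r e), where r e = p - r.\<close>
        define e where "e = (ps i - r i) / r i"
        have e: "0 \<le> e" "ps i * \<gamma> i = e" "ps i / r i = 1 + e"
          using r_ps[OF i] r_pos[OF i] ps_pos[OF i] by (auto simp: e_def \<gamma>_def field_simps)
        have "w i x = y powr (- e) * v i x powr (1 + e)"
          by (simp add: w_def new_weight_def y_def e)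
        also have "y powr (- e) \<le> (norm (f i x) powr r i * v i x / c i powr r i) powr (- e)"
          using ky z e(1) by (intro powr_mono2') auto
        also have "(norm (f i x) powr r i * v i x / c i powr r i) powr (- e) * v i x powr (1 + e)
          = ((norm (f i x) powr r i / c i powr r i) powr (- e) * v i x powr (- e)) * (v i x * v i x powr e)"
          using vx by (simp add: powr_mult[symmetric] powr_add mult.commute)
        also have "\<dots> = (norm (f i x) powr r i / c i powr r i) powr (- e) * v i x * (v i x powr (- e) * v i x powr e)"
          by (simp add: mult_ac)
        also have "v i x powr (- e) * v i x powr e = 1" using vx by (simp add: powr_add[symmetric])
        also have "(norm (f i x) powr r i / c i powr r i) powr (- e) = (c i / norm (f i x)) powr (ps i - r i)"
        proof -
          have "(norm (f i x) powr r i / c i powr r i) powr (- e) = (c i powr r i / norm (f i x) powr r i) powr e"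
            using u c[OF i] by (simp add: powr_minus powr_divide)
          also have "\<dots> = ((c i / norm (f i x)) powr r i) powr e"
            using u c[OF i] by (simp add: powr_divide)
          also have "\<dots> = (c i / norm (f i x)) powr (ps i - r i)"
            using r_pos[OF i] by (simp add: powr_powr e_def)
          finally show ?thesis .
        qed
        finally show "w i x \<le> v i x * (c i / norm (f i x)) powr (ps i - r i)"
          by (simp add: mult.commute mult_right_mono)
      qed
    qed (use i v c wm \<alpha> r_ps r_pos in \<open>auto intro: less_imp_le\<close>)
    have np: "norm_prod (\<lambda>i. start_norm \<alpha> f w i) {1..m} \<le> ennreal (q * (\<Prod>i=1..m. c i))"
    proof -
      have "start_norm \<alpha> f w i \<noteq> \<infinity>" if "i \<in> {1..m}" for i
        using lor[OF that] by (auto simp: top_unique)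
      then have "norm_prod (\<lambda>i. start_norm \<alpha> f w i) {1..m}
        = (\<Prod>i=1..m. start_norm \<alpha> f w i)"
        by (auto simp: norm_prod_def)
      also have "\<dots> \<le> (\<Prod>i=1..m. ennreal ((ps i / r i) powr (1 / \<alpha> i) * c i))"
        by (intro prod_mono_ennreal lor)
      also have "\<dots> = ennreal (\<Prod>i=1..m. (ps i / r i) powr (1 / \<alpha> i) * c i)"
        by (intro prod_ennreal_eq mult_nonneg_nonneg powr_ge_zero less_imp_le[OF c] finite_atLeastAtMost)
      finally show ?thesis by (simp add: q_def prod.distrib)
    qed
    define Y where "Y = \<phi> T * (q * (\<Prod>i=1..m. c i))"
    have cp: "0 < (\<Prod>i=1..m. c i)" by (rule prod_pos) (rule c)
    have Y: "0 < Y" using \<phi>(1)[OF T] q cp by (simp add: Y_def)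
    have wY: "weak_lorentz_norm (weight_measure (prod_weight m ps w)) p g \<le> ennreal Y"
    proof -
      have "weak_lorentz_norm (weight_measure (prod_weight m ps w)) p g
        \<le> ennreal (\<phi> (enn2real (AR_const m ps r w))) *
           norm_prod (\<lambda>i. start_norm \<alpha> f w i) {1..m}"
        using hyp wclass unfolding hypothesis_def p_def by blast
      also have "\<dots> \<le> ennreal (\<phi> T) * ennreal (q * (\<Prod>i=1..m. c i))"
        using ARr T by (intro mult_mono np ennreal_leI mono_onD[OF \<phi>(2)]) auto
      also have "\<dots> = ennreal Y"
        using \<phi>(1)[OF T] q cp by (simp add: Y_def ennreal_mult)
      finally show ?thesis .
    qed
    have mix: "A1.mixed (1 - \<rho> * D) = weight_measure (prod_weight m r v)"
    proof -
      have "base v x powr (1 - (1 - \<rho> * D)) = prod_weight m r v x" for x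
        using V_eq_base[of v h x] v(2) h(2) by (simp add: prod_weight_r powr_powr mult.commute)
      then show ?thesis by (simp add: A1.mixed_def weight_measure_def)
    qed
    have "weak_lorentz_norm (weight_measure (prod_weight m r v)) \<rho> g \<le> ennreal ((M + 1) powr (1 / \<rho>) * Y)"
    proof (rule weak_norm_transfer[OF v h(1,2) g _ _ Y])
      show "ennreal s * emeasure (weight_measure (prod_weight m r v)) {x. s < h x * base v x powr (1 - \<rho> * D)} \<le> ennreal M"
        if "0 < s" for s
        using h(5)[OF that, of "1 - \<rho> * D"] rho_D by (simp add: mix)
    qed (use M wY in \<open>auto simp: w_def\<close>)
    also have "\<dots> \<le> ennreal (\<Psi> * (\<Prod>i=1..m. c i))"
    proof (intro ennreal_leI)
      have "(M + 1) powr (1 / \<rho>) * (\<phi> T * q) * (\<Prod>i=1..m. c i) \<le> \<Psi> * (\<Prod>i=1..m. c i)"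
        using cp by (intro mult_right_mono) (auto simp: \<Psi>_def)
      then show "(M + 1) powr (1 / \<rho>) * Y \<le> \<Psi> * (\<Prod>i=1..m. c i)" by (simp add: Y_def mult.assoc)
    qed
    finally show "weak_lorentz_norm (weight_measure (prod_weight m r v)) \<rho> g \<le> ennreal (\<Psi> * (\<Prod>i=1..m. c i))" .
  qed
qed

text \<open>Removes two normalizations of \<open>weak_type_positive\<close>. Weights positive almost
  everywhere are made positive everywhere by a change on a null set, which alters neither the
  measures nor the hypothesis. The positive bounds are taken as n_i + 1/(k+1), and k tends to
  infinity; an infinite norm makes the right-hand side infinite by convention.\<close>

lemma weak_type_bounded:
  fixes a :: real and \<alpha> :: "nat \<Rightarrow> real" and \<phi> :: "real \<Rightarrow> real"
  assumes a: "1 \<le> a" and \<alpha>: "\<And>i. i \<in> {1..m} \<Longrightarrow> 0 < \<alpha> i \<and> \<alpha> i \<le> ps i"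
    and \<phi>: "\<And>t. 0 < t \<Longrightarrow> 0 < \<phi> t" "mono_on {0<..} \<phi>"
  shows "\<exists>\<Psi>>0. \<forall>(v :: nat \<Rightarrow> real^'n \<Rightarrow> real) f g.
    (\<forall>i\<in>{1..m}. f i \<in> borel_measurable lebesgue) \<longrightarrow> g \<in> borel_measurable lebesgue \<longrightarrow>
    hypothesis \<alpha> \<phi> f g \<longrightarrow> v \<in> AR_class m r r \<longrightarrow> AR_const m r r v \<le> ennreal a \<longrightarrow>
    weak_lorentz_norm (weight_measure (prod_weight m r v)) \<rho> g
      \<le> ennreal \<Psi> * norm_prod (\<lambda>i. end_norm \<alpha> f v i) {1..m}"
proof -
  obtain \<Psi> where \<Psi>: "0 < \<Psi>" "\<And>(v :: nat \<Rightarrow> real^'n \<Rightarrow> real) f g c.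
    (\<forall>i\<in>{1..m}. v i \<in> borel_measurable lebesgue \<and> (\<forall>x. 0 < v i x) \<and> f i \<in> borel_measurable lebesgue \<and> 0 < c i \<and>
       end_norm \<alpha> f v i \<le> ennreal (c i)) \<Longrightarrow>
    g \<in> borel_measurable lebesgue \<Longrightarrow> cube_bound v a \<Longrightarrow> hypothesis \<alpha> \<phi> f g \<Longrightarrow>
    weak_lorentz_norm (weight_measure (prod_weight m r v)) \<rho> g \<le> ennreal (\<Psi> * (\<Prod>i=1..m. c i))"
    using weak_type_positive[OF a \<alpha> \<phi>, where 'n = 'n] by metis
  show ?thesis
  proof (intro exI[of _ \<Psi>] conjI allI impI \<Psi>(1))
    fix u :: "nat \<Rightarrow> real^'n \<Rightarrow> real" and f :: "nat \<Rightarrow> real^'n \<Rightarrow> complex" and g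
    assume f: "\<forall>i\<in>{1..m}. f i \<in> borel_measurable lebesgue" and g: "g \<in> borel_measurable lebesgue"
      and hyp: "hypothesis \<alpha> \<phi> f g" and u: "u \<in> AR_class m r r" and ua: "AR_const m r r u \<le> ennreal a"
    define v where "v i x = (if 0 < u i x then u i x else 1)" for i x
    have um: "u i \<in> borel_measurable lebesgue" and up: "AE x in lebesgue. 0 < u i x" if "i \<in> {1..m}" for i
      using u that by (auto simp: AR_class_def is_weight_def)
    have vm: "v i \<in> borel_measurable lebesgue" if "i \<in> {1..m}" for i
      unfolding v_def[abs_def] using um[OF that] by measurable
    have vpos: "0 < v i x" for i x by (simp add: v_def)
    have uv: "AE x in lebesgue. u i x = v i x" if "i \<in> {1..m}" for i
      using up[OF that] by (auto simp: v_def elim!: eventually_mono)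
    have cb: "cube_bound v a"
      using vm vpos um uv ua a by (intro cube_boundI[where u = u]) auto
    have wv: "weight_measure (u i) = weight_measure (v i)" if "i \<in> {1..m}" for i
      unfolding weight_measure_def using um[OF that] vm[OF that] uv[OF that]
      by (intro density_cong) (auto elim!: eventually_mono)
    have pv: "weight_measure (prod_weight m r u) = weight_measure (prod_weight m r v)"
    proof -
      have "AE x in lebesgue. \<forall>i\<in>{1..m}. u i x = v i x" using uv by (intro AE_finite_allI) auto
      then have "AE x in lebesgue. prod_weight m r u x = prod_weight m r v x"
        by (rule eventually_mono) (auto simp: prod_weight_def intro!: prod.cong)
      then show ?thesis
        unfolding weight_measure_def using um vm
        by (intro density_cong measurable_compose[OF borel_measurable_prod_weight measurable_ennreal])
          (auto elim!: eventually_mono)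
    qed
    define N where "N i = end_norm \<alpha> f u i" for i
    show "weak_lorentz_norm (weight_measure (prod_weight m r u)) \<rho> g
      \<le> ennreal \<Psi> * norm_prod (\<lambda>i. end_norm \<alpha> f u i) {1..m}"
    proof (cases "\<exists>i\<in>{1..m}. N i = \<infinity>")
      case True
      then have "norm_prod N {1..m} = \<infinity>" by (simp add: norm_prod_def)
      then show ?thesis using \<Psi>(1) unfolding N_def by (simp add: ennreal_mult_top)
    next
      case False
      define n where "n i = enn2real (N i)" for i
      have Nn: "N i = ennreal (n i)" if "i \<in> {1..m}" for i
        using False that by (auto simp: n_def less_top)
      have n0: "0 \<le> n i" for i by (simp add: n_def)
      have bound: "weak_lorentz_norm (weight_measure (prod_weight m r u)) \<rho> g
         \<le> ennreal (\<Psi> * (\<Prod>i=1..m. n i + 1 / real (Suc k)))" for k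
        unfolding pv
      proof (rule \<Psi>(2))
        show "\<forall>i\<in>{1..m}. v i \<in> borel_measurable lebesgue \<and> (\<forall>x. 0 < v i x) \<and> f i \<in> borel_measurable lebesgue \<and>
          0 < n i + 1 / real (Suc k) \<and>
          end_norm \<alpha> f v i \<le> ennreal (n i + 1 / real (Suc k))"
        proof (intro ballI conjI allI)
          fix i assume i: "i \<in> {1..m}"
          show "0 < n i + 1 / real (Suc k)" using n0[of i] by (intro add_nonneg_pos) auto
          have "end_norm \<alpha> f v i = ennreal (n i)"
            using Nn[OF i] wv[OF i] by (simp add: N_def)
          also have "\<dots> \<le> ennreal (n i + 1 / real (Suc k))" by (intro ennreal_leI) simp
          finally show "end_norm \<alpha> f v i \<le> ennreal (n i + 1 / real (Suc k))" .
        qed (use vm vpos f in auto)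
      qed (use g cb hyp in auto)
      have "(\<lambda>k. 1 / real (Suc k)) \<longlonglongrightarrow> 0" using LIMSEQ_inverse_real_of_nat by (simp add: inverse_eq_divide)
      then have "(\<lambda>k. ennreal (\<Psi> * (\<Prod>i=1..m. n i + 1 / real (Suc k)))) \<longlonglongrightarrow> ennreal (\<Psi> * (\<Prod>i=1..m. n i + 0))"
        by (intro tendsto_ennrealI tendsto_intros)
      then have "weak_lorentz_norm (weight_measure (prod_weight m r u)) \<rho> g \<le> ennreal (\<Psi> * (\<Prod>i=1..m. n i + 0))"
        by (rule LIMSEQ_le_const) (use bound in auto)
      also have "\<dots> = ennreal \<Psi> * (\<Prod>i=1..m. ennreal (n i))"
        using \<Psi>(1) n0 by (simp add: prod_ennreal_eq ennreal_mult prod_nonneg)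
      also have "(\<Prod>i=1..m. ennreal (n i)) = norm_prod N {1..m}"
        using False Nn by (simp add: norm_prod_def)
      finally show ?thesis unfolding N_def[abs_def] .
    qed
  qed
qed

end

theorem theorem1p2:
  fixes m :: nat and ps r \<alpha> :: "nat \<Rightarrow> real" and \<phi> :: "real \<Rightarrow> real"
  assumes "1 \<le> m"
    and "\<And>i. i \<in> {1..m} \<Longrightarrow> 1 \<le> r i \<and> r i \<le> ps i"
    and "1 \<le> r (m + 1)"
    and "1 / total_exp m ps > inv_conj (r (m + 1))"
    and "\<And>i. i \<in> {1..m} \<Longrightarrow> 0 < \<alpha> i \<and> \<alpha> i \<le> ps i"
    and "\<And>t. 0 < t \<Longrightarrow> 0 < \<phi> t" and "mono_on {0<..} \<phi>"
  shows "\<exists>\<psi> :: real \<Rightarrow> real. (\<forall>t>0. 0 < \<psi> t) \<and> mono_on {0<..} \<psi> \<and>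
    (\<forall>(f :: nat \<Rightarrow> real^'n \<Rightarrow> complex) (g :: real^'n \<Rightarrow> complex).
      (\<forall>i\<in>{1..m}. f i \<in> borel_measurable lebesgue) \<longrightarrow> g \<in> borel_measurable lebesgue \<longrightarrow>
      (\<forall>w \<in> AR_class m ps r.
        weak_lorentz_norm (weight_measure (prod_weight m ps w)) (total_exp m ps) g
        \<le> ennreal (\<phi> (enn2real (AR_const m ps r w))) *
           norm_prod (\<lambda>i. lorentz_norm (weight_measure (w i)) (ps i) (\<alpha> i) (f i)) {1..m}) \<longrightarrow>
      (\<forall>v \<in> AR_class m r r.
        weak_lorentz_norm (weight_measure (prod_weight m r v)) (total_exp m r) g
        \<le> ennreal (\<psi> (enn2real (AR_const m r r v))) *
           norm_prod (\<lambda>i. lorentz_norm (weight_measure (v i)) (r i) (\<alpha> i * r i / ps i) (f i)) {1..m}))"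
proof -
  interpret exponents m ps r
    using assms(1-4) by unfold_locales auto
  define works where "works a \<Psi> \<longleftrightarrow> 0 < \<Psi> \<and> (\<forall>(v :: nat \<Rightarrow> real^'n \<Rightarrow> real) f g.
    (\<forall>i\<in>{1..m}. f i \<in> borel_measurable lebesgue) \<longrightarrow> g \<in> borel_measurable lebesgue \<longrightarrow>
    hypothesis \<alpha> \<phi> f g \<longrightarrow> v \<in> AR_class m r r \<longrightarrow> AR_const m r r v \<le> ennreal a \<longrightarrow>
    weak_lorentz_norm (weight_measure (prod_weight m r v)) \<rho> g
      \<le> ennreal \<Psi> * norm_prod (\<lambda>i. end_norm \<alpha> f v i) {1..m})"
    for a \<Psi> :: real
  have "\<exists>\<Psi>. works (real k + 1) \<Psi>" for k
    unfolding works_def using weak_type_bounded[OF _ assms(5-7), of "real k + 1", where 'n = 'n] by auto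
  then obtain c where c: "\<And>k. works (real k + 1) (c k)" by metis
  have cpos: "0 < c k" for k using c[of k] by (simp add: works_def)
  \<comment> \<open>Constants for different integer bounds need not be comparable; summing them
    makes the function monotone. The index is shifted since the bound for \<open>c k\<close> is real
    k + 1, which is at least 1 and at least \<open>t\<close> for k = nat \<lceil>t\<rceil>.\<close>
  define \<psi> where "\<psi> t = (\<Sum>k\<le>nat \<lceil>t\<rceil>. c k)" for t :: real
  have "0 < \<psi> t" for t unfolding \<psi>_def using cpos by (intro sum_pos) auto
  moreover have "mono_on {0<..} \<psi>"
    unfolding \<psi>_def
  proof (rule mono_onI)
    fix s t :: real assume "s \<le> t"
    then have "nat \<lceil>s\<rceil> \<le> nat \<lceil>t\<rceil>" by (intro nat_mono ceiling_mono)
    then show "(\<Sum>k\<le>nat \<lceil>s\<rceil>. c k) \<le> (\<Sum>k\<le>nat \<lceil>t\<rceil>. c k)"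
      using cpos by (intro sum_mono2) (auto intro: less_imp_le)
  qed
  moreover have "weak_lorentz_norm (weight_measure (prod_weight m r v)) (total_exp m r) g
        \<le> ennreal (\<psi> (enn2real (AR_const m r r v))) *
           norm_prod (\<lambda>i. end_norm \<alpha> f v i) {1..m}"
    if f: "\<forall>i\<in>{1..m}. f i \<in> borel_measurable lebesgue" and g: "g \<in> borel_measurable lebesgue"
      and hyp: "hypothesis \<alpha> \<phi> f g" and v: "v \<in> AR_class m r r"
    for f :: "nat \<Rightarrow> real^'n \<Rightarrow> complex" and g :: "real^'n \<Rightarrow> complex" and v
  proof -
    define t where "t = enn2real (AR_const m r r v)"
    have "AR_const m r r v < \<infinity>" using v by (simp add: AR_class_def)
    then have "AR_const m r r v = ennreal t" by (simp add: t_def)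
    also have "\<dots> \<le> ennreal (real (nat \<lceil>t\<rceil>) + 1)" by (intro ennreal_leI) linarith
    finally have "weak_lorentz_norm (weight_measure (prod_weight m r v)) \<rho> g
      \<le> ennreal (c (nat \<lceil>t\<rceil>)) * norm_prod (\<lambda>i. end_norm \<alpha> f v i) {1..m}"
      using c[of "nat \<lceil>t\<rceil>"] f g hyp v unfolding works_def by blast
    also have "\<dots> \<le> ennreal (\<psi> t) * norm_prod (\<lambda>i. end_norm \<alpha> f v i) {1..m}"
    proof (intro mult_right_mono ennreal_leI)
      show "c (nat \<lceil>t\<rceil>) \<le> \<psi> t"
        unfolding \<psi>_def using cpos by (intro member_le_sum) (auto intro: less_imp_le)
    qed simp
    finally show ?thesis by (simp add: t_def \<rho>_def)
  qed
  ultimately show ?thesis unfolding hypothesis_def by (intro exI[of _ \<psi>]) blast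
qed

end
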